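(* Let $p_1,p_2\ge1$, $\alpha_1,\alpha_2>0$, $\mathbb{Q}\in\{\mathbb{T},\mathbb{H}\}$, $\beta=(\beta_1,\beta_2)\in\mathbb{R}^2$, $\gamma\ge0$ and $\nu>0$ be fixed, and let $n_2=\nu n_1$ with $n_1\to\infty$. Consider the matrices (nested case) $$A_{\mathbf n,\mathbf p}=\frac1\nu\,M^{\mathbb{Q}_{\alpha_2}}_{n_2,p_2}\otimes K^{\mathbb{Q}_{\alpha_1}}_{n_1,p_1}+\nu\,K^{\mathbb{Q}_{\alpha_2}}_{n_2,p_2}\otimes M^{\mathbb{Q}_{\alpha_1}}_{n_1,p_1}+\frac{\beta_1}{\nu n_1}\,M^{\mathbb{Q}_{\alpha_2}}_{n_2,p_2}\otimes H^{\mathbb{Q}_{\alpha_1}}_{n_1,p_1}+\frac{\beta_2}{n_1}\,H^{\mathbb{Q}_{\alpha_2}}_{n_2,p_2}\otimes M^{\mathbb{Q}_{\alpha_1}}_{n_1,p_1}+\frac{\gamma}{\nu n_1^2}\,M^{\mathbb{Q}_{\alpha_2}}_{n_2,p_2}\otimes M^{\mathbb{Q}_{\alpha_1}}_{n_1,p_1}.$$ Then the sequence $\{A_{\mathbf n,\mathbf p}\}_{n_1}$ is distributed in the sense of the eigenvalues like the function $g_{p_1,p_2}:[-\pi,\pi]^2\to\mathbb{R}$, $$g_{p_1,p_2}(\theta_1,\theta_2)=\frac1\nu\,h_{p_2}(\theta_1)f_{p_1}(\theta_2)+\nu\,f_{p_2}(\theta_1)h_{p_1}(\theta_2).$$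
   Context: GB-splines: For $\mu>0$ and $p\ge1$ let $\mathbb{P}^{\mathbb{T}_\mu}_p=\mathrm{span}\{1,x,\dots,x^{p-2},\cos(\mu x),\sin(\mu x)\}$ and $\mathbb{P}^{\mathbb{H}_\mu}_p=\mathrm{span}\{1,x,\dots,x^{p-2},\cosh(\mu x),\sinh(\mu x)\}$ (for $p=1$ only the two transcendental functions). For $n\ge2$ take the open uniform knots $s_1=\dots=s_{p+1}=0$, $s_{p+i+1}=i/n$ ($i=0,\dots,n$), $s_{n+p+1}=\dots=s_{n+2p+1}=1$. The GB-spline space consists of $C^{p-1}$ functions on $[0,1]$ whose restriction to each $[i/n,(i+1)/n]$ lies in $\mathbb{P}^{\mathbb{Q}_\mu}_p$; $N^{\mathbb{Q}_\mu}_{i,p}$, $i=1,\dots,n+p$, is its B-spline-type basis (nonnegative, $N^{\mathbb{Q}_\mu}_{i,p}$ supported on $[s_i,s_{i+p+1}]$, partition of unity). In the trigonometric case $\mu/n<\pi$ is assumed. With indices $i,j=1,\dots,n+p-2$: $K^{\mathbb{Q}_\mu}_{n,p}=[\frac1n\int_0^1(N^{\mathbb{Q}_\mu}_{j+1,p})'(N^{\mathbb{Q}_\mu}_{i+1,p})'dx]$, $H^{\mathbb{Q}_\mu}_{n,p}=[\int_0^1(N^{\mathbb{Q}_\mu}_{j+1,p})'N^{\mathbb{Q}_\mu}_{i+1,p}dx]$, $M^{\mathbb{Q}_\mu}_{n,p}=[n\int_0^1N^{\mathbb{Q}_\mu}_{j+1,p}N^{\mathbb{Q}_\mu}_{i+1,p}dx]$.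 In the nested case the phase parameter $\alpha_k$ is fixed independently of $n_k$. The matrix $A_{\mathbf n,\mathbf p}$ equals the Galerkin matrix $[a(\varphi_j,\varphi_i)]$ for $-\Delta u+\beta\cdot\nabla u+\gamma u=f$ on $(0,1)^2$ with $u=0$ on the boundary, $a(u,v)=\int\nabla u\cdot\nabla v+\int(\beta\cdot\nabla u)v+\gamma\int uv$, using the basis $\varphi_{(n_1+p_1-2)(j-1)+i}(x,y)=N^{\mathbb{Q}_{\alpha_1}}_{i+1,p_1}(x)N^{\mathbb{Q}_{\alpha_2}}_{j+1,p_2}(y)$ built on $n_1$ intervals in $x$ and $n_2$ in $y$; its size is $d=(n_1+p_1-2)(n_2+p_2-2)$. ($n_2$ is taken as the integer best approximating $\nu n_1$.) Symbols: let $\phi_q$ be the cardinal polynomial B-spline of degree $q$ with knots $0,1,\dots,q+1$ ($\phi_0=\mathbf 1_{[0,1)}$, $\phi_q(t)=\frac tq\phi_{q-1}(t)+\frac{q+1-t}{q}\phi_{q-1}(t-1)$); $h_p(\theta)=\phi_{2p+1}(p+1)+2\sum_{k=1}^p\phi_{2p+1}(p+1-k)\cos(k\theta)$ and $f_p(\theta)=-\phi''_{2p+1}(p+1)-2\sum_{k=1}^p\phi''_{2p+1}(p+1-k)\cos(k\theta)$. Eigenvalue distribution: a sequence $\{X_{n_1}\}$ of matrices of size $d_{n_1}\to\infty$ with eigenvalues $\lambda_j(X_{n_1})$ is distributed like $g:[-\pi,\pi]^2\to\mathbb{R}$ if for every continuous compactly supported $F:\mathbb{C}\to\mathbb{C}$,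 $\lim_{n_1\to\infty}\frac1{d_{n_1}}\sum_{j=1}^{d_{n_1}}F(\lambda_j(X_{n_1}))=\frac1{4\pi^2}\int_{[-\pi,\pi]^2}F(g(\theta_1,\theta_2))\,d\theta_1d\theta_2$. *)

theory Defs
  imports "HOL-Analysis.Analysis" "Jordan_Normal_Form.Char_Poly"
begin

datatype gbkind = Trig | Hyp

definition gbS :: "gbkind \<Rightarrow> real \<Rightarrow> real \<Rightarrow> real" where
  "gbS Q mu x = (case Q of Trig \<Rightarrow> sin (mu * x) | Hyp \<Rightarrow> sinh (mu * x))"

text \<open>Knots s_1 = ... = s_{p+1} = 0, s_{p+i+1} = i/n (i = 0..n), s_{n+p+1} = ... = s_{n+2p+1} = 1
  (1-based index k).\<close>
definition knot :: "nat \<Rightarrow> nat \<Rightarrow> nat \<Rightarrow> real" where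
  "knot n p k = (if k \<le> p + 1 then 0 else if k \<le> n + p + 1 then real (k - p - 1) / real n else 1)"

text \<open>gbspl Q mu n p q i: the i-th (1-based) GB-spline of degree q on the knot vector of the
  degree-p open uniform partition with n intervals; the basis functions of the statement are
  gbspl Q mu n p p i, i = 1..n+p.  Degree 1: the generalized hat functions in span{cos,sin}
  (resp. span{cosh,sinh}).  Degree q+1 (q >= 1): the standard integral recurrence
  N_{i,q+1} = Phi_{i,q} - Phi_{i+1,q}, Phi_{i,q}(x) = (int_{s_i}^x N_{i,q}) / (int N_{i,q}),
  where for a degenerate support (all its knots equal, only possible at 0 or 1) Phi_{i,q} is
  the limiting step function (identically 1 on [0,1] if the knot is 0, identically 0 on [0,1]
  if the knot is 1).\<close>
fun gbspl :: "gbkind \<Rightarrow> real \<Rightarrow> nat \<Rightarrow> nat \<Rightarrow> nat \<Rightarrow> nat \<Rightarrow> real \<Rightarrow> real" where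
  "gbspl Q mu n p 0 i x =
     (if knot n p i \<le> x \<and> x < knot n p (i+1) then 1 else 0)"
| "gbspl Q mu n p (Suc 0) i x =
     (let a = knot n p i; b = knot n p (i+1); c = knot n p (i+2) in
      if a < b \<and> a \<le> x \<and> (x < b \<or> (x = b \<and> b = 1 \<and> c = 1))
        then gbS Q mu (x - a) / gbS Q mu (b - a)
      else if b < c \<and> b \<le> x \<and> (x < c \<or> (x = c \<and> c = 1))
        then gbS Q mu (c - x) / gbS Q mu (c - b)
      else 0)"
| "gbspl Q mu n p (Suc (Suc q)) i x =
     (let Phi = (\<lambda>k. let a = knot n p k; b = knot n p (k + q + 2) in
                   if a < b
                   then integral {a..x} (\<lambda>y. gbspl Q mu n p (Suc q) k y)
                        / integral {a..b} (\<lambda>y. gbspl Q mu n p (Suc q) k y)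
                   else (if a < 1 \<and> a \<le> x then 1 else 0))
      in Phi i - Phi (i+1))"

definition GBN :: "gbkind \<Rightarrow> real \<Rightarrow> nat \<Rightarrow> nat \<Rightarrow> nat \<Rightarrow> real \<Rightarrow> real" where
  "GBN Q mu n p i = gbspl Q mu n p p i"

section \<open>Matrices (size n+p-2, 0-based entries (i,j) correspond to 1-based (i+1,j+1))\<close>

definition Kmat :: "gbkind \<Rightarrow> real \<Rightarrow> nat \<Rightarrow> nat \<Rightarrow> real mat" where
  "Kmat Q mu n p = mat (n + p - 2) (n + p - 2) (\<lambda>(i,j).
     (1 / real n) * integral {0..1} (\<lambda>x. deriv (GBN Q mu n p (j+2)) x * deriv (GBN Q mu n p (i+2)) x))"

definition Hmat :: "gbkind \<Rightarrow> real \<Rightarrow> nat \<Rightarrow> nat \<Rightarrow> real mat" where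
  "Hmat Q mu n p = mat (n + p - 2) (n + p - 2) (\<lambda>(i,j).
     integral {0..1} (\<lambda>x. deriv (GBN Q mu n p (j+2)) x * GBN Q mu n p (i+2) x))"

definition Mmat :: "gbkind \<Rightarrow> real \<Rightarrow> nat \<Rightarrow> nat \<Rightarrow> real mat" where
  "Mmat Q mu n p = mat (n + p - 2) (n + p - 2) (\<lambda>(i,j).
     real n * integral {0..1} (\<lambda>x. GBN Q mu n p (j+2) x * GBN Q mu n p (i+2) x))"

definition kron :: "'a :: times mat \<Rightarrow> 'a mat \<Rightarrow> 'a mat" where
  "kron X Y = mat (dim_row X * dim_row Y) (dim_col X * dim_col Y)
     (\<lambda>(r,c). X $$ (r div dim_row Y, c div dim_col Y) * Y $$ (r mod dim_row Y, c mod dim_col Y))"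

definition eigvals :: "real mat \<Rightarrow> complex multiset" where
  "eigvals A = proots (char_poly (map_mat complex_of_real A))"

fun cardB :: "nat \<Rightarrow> real \<Rightarrow> real" where
  "cardB 0 t = (if 0 \<le> t \<and> t < 1 then 1 else 0)"
| "cardB (Suc q) t = t / real (Suc q) * cardB q t + (real q + 2 - t) / real (Suc q) * cardB q (t - 1)"

definition hsym :: "nat \<Rightarrow> real \<Rightarrow> real" where
  "hsym p \<theta> = cardB (2*p+1) (real p + 1)
     + 2 * (\<Sum>k=1..p. cardB (2*p+1) (real p + 1 - real k) * cos (real k * \<theta>))"

definition fsym :: "nat \<Rightarrow> real \<Rightarrow> real" where
  "fsym p \<theta> = - deriv (deriv (cardB (2*p+1))) (real p + 1)
     - 2 * (\<Sum>k=1..p. deriv (deriv (cardB (2*p+1))) (real p + 1 - real k) * cos (real k * \<theta>))"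


definition n2of :: "real \<Rightarrow> nat \<Rightarrow> nat" where
  "n2of \<nu> n1 = nat (round (\<nu> * real n1))"

definition Amat :: "gbkind \<Rightarrow> real \<Rightarrow> real \<Rightarrow> nat \<Rightarrow> nat \<Rightarrow> real \<Rightarrow> real \<Rightarrow> real \<Rightarrow> real \<Rightarrow> nat \<Rightarrow> real mat" where
  "Amat Q \<alpha>1 \<alpha>2 p1 p2 \<beta>1 \<beta>2 \<gamma> \<nu> n1 = (let n2 = n2of \<nu> n1 in
        (1 / \<nu>) \<cdot>\<^sub>m kron (Mmat Q \<alpha>2 n2 p2) (Kmat Q \<alpha>1 n1 p1)
      + \<nu> \<cdot>\<^sub>m kron (Kmat Q \<alpha>2 n2 p2) (Mmat Q \<alpha>1 n1 p1)
      + (\<beta>1 / (\<nu> * real n1)) \<cdot>\<^sub>m kron (Mmat Q \<alpha>2 n2 p2) (Hmat Q \<alpha>1 n1 p1)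
      + (\<beta>2 / real n1) \<cdot>\<^sub>m kron (Hmat Q \<alpha>2 n2 p2) (Mmat Q \<alpha>1 n1 p1)
      + (\<gamma> / (\<nu> * (real n1)\<^sup>2)) \<cdot>\<^sub>m kron (Mmat Q \<alpha>2 n2 p2) (Mmat Q \<alpha>1 n1 p1))"

end

theory Submission
  imports Defs "Jordan_Normal_Form.Schur_Decomposition"
begin

text \<open>Moment method.  The matrices are two-level banded with bounded entries, and away from the
  boundary their entries converge to those of the Toeplitz matrix of the symbol \<open>g\<close>: at mesh
  width \<open>1/n\<close> a GB-spline only sees the phase \<open>\<mu>/n\<close>, so it converges uniformly to a polynomial
  B-spline.  Hence entries of the \<open>k\<close>-th power of the matrix far from the boundary converge to
  Fourier coefficients of \<open>g^k\<close>, and the normalised trace converges to the mean of \<open>g^k\<close>.  The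
  skew-symmetric part is \<open>O(1/n)\<close>, so imaginary parts of eigenvalues vanish in the limit, and
  Weierstrass approximation on a real interval passes from monomials to continuous \<open>F\<close>.\<close>

section \<open>Cardinal B-splines\<close>

text \<open>The defining recurrence divides by integrals over supports, and near the boundary these
  supports shrink and degenerate. Closeness to polynomial splines must therefore pass from one
  degree to the next relative to the support length and uniformly in the index. That works because
  the integral of a polynomial spline of degree \<open>q\<close> is exactly its support length
  divided by \<open>q + 1\<close>. The recurrence does not reproduce this fact by itself: the
  integral in the next degree needs a first moment, the next one a second moment, and so on, so the
  formula is proved for all moments at once. No rate of convergence is needed. The error
  \<open>e\<close> is a free parameter that grows by a fixed factor per degree, and the phase
  restriction of the trigonometric case appears only as positivity of
  \<open>gbS Q mu (1 / real n)\<close>, which holds for large \<open>n\<close>. Exact limits are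
  computed only for splines with equally spaced knots; boundary entries need no more than a bound,
  since they are too few to affect a normalised trace.\<close>

lemma cardB_support: "t < 0 \<or> t \<ge> real q + 1 \<Longrightarrow> cardB q t = 0"
  by (induction q arbitrary: t) (auto split: if_splits)

lemma cardB_nonneg: "0 \<le> cardB q t"
proof (induction q arbitrary: t)
  case (Suc q)
  have "0 \<le> t / real (Suc q) * cardB q t"
    using Suc[of t] cardB_support[of t q] by (cases "t < 0") auto
  moreover have "0 \<le> (real q + 2 - t) / real (Suc q) * cardB q (t - 1)"
    using Suc[of "t - 1"] cardB_support[of "t - 1" q] by (cases "t > real q + 2") auto
  ultimately show ?case by simp
qed simp

text \<open>Each coefficient of the recurrence is at most 1 on the support of its factor, so the
  bound doubles per degree. Any bound would do; it serves integrability.\<close>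

lemma cardB_le: "cardB q t \<le> 2 ^ q"
proof (induction q arbitrary: t)
  case (Suc q)
  have "t / real (Suc q) * cardB q t \<le> 2 ^ q"
  proof (cases "0 \<le> t \<and> t < real q + 1")
    case True
    then have "t / real (Suc q) * cardB q t \<le> 1 * cardB q t"
      by (intro mult_right_mono cardB_nonneg) auto
    then show ?thesis using Suc[of t] by simp
  qed (use cardB_support[of t q] in auto)
  moreover have "(real q + 2 - t) / real (Suc q) * cardB q (t - 1) \<le> 2 ^ q"
  proof (cases "0 \<le> t - 1 \<and> t - 1 < real q + 1")
    case True
    then have "(real q + 2 - t) / real (Suc q) * cardB q (t - 1) \<le> 1 * cardB q (t - 1)"
      by (intro mult_right_mono cardB_nonneg) auto
    then show ?thesis using Suc[of "t - 1"] by simp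
  qed (use cardB_support[of "t - 1" q] in auto)
  ultimately show ?case by simp
qed simp

lemma cardB_borel [measurable]: "cardB q \<in> borel_measurable borel"
proof (induction q)
  case 0
  have "cardB 0 = indicator {0..<1}" by (auto simp: fun_eq_iff indicator_def)
  then show ?case by simp
next
  case (Suc q)
  note [measurable] = Suc
  have "cardB (Suc q) = (\<lambda>t. t / real (Suc q) * cardB q t + (real q + 2 - t) / real (Suc q) * cardB q (t - 1))"
    by (simp add: fun_eq_iff)
  then show ?case by simp
qed

lemma cardB_1: "cardB (Suc 0) t = max 0 (min t (2 - t))"
  by (auto simp: max_def min_def)

section \<open>Continuity and derivatives of cardinal B-splines\<close>

lemma cardB_isCont: "isCont (cardB (Suc q)) t"
proof (induction q arbitrary: t)
  case 0
  have "cardB (Suc 0) = (\<lambda>t. max 0 (min t (2 - t)))" using cardB_1 by blast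
  then show ?case by (auto intro!: continuous_intros)
next
  case (Suc q)
  have "cardB (Suc (Suc q)) = (\<lambda>t. t / real (Suc (Suc q)) * cardB (Suc q) t
      + (real (Suc q) + 2 - t) / real (Suc (Suc q)) * cardB (Suc q) (t - 1))"
    by (rule ext) simp
  moreover have "isCont (\<lambda>t. cardB (Suc q) (t - 1)) t"
    by (rule isCont_o2[OF _ Suc]) (auto intro!: continuous_intros)
  ultimately show ?case using Suc[of t] by (auto intro!: continuous_intros)
qed

text \<open>Degree 1 has corners at integers, so a formula for all degrees has to avoid them. The
  induction differentiates the recurrence and removes the leftover terms by the recurrence one
  degree lower, taken at \<open>t\<close> and at \<open>t - 1\<close>.\<close>

lemma cardB_DERIV_nonint:
  "t \<notin> \<int> \<Longrightarrow> (cardB (Suc q) has_real_derivative cardB q t - cardB q (t - 1)) (at t)"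
proof (induction q arbitrary: t)
  case 0
  define m where "m = \<lfloor>t\<rfloor>"
  have "of_int m \<noteq> t" using 0 by (metis Ints_of_int)
  then have tm: "of_int m < t" "t < of_int m + 1" unfolding m_def by linarith+
  \<comment> \<open>Between two consecutive integers the hat is a single affine function.\<close>
  define f where "f = (\<lambda>t::real. if m = 0 then t else if m = 1 then 2 - t else 0)"
  have "(f has_real_derivative cardB 0 t - cardB 0 (t - 1)) (at t)"
  proof -
    consider "m = 0" | "m = 1" | "m < 0" | "m \<ge> 2" by linarith
    then show ?thesis
      using tm by cases (auto simp: f_def intro!: derivative_eq_intros)
  qed
  moreover have "eventually (\<lambda>u. f u = cardB (Suc 0) u) (nhds t)"
  proof -
    have "eventually (\<lambda>u. u \<in> {of_int m <..< of_int m + 1}) (nhds t)"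
      using tm by (intro eventually_nhds_in_open) auto
    then show ?thesis
    proof eventually_elim
      case (elim u)
      consider "m = 0" | "m = 1" | "m < 0" | "m \<ge> 2" by linarith
      then show ?case using elim unfolding cardB_1 f_def
        by cases auto
    qed
  qed
  ultimately show ?case
    by (subst (asm) DERIV_cong_ev[OF refl _ refl])
next
  case (Suc q)
  have t1: "t - 1 \<notin> \<int>" using Suc.prems by (metis Ints_1 Ints_add diff_add_cancel)
  have eq: "cardB (Suc (Suc q)) = (\<lambda>t. (t * cardB (Suc q) t
      + (real q + 3 - t) * cardB (Suc q) (t - 1)) / (real q + 2))"
    by (rule ext, subst cardB.simps(2)) (simp add: add_divide_distrib ac_simps del: cardB.simps)
  have d1: "(cardB (Suc q) has_real_derivative cardB q t - cardB q (t - 1)) (at t)"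
    by (rule Suc.IH[OF Suc.prems])
  have "((\<lambda>t. cardB (Suc q) (t - 1)) has_real_derivative (cardB q (t - 1) - cardB q (t - 2)) * 1) (at t)"
    using Suc.IH[OF t1]
    by (intro DERIV_chain2[where f = "cardB (Suc q)"])
      (auto intro!: derivative_eq_intros simp del: cardB.simps)
  then have d2: "((\<lambda>t. cardB (Suc q) (t - 1)) has_real_derivative cardB q (t - 1) - cardB q (t - 2)) (at t)"
    by simp
  have mulS: "real (Suc q) * (u / real (Suc q) * A + v / real (Suc q) * B) = u * A + v * B" for u v A B
    by (simp add: distrib_left del: of_nat_Suc)
  have rec: "real (Suc q) * cardB (Suc q) u = u * cardB q u + (real q + 2 - u) * cardB q (u - 1)" for u
    unfolding cardB.simps(2) by (rule mulS)
  have "(real q + 1) * cardB (Suc q) t = t * cardB q t + (real q + 2 - t) * cardB q (t - 1)"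
    and "(real q + 1) * cardB (Suc q) (t - 1) = (t - 1) * cardB q (t - 1) + (real q + 3 - t) * cardB q (t - 2)"
    using rec[of t] rec[of "t - 1"] by (simp_all add: algebra_simps del: cardB.simps)
  then have "cardB (Suc q) t + (cardB q t - cardB q (t - 1)) * t
      + (- cardB (Suc q) (t - 1) + (cardB q (t - 1) - cardB q (t - 2)) * (real q + 3 - t))
      = (cardB (Suc q) t - cardB (Suc q) (t - 1)) * (real q + 2)"
    by (simp add: algebra_simps del: cardB.simps)
  moreover have "((\<lambda>t. t * cardB (Suc q) t + (real q + 3 - t) * cardB (Suc q) (t - 1)) has_real_derivative
      cardB (Suc q) t + (cardB q t - cardB q (t - 1)) * t
      + (- cardB (Suc q) (t - 1) + (cardB q (t - 1) - cardB q (t - 2)) * (real q + 3 - t))) (at t)"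
    by (rule derivative_eq_intros d1 d2 refl | simp del: cardB.simps)+
  ultimately show ?case unfolding eq
    using DERIV_cdivide[where c = "real q + 2"] by fastforce
qed

text \<open>These are the mesh points. They serve as exceptional set in the fundamental theorem of
  calculus and as a null set for derivatives.\<close>

lemma finite_Ints_affine:
  fixes n :: real
  assumes "n > 0" shows "finite {x \<in> {a..b}. n * x - c \<in> \<int>}"
proof (rule finite_imageD)
  have "(\<lambda>x. n * x - c) ` {x \<in> {a..b}. n * x - c \<in> \<int>} \<subseteq> {y \<in> \<int>. n * a - c \<le> y \<and> y \<le> n * b - c}"
    using assms by auto
  then show "finite ((\<lambda>x. n * x - c) ` {x \<in> {a..b}. n * x - c \<in> \<int>})"
    by (rule finite_subset) (rule finite_int_segment)
  show "inj_on (\<lambda>x. n * x - c) {x \<in> {a..b}. n * x - c \<in> \<int>}"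
    using assms by (auto simp: inj_on_def)
qed

text \<open>The fundamental theorem of calculus with finitely many exceptional points also covers
  degree 0, where the integrand jumps at the knots.\<close>
lemma cardB_affine_has_integral:
  assumes "n > 0" "a \<le> b"
  shows "((\<lambda>y. n * (cardB q (n * y - c) - cardB q (n * y - c - 1))) has_integral
    cardB (Suc q) (n * b - c) - cardB (Suc q) (n * a - c)) {a..b}"
proof (rule fundamental_theorem_of_calculus_interior_strong[OF finite_Ints_affine[OF assms(1), of a b c] assms(2)])
  fix x assume "x \<in> {a<..<b} - {x \<in> {a..b}. n * x - c \<in> \<int>}"
  then have "n * x - c \<notin> \<int>" by auto
  from cardB_DERIV_nonint[OF this, of q]
  have "((\<lambda>x. cardB (Suc q) (n * x - c)) has_real_derivative
     (cardB q (n * x - c) - cardB q (n * x - c - 1)) * n) (at x)"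
    by (rule DERIV_chain2) (auto intro!: derivative_eq_intros)
  then show "((\<lambda>x. cardB (Suc q) (n * x - c)) has_vector_derivative
     n * (cardB q (n * x - c) - cardB q (n * x - c - 1))) (at x)"
    by (simp add: has_real_derivative_iff_has_vector_derivative mult.commute)
next
  show "continuous_on {a..b} (\<lambda>x. cardB (Suc q) (n * x - c))"
    by (intro continuous_at_imp_continuous_on ballI isCont_o2[OF _ cardB_isCont]) (auto intro!: continuous_intros)
qed

text \<open>From degree 2 on the formula holds at knots as well: its right-hand side is continuous,
  so the primitive is differentiable everywhere. The base point \<open>t - 1\<close> merely has to
  lie to the left of \<open>t\<close>.\<close>

lemma cardB_DERIV:
  "(cardB (Suc (Suc q)) has_real_derivative cardB (Suc q) t - cardB (Suc q) (t - 1)) (at t)"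
proof -
  let ?g = "\<lambda>y. cardB (Suc q) y - cardB (Suc q) (y - 1)"
  have cont: "isCont ?g y" for y
    by (intro continuous_intros cardB_isCont isCont_o2[OF _ cardB_isCont])
  have "((\<lambda>u. integral {t - 1..u} ?g) has_real_derivative ?g t) (at t within {t - 1..t + 1})"
    using cont by (intro integral_has_real_derivative continuous_at_imp_continuous_on) auto
  then have "((\<lambda>u. integral {t - 1..u} ?g) has_real_derivative ?g t) (at t)"
    by (simp add: at_within_Icc_at)
  then have "((\<lambda>u. cardB (Suc (Suc q)) (t - 1) + integral {t - 1..u} ?g) has_real_derivative ?g t) (at t)"
    by (auto intro!: derivative_eq_intros)
  moreover have "eventually (\<lambda>u. cardB (Suc (Suc q)) (t - 1) + integral {t - 1..u} ?g = cardB (Suc (Suc q)) u) (nhds t)"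
  proof -
    have "eventually (\<lambda>u. u \<in> {t - 1 <..}) (nhds t)"
      by (intro eventually_nhds_in_open) auto
    then show ?thesis
    proof eventually_elim
      case (elim u)
      then show ?case
        using integral_unique[OF cardB_affine_has_integral[of 1 "t - 1" u "Suc q" 0]]
        by (simp del: cardB.simps)
    qed
  qed
  ultimately show ?thesis
    by (subst (asm) DERIV_cong_ev[OF refl _ refl])
qed

text \<open>Degree \<open>q + 3\<close> makes the second derivative exist everywhere as a difference
  of continuous splines. Since \<open>2 * p + 1 = (2 * p - 2) + 3\<close>, every \<open>p\<close>
  from 1 on is covered.\<close>

lemma deriv2_cardB:
  "deriv (deriv (cardB (Suc (Suc (Suc q))))) t
    = cardB (Suc q) t - 2 * cardB (Suc q) (t - 1) + cardB (Suc q) (t - 2)"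
proof -
  have "deriv (cardB (Suc (Suc (Suc q)))) = (\<lambda>t. cardB (Suc (Suc q)) t - cardB (Suc (Suc q)) (t - 1))"
    by (rule ext, rule DERIV_imp_deriv, rule cardB_DERIV)
  moreover have "((\<lambda>t. cardB (Suc (Suc q)) (t - 1)) has_real_derivative
      (cardB (Suc q) (t - 1) - cardB (Suc q) (t - 1 - 1)) * 1) (at t)"
    by (rule DERIV_chain2[OF cardB_DERIV]) (auto intro!: derivative_eq_intros)
  then have "((\<lambda>t. cardB (Suc (Suc q)) t - cardB (Suc (Suc q)) (t - 1)) has_real_derivative
      cardB (Suc q) t - 2 * cardB (Suc q) (t - 1) + cardB (Suc q) (t - 2)) (at t)"
    using DERIV_diff[OF cardB_DERIV[of "q" t]] by (fastforce simp del: cardB.simps simp: algebra_simps)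
  ultimately show ?thesis by (metis DERIV_imp_deriv)
qed

text \<open>Degree 0 is left out because its half-open indicator is not symmetric at the two end
  points.\<close>

lemma cardB_sym: "cardB (Suc q) (real q + 2 - t) = cardB (Suc q) t"
proof (induction q arbitrary: t)
  case 0
  then show ?case unfolding cardB_1 by auto
next
  case (Suc q)
  have "cardB (Suc q) (real q + 3 - t - 1) = cardB (Suc q) t"
    using Suc[of t] by (simp add: algebra_simps del: cardB.simps)
  moreover have "cardB (Suc q) (real q + 3 - t) = cardB (Suc q) (t - 1)"
    using Suc[of "t - 1"] by (simp add: algebra_simps del: cardB.simps)
  ultimately show ?case
    by (subst (1 2) cardB.simps(2)) (simp add: algebra_simps del: cardB.simps)
qed

section \<open>Convolution and correlation of cardinal B-splines\<close>

lemma integrable_cardB_mult: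
  assumes [measurable]: "g \<in> borel_measurable borel" and "\<And>x. \<bar>g x\<bar> \<le> B"
  shows "integrable lborel (\<lambda>x. cardB q x * g x)"
proof (rule Bochner_Integration.integrable_bound)
  show "integrable lborel (\<lambda>x. 2 ^ q * B * indicator {0..real q + 1} x :: real)"
    by (intro integrable_mult_right integrable_real_indicator) auto
  show "AE x in lborel. norm (cardB q x * g x) \<le> norm (2 ^ q * B * indicator {0..real q + 1} x :: real)"
  proof (rule AE_I2)
    fix x
    have "0 \<le> B" using assms(2)[of 0] by linarith
    moreover have "\<bar>cardB q x\<bar> * \<bar>g x\<bar> \<le> 2 ^ q * B"
      using assms(2)[of x] cardB_le[of q x] cardB_nonneg[of q x] by (intro mult_mono) auto
    ultimately show "norm (cardB q x * g x) \<le> norm (2 ^ q * B * indicator {0..real q + 1} x :: real)"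
      using cardB_support[of x q] by (cases "x \<in> {0..real q + 1}") (auto simp: abs_mult)
  qed
qed simp

text \<open>Convolution with the box function, which the two-term recurrence hides. The derivative
  formula is integrated from -1, where the spline vanishes, and the two shifted integrals telescope
  to one over a unit interval.\<close>

lemma cardB_Suc_average:
  "cardB (Suc q) (t + 1) = (\<integral>s. indicator {0..1} s * cardB q (t + s) \<partial>lborel)"
proof -
  have int: "set_integrable lborel {a..b} (\<lambda>y. cardB q (y - c))" for a b c
    unfolding set_integrable_def
  proof (rule Bochner_Integration.integrable_bound)
    show "integrable lborel (\<lambda>x. 2 ^ q * indicator {a..b} x :: real)"
      by (intro integrable_mult_right integrable_real_indicator) (auto simp: emeasure_lborel_Icc_eq)
    show "AE x in lborel. norm (indicat_real {a..b} x *\<^sub>R cardB q (x - c)) \<le> norm (2 ^ q * indicator {a..b} x :: real)"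
      using cardB_le[of q] cardB_nonneg[of q] by (auto split: split_indicator)
  qed simp
  show ?thesis
  proof (cases "t < -1")
    case True
    then have "(\<lambda>s. indicator {0..1} s * cardB q (t + s)) = (\<lambda>s. 0)"
      by (auto simp: fun_eq_iff cardB_support split: split_indicator)
    then show ?thesis using True by (simp add: cardB_support del: cardB.simps)
  next
    case False
    let ?I = "\<lambda>a b. integral {a..b} (cardB q)"
    have hk: "cardB q integrable_on {a..b}" for a b
      using set_borel_integral_eq_integral(1)[OF int[of a b 0]] by simp
    have "cardB (Suc q) (t + 1) = integral {-1..t + 1} (\<lambda>y. cardB q y - cardB q (y - 1))"
      using integral_unique[OF cardB_affine_has_integral[of 1 "-1" "t + 1" q 0]] False
      by (simp add: cardB_support del: cardB.simps)
    also have "\<dots> = ?I (-1) (t + 1) - integral {-1..t + 1} (\<lambda>y. cardB q (y - 1))"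
      using set_borel_integral_eq_integral(1)[OF int[of _ _ 1]]
      by (intro integral_diff hk) auto
    also have "integral {-1..t + 1} (\<lambda>y. cardB q (y - 1)) = ?I (-2) t"
      using has_integral_affinity[OF integrable_integral[OF hk[of "-2" t], folded box_real(2)], of 1 "-1"]
      by (simp add: integral_unique)
    also have "?I (-2) t = ?I (-2) (-1) + ?I (-1) t"
      using False by (intro Henstock_Kurzweil_Integration.integral_combine[symmetric] hk) auto
    also have "?I (-2) (-1) = integral {-2..-1::real} (\<lambda>_. 0)"
      by (rule integral_cong) (auto simp: cardB_support)
    also have "?I (-1) (t + 1) = ?I (-1) t + ?I t (t + 1)"
      using False by (intro Henstock_Kurzweil_Integration.integral_combine[symmetric] hk) auto
    also have "?I (-1) t + ?I t (t + 1) - (integral {-2..-1::real} (\<lambda>_. 0) + ?I (-1) t) = ?I t (t + 1)" by simp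
    also have "\<dots> = (\<integral>s. indicator {t..t+1} s * cardB q s \<partial>lborel)"
      using set_borel_integral_eq_integral(2)[OF int[of t "t + 1" 0]]
      by (simp add: set_lebesgue_integral_def)
    also have "\<dots> = (\<integral>s. indicator {t..t+1} (t + s) * cardB q (t + s) \<partial>lborel)"
      by (subst lborel_integral_real_affine[where c = 1 and t = t]) simp_all
    also have "\<dots> = (\<integral>s. indicator {0..1} s * cardB q (t + s) \<partial>lborel)"
      by (intro Bochner_Integration.integral_cong) (auto split: split_indicator)
    finally show ?thesis .
  qed
qed

lemma cardB_Suc_average':
  "cardB (Suc q) t = (\<integral>s. indicator {0..1} s * cardB q (t - s) \<partial>lborel)"
  using cardB_Suc_average[of q "t - 1"]
  by (subst (asm) lborel_integral_real_affine[where c = "-1" and t = 1])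
    (auto simp: indicator_def algebra_simps intro!: Bochner_Integration.integral_cong simp del: cardB.simps)

text \<open>By Fubini, one more box average of the first factor is one more box average of the
  correlation, which raises its degree by one. Gram integrals of degree \<open>p\<close> thus become
  values of degree \<open>2 * p + 1\<close>, the form in which the symbols are given.\<close>

lemma cardB_correlation:
  "(\<integral>t. cardB a t * cardB b (t + y) \<partial>lborel) = cardB (a + b + 1) (real a + 1 + y)"
proof (induction a arbitrary: y)
  case 0
  have "(\<integral>t. cardB 0 t * cardB b (t + y) \<partial>lborel) = (\<integral>t. indicator {0..1} t * cardB b (y + t) \<partial>lborel)"
  proof (rule integral_cong_AE)
    have "AE t in lborel. t \<noteq> (1::real)" by (rule AE_lborel_singleton)
    then show "AE t in lborel. cardB 0 t * cardB b (t + y) = indicator {0..1} t * cardB b (y + t)"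
      by eventually_elim (auto simp: add.commute)
  qed auto
  also have "\<dots> = cardB (Suc b) (y + 1)" by (rule cardB_Suc_average[symmetric])
  finally show ?case by (simp add: add.commute del: cardB.simps)
next
  case (Suc a)
  let ?F = "\<lambda>t s. indicator {0..1} s * (cardB a (t - s) * cardB b (t + y))"
  have int: "integrable (lborel \<Otimes>\<^sub>M lborel) (\<lambda>(t, s). ?F t s)"
  proof (rule Bochner_Integration.integrable_bound)
    show "integrable (lborel \<Otimes>\<^sub>M lborel) (\<lambda>x. 2 ^ a * 2 ^ b * indicator ({0..real a + 2} \<times> {0..1::real}) x :: real)"
      by (intro integrable_mult_right integrable_real_indicator)
        (auto simp: lborel.emeasure_pair_measure_Times ennreal_mult_less_top)
    show "(\<lambda>(t, s). ?F t s) \<in> borel_measurable (lborel \<Otimes>\<^sub>M lborel)" by measurable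
    show "AE x in lborel \<Otimes>\<^sub>M lborel. norm ((\<lambda>(t, s). ?F t s) x) \<le>
        norm (2 ^ a * 2 ^ b * indicator ({0..real a + 2} \<times> {0..1::real}) x :: real)"
    proof (rule AE_I2)
      fix x :: "real \<times> real"
      obtain t s where x: "x = (t, s)" by force
      have "\<bar>cardB a (t - s)\<bar> * \<bar>cardB b (t + y)\<bar> \<le> 2 ^ a * 2 ^ b"
        using cardB_le[of a] cardB_nonneg[of a] cardB_le[of b] cardB_nonneg[of b] by (intro mult_mono) auto
      then show "norm ((\<lambda>(t, s). ?F t s) x) \<le> norm (2 ^ a * 2 ^ b * indicator ({0..real a + 2} \<times> {0..1::real}) x :: real)"
        using cardB_support[of "t - s" a] by (auto simp: x abs_mult split: split_indicator)
    qed
  qed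
  have "(\<integral>t. cardB (Suc a) t * cardB b (t + y) \<partial>lborel) = (\<integral>t. (\<integral>s. ?F t s \<partial>lborel) \<partial>lborel)"
    unfolding cardB_Suc_average' by (simp add: mult.assoc[symmetric] del: cardB.simps)
  also have "\<dots> = (\<integral>s. (\<integral>t. ?F t s \<partial>lborel) \<partial>lborel)"
    by (rule lborel_pair.Fubini_integral[OF int, symmetric])
  also have "\<dots> = (\<integral>s. indicator {0..1} s * cardB (a + b + 1) (real a + 1 + y + s) \<partial>lborel)"
  proof (rule Bochner_Integration.integral_cong[OF refl])
    fix s :: real
    have "(\<integral>t. cardB a (t - s) * cardB b (t + y) \<partial>lborel) = (\<integral>t. cardB a t * cardB b (t + (y + s)) \<partial>lborel)"
      by (subst lborel_integral_real_affine[where c = 1 and t = s]) (simp_all add: ac_simps)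
    also have "\<dots> = cardB (a + b + 1) (real a + 1 + (y + s))" by (rule Suc)
    finally show "(\<integral>t. ?F t s \<partial>lborel) = indicator {0..1} s * cardB (a + b + 1) (real a + 1 + y + s)"
      by (simp add: add.assoc del: cardB.simps)
  qed
  also have "\<dots> = cardB (Suc (a + b + 1)) (real a + 1 + y + 1)"
    by (rule cardB_Suc_average[symmetric])
  finally show ?case by (simp add: ac_simps del: cardB.simps)
qed

section \<open>Polynomial B-splines on open uniform knots\<close>

text \<open>Truncated subtraction absorbs the repeated knots at 0 and \<open>min\<close> those at 1,
  so no case distinction on the index is left.\<close>

lemma knot_eq: "n > 0 \<Longrightarrow> knot n p k = real (min (k - p - 1) n) / real n"
  by (auto simp: knot_def min_def)

lemma knot_mono: "n > 0 \<Longrightarrow> k \<le> l \<Longrightarrow> knot n p k \<le> knot n p l"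
  by (auto simp: knot_eq intro!: divide_right_mono)

lemma knot_bounds: "n > 0 \<Longrightarrow> 0 \<le> knot n p k" "n > 0 \<Longrightarrow> knot n p k \<le> 1"
  by (auto simp: knot_eq)

lemma knot_diff_le: "n > 0 \<Longrightarrow> knot n p (k + m) - knot n p k \<le> real m / real n"
  by (auto simp: knot_eq diff_divide_distrib[symmetric] intro!: divide_right_mono)

text \<open>A non-degenerate support is at least one mesh interval long, also at the boundary; every
  division by a support length costs at most a factor \<open>n\<close>.\<close>

lemma knot_gap: "n > 0 \<Longrightarrow> knot n p k < knot n p l \<Longrightarrow> 1 / real n \<le> knot n p l - knot n p k"
  by (auto simp: knot_eq diff_divide_distrib[symmetric] divide_less_cancel intro!: divide_right_mono)

lemma knot_degenerate:
  assumes "n > 0" "k < l" "knot n p k = knot n p l" shows "knot n p k = 0 \<or> knot n p k = 1"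
proof -
  have "min (k - p - 1) n = min (l - p - 1) n" using assms by (simp add: knot_eq)
  then have "k - p - 1 = 0 \<or> n \<le> k - p - 1" using assms(2) by linarith
  then show ?thesis using assms(1) by (auto simp: knot_eq)
qed

lemma knot_Ints: "n > 0 \<Longrightarrow> real n * knot n p k \<in> \<int>"
  by (simp add: knot_eq)

text \<open>The complete homogeneous symmetric polynomial of degree \<open>m\<close> in \<open>s i, \<dots>, s (i + k)\<close>;
  up to a binomial factor it is the \<open>m\<close>-th moment of the B-spline density on these knots.\<close>
fun hs :: "(nat \<Rightarrow> real) \<Rightarrow> nat \<Rightarrow> nat \<Rightarrow> nat \<Rightarrow> real" where
  "hs s i k 0 = 1"
| "hs s i 0 (Suc m) = s i ^ Suc m"
| "hs s i (Suc k) (Suc m) = hs s i k (Suc m) + s (i + k + 1) * hs s i (Suc k) m"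

text \<open>The definition splits off the last variable; by symmetry of the polynomial the first one
  can be split off too. Both recursions are unfolded against each other, which explains the
  induction on \<open>k + m\<close>.\<close>

lemma hs_remove_first: "hs s i (Suc k) (Suc m) = hs s (Suc i) k (Suc m) + s i * hs s i (Suc k) m"
proof (induction "k + m" arbitrary: k m rule: less_induct)
  case less
  show ?case
  proof (cases k; cases m)
    assume [simp]: "k = 0" "m = 0"
    show ?thesis by simp
  next
    fix m' assume [simp]: "k = 0" "m = Suc m'"
    show ?thesis using arg_cong[OF less[of 0 m'], of "\<lambda>z. s (Suc i) * z"] by (simp add: algebra_simps)
  next
    fix k' assume [simp]: "k = Suc k'" "m = 0"
    show ?thesis using less[of k' 0] by (simp add: algebra_simps)
  next
    fix k' m' assume k: "k = Suc k'" and m: "m = Suc m'"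
    let ?S = "s (i + k + 1)"
    have e1: "hs s i (Suc k) (Suc m) = hs s i k (Suc m) + ?S * hs s i (Suc k) m"
      and e2: "hs s (Suc i) k (Suc m) = hs s (Suc i) k' (Suc m) + ?S * hs s (Suc i) k m"
      and e3: "hs s i (Suc k) m = hs s i k m + ?S * hs s i (Suc k) m'"
      by (simp_all add: k m)
    have i1: "hs s i k (Suc m) = hs s (Suc i) k' (Suc m) + s i * hs s i k m"
      using less[of k' m] by (simp add: k del: hs.simps)
    have i2: "hs s i (Suc k) m = hs s (Suc i) k m + s i * hs s i (Suc k) m'"
      using less[of k m'] by (simp add: m del: hs.simps)
    have "?S * hs s i (Suc k) m = ?S * hs s (Suc i) k m + ?S * (s i * hs s i (Suc k) m')"
      by (subst i2) (rule distrib_left)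
    moreover have "s i * hs s i (Suc k) m = s i * hs s i k m + ?S * (s i * hs s i (Suc k) m')"
      by (subst e3) (simp only: distrib_left mult.left_commute)
    ultimately show ?thesis using e1 e2 i1 by linarith
  qed
qed

text \<open>A divided difference, obtained by subtracting the two recursions. Its factor
  \<open>s (i + k + 1) - s i\<close> becomes the length of the enlarged support in the moment
  formula.\<close>

lemma hs_diff: "hs s (Suc i) k (Suc m) - hs s i k (Suc m) = (s (i + k + 1) - s i) * hs s i (Suc k) m"
  using hs_remove_first[of s i k m] by (simp add: algebra_simps)

lemma hs_const:
  "(\<And>j. i \<le> j \<Longrightarrow> j \<le> i + k \<Longrightarrow> s j = c) \<Longrightarrow> hs s i k m = c ^ m * real ((m + k) choose m)"
proof (induction s i k m rule: hs.induct)
  case (3 s i k m)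
  have "hs s i k (Suc m) = c ^ Suc m * real ((Suc m + k) choose Suc m)"
    using "3.prems" by (intro "3.IH") auto
  moreover have "hs s i (Suc k) m = c ^ m * real ((m + Suc k) choose m)"
    using "3.prems" by (intro "3.IH") auto
  moreover have "real ((Suc m + Suc k) choose Suc m) = real ((Suc m + k) choose Suc m) + real ((m + Suc k) choose m)"
    by simp
  moreover have "s (i + k + 1) = c" using "3.prems" by simp
  ultimately show ?case
    by (simp only: hs.simps distrib_left power_Suc mult.assoc)
qed auto

text \<open>Integration over all of [0,1] instead of the support gives one expression for every
  \<open>f\<close> that vanishes off the support. A degenerate support sits at 0 or 1, and the
  constant is the limit of ramps over shrinking supports.\<close>

definition ramp :: "real \<Rightarrow> real \<Rightarrow> (real \<Rightarrow> real) \<Rightarrow> real \<Rightarrow> real" where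
  "ramp a b f x = (if a < b then integral {0..x} f / integral {0..1} f else if a < 1 then 1 else 0)"

text \<open>The integral recurrence is used instead of the two-term one because it has the shape of
  \<open>gbspl\<close>, so the two families can be compared degree by degree.\<close>

fun pspl :: "nat \<Rightarrow> nat \<Rightarrow> nat \<Rightarrow> nat \<Rightarrow> real \<Rightarrow> real" where
  "pspl n p 0 i x = (if knot n p i \<le> x \<and> x < knot n p (i + 1) then 1 else 0)"
| "pspl n p (Suc q) i x = ramp (knot n p i) (knot n p (i + q + 1)) (pspl n p q i) x
     - ramp (knot n p (i + 1)) (knot n p (i + q + 2)) (pspl n p q (i + 1)) x"

text \<open>Restricted to [0,1], where all integrals live; measurability on the restricted Lebesgue
  space together with the bound yields Henstock-Kurzweil integrability.\<close>

definition bfun :: "real \<Rightarrow> real \<Rightarrow> real \<Rightarrow> (real \<Rightarrow> real) \<Rightarrow> bool" where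
  "bfun a b C f \<longleftrightarrow> f \<in> borel_measurable (lebesgue_on {0..1}) \<and> (\<forall>x\<in>{0..1}. \<bar>f x\<bar> \<le> C)
     \<and> (\<forall>x\<in>{0..1}. x < a \<or> b < x \<longrightarrow> f x = 0)"

lemma bounded_measurable_integrable:
  fixes f :: "real \<Rightarrow> real"
  assumes "f \<in> borel_measurable (lebesgue_on {0..1})" "\<And>x. x \<in> {0..1} \<Longrightarrow> \<bar>f x\<bar> \<le> C"
    "0 \<le> u" "v \<le> 1"
  shows "f integrable_on {u..v}"
proof -
  have "f integrable_on {0..1}"
  proof (rule measurable_bounded_by_integrable_imp_integrable_real)
    show "(\<lambda>_. C) integrable_on {0..1::real}" by (rule integrable_const_ivl)
  qed (use assms(1,2) in simp_all)
  then show ?thesis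
    by (rule integrable_on_subinterval) (use assms in auto)
qed

lemma bfun_integrable: "bfun a b C f \<Longrightarrow> 0 \<le> u \<Longrightarrow> v \<le> 1 \<Longrightarrow> f integrable_on {u..v}"
  by (rule bounded_measurable_integrable[where C = C]) (auto simp: bfun_def)

lemma bfun_nonneg:
  assumes "bfun a b C f" shows "0 \<le> C"
proof -
  have "\<bar>f 0\<bar> \<le> C" using assms by (simp add: bfun_def)
  then show ?thesis by linarith
qed

lemma bfun_mult:
  "bfun a b C f \<Longrightarrow> bfun a' b' C' g \<Longrightarrow> bfun a b (C * C') (\<lambda>x. f x * g x)"
  using bfun_nonneg[of a b C f] unfolding bfun_def
  by (auto simp: abs_mult intro!: borel_measurable_times mult_mono)

lemma bfun_integral_le:
  assumes f: "bfun a b C f" and "a \<le> b" "x \<le> 1"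
  shows "\<bar>integral {0..x} f\<bar> \<le> C * (b - a)"
proof -
  have C: "0 \<le> C" by (rule bfun_nonneg[OF f])
  have "norm (integral {0..x} f) \<le> integral {0..x} (\<lambda>y. if y \<in> {a..b} then C else 0)"
  proof (rule integral_norm_bound_integral)
    show "f integrable_on {0..x}" by (rule bfun_integrable[OF f]) (use assms in auto)
    show "(\<lambda>y. if y \<in> {a..b} then C else 0) integrable_on {0..x}"
      by (subst integrable_restrict_Int, subst Int_atLeastAtMost) (rule integrable_const_ivl)
    show "norm (f y) \<le> (if y \<in> {a..b} then C else 0)" if "y \<in> {0..x}" for y
      using f that \<open>x \<le> 1\<close> by (auto simp: bfun_def not_le)
  qed
  also have "\<dots> = integral ({a..b} \<inter> {0..x}) (\<lambda>y. C)"
    by (rule integral_restrict_Int)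
  also have "\<dots> \<le> C * (b - a)"
    using C \<open>a \<le> b\<close> by (auto simp: max_def min_def content_real_if mult_left_mono mult.commute)
  finally show ?thesis by simp
qed

lemma has_integral_power:
  fixes a b :: real
  assumes "a \<le> b"
  shows "((\<lambda>x. x ^ m) has_integral (b ^ Suc m / real (Suc m) - a ^ Suc m / real (Suc m))) {a..b}"
proof (rule fundamental_theorem_of_calculus[OF assms])
  fix x assume "x \<in> {a..b}"
  have "((\<lambda>x. x ^ Suc m / real (Suc m)) has_real_derivative
      real (Suc m) * x ^ (Suc m - Suc 0) / real (Suc m)) (at x within {a..b})"
    by (rule DERIV_cdivide[OF DERIV_pow])
  then show "((\<lambda>x. x ^ Suc m / real (Suc m)) has_vector_derivative x ^ m) (at x within {a..b})"
    by (simp add: has_real_derivative_iff_has_vector_derivative del: of_nat_Suc power_Suc)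
qed

lemma continuous_on_ramp: "f integrable_on {0..1} \<Longrightarrow> continuous_on {0..1} (ramp a b f)"
  unfolding ramp_def
  by (cases "a < b") (auto intro!: continuous_intros indefinite_integral_continuous_1 simp: divide_inverse)

lemma ramp_left:
  assumes "bfun a b C f" "0 \<le> x" "x \<le> 1" "x < a" "a < b \<or> a = 0 \<or> a = 1"
  shows "ramp a b f x = 0"
proof (cases "a < b")
  case True
  have "integral {0..x} f = integral {0..x} (\<lambda>_. 0)"
    using assms by (intro integral_cong) (auto simp: bfun_def)
  then show ?thesis using True by (simp add: ramp_def)
qed (use assms in \<open>auto simp: ramp_def\<close>)

lemma ramp_right:
  assumes f: "bfun a b C f" and "0 \<le> x" "x \<le> 1" "b < x" "a \<le> b" "a < b \<Longrightarrow> integral {0..1} f \<noteq> 0"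
  shows "ramp a b f x = 1"
proof (cases "a < b")
  case True
  have "integral {0..1} f = integral {0..x} f + integral {x..1} f"
    using assms by (intro Henstock_Kurzweil_Integration.integral_combine[symmetric] bfun_integrable[OF f]) auto
  also have "integral {x..1} f = integral {x..1} (\<lambda>_. 0)"
    using assms by (intro integral_cong) (auto simp: bfun_def)
  finally show ?thesis using True assms by (simp add: ramp_def)
qed (use assms in \<open>auto simp: ramp_def\<close>)

text \<open>Integration by parts. Continuity outside a finite set admits the step functions of
  degree 0.\<close>

lemma integral_moment_antiderivative:
  fixes f :: "real \<Rightarrow> real"
  assumes f: "bfun a b C f" and S: "finite S" "\<And>x. x \<in> {0<..<1} - S \<Longrightarrow> isCont f x"
  shows "integral {0..1} (\<lambda>x. x ^ m * integral {0..x} f)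
    = (integral {0..1} f - integral {0..1} (\<lambda>x. x ^ Suc m * f x)) / real (Suc m)"
proof -
  let ?J = "\<lambda>x. integral {0..x} f"
  have fi: "f integrable_on {0..1}" by (rule bfun_integrable[OF f]) auto
  have Jc: "continuous_on {0..1} ?J" by (rule indefinite_integral_continuous_1[OF fi])
  have "((\<lambda>x. x ^ m * ?J x + x ^ Suc m / real (Suc m) * f x) has_integral
     1 ^ Suc m / real (Suc m) * ?J 1 - 0 ^ Suc m / real (Suc m) * ?J 0) {0..1}"
  proof (rule fundamental_theorem_of_calculus_interior_strong[OF S(1)])
    fix x assume x: "x \<in> {0<..<1} - S"
    have "(?J has_vector_derivative f x) (at x within ({0..1} - {}))"
      using x S(2)[OF x] by (intro integral_has_vector_derivative_continuous_at[OF fi])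
        (auto intro: continuous_at_imp_continuous_at_within)
    then have J: "(?J has_real_derivative f x) (at x)"
      using x by (simp add: has_real_derivative_iff_has_vector_derivative at_within_Icc_at)
    have "((\<lambda>x. x ^ Suc m / real (Suc m)) has_real_derivative x ^ m) (at x)"
      by (rule derivative_eq_intros refl | simp)+
    from DERIV_mult[OF this J]
    show "((\<lambda>x. x ^ Suc m / real (Suc m) * ?J x) has_vector_derivative
        x ^ m * ?J x + x ^ Suc m / real (Suc m) * f x) (at x)"
      by (simp add: has_real_derivative_iff_has_vector_derivative add.commute mult.commute)
  qed (auto intro!: continuous_intros Jc)
  then have tot: "integral {0..1} (\<lambda>x. x ^ m * ?J x + x ^ Suc m / real (Suc m) * f x) = ?J 1 / real (Suc m)"
    by (simp add: integral_unique)
  have i1: "(\<lambda>x. x ^ m * ?J x) integrable_on {0..1}"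
    by (intro integrable_continuous_real continuous_intros Jc)
  have i2: "(\<lambda>x. x ^ Suc m * f x) integrable_on {0..1}"
  proof (rule bounded_measurable_integrable)
    show "(\<lambda>x. x ^ Suc m * f x) \<in> borel_measurable (lebesgue_on {0..1})"
      using f by (intro borel_measurable_times[OF continuous_imp_measurable_on_sets_lebesgue])
        (auto intro!: continuous_intros simp: bfun_def)
    show "\<bar>x ^ Suc m * f x\<bar> \<le> 1 * C" if "x \<in> {0..1}" for x
      unfolding abs_mult using f that bfun_nonneg[OF f]
      by (intro mult_mono) (auto simp: bfun_def power_le_one mult_le_one)
  qed auto
  have "integral {0..1} (\<lambda>x. x ^ m * ?J x + x ^ Suc m / real (Suc m) * f x)
     = integral {0..1} (\<lambda>x. x ^ m * ?J x) + integral {0..1} (\<lambda>x. (x ^ Suc m * f x) / real (Suc m))"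
    using i1 integrable_on_divide[OF i2, of "real (Suc m)"]
    by (subst Henstock_Kurzweil_Integration.integral_add[symmetric]) auto
  then show ?thesis using tot
    by (simp add: diff_divide_distrib)
qed

text \<open>Two ramps, each at most \<open>1 + C / c\<close> by \<open>ramp_bound\<close> with
  \<open>c = 1 / real (Suc q)\<close>. The bound is crude; what counts is that it depends neither on
  the index nor on \<open>n\<close>.\<close>

fun pspl_bound :: "nat \<Rightarrow> real" where
  "pspl_bound 0 = 1"
| "pspl_bound (Suc q) = 2 * (1 + real (Suc q) * pspl_bound q)"

lemma pspl_bound_ge_1: "1 \<le> pspl_bound q"
  by (induction q) auto

text \<open>Numerator and denominator are both comparable to \<open>b - a\<close>, so the length
  cancels; the summand 1 covers the degenerate ramp.\<close>

lemma ramp_bound: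
  assumes f: "bfun a b C f" and "a \<le> b" "x \<le> 1"
    and I: "a < b \<Longrightarrow> c * (b - a) \<le> integral {0..1} f" and "c > 0"
  shows "\<bar>ramp a b f x\<bar> \<le> 1 + C / c"
proof (cases "a < b")
  case True
  have "0 < c * (b - a)" using True \<open>c > 0\<close> by simp
  then have "\<bar>integral {0..x} f\<bar> / \<bar>integral {0..1} f\<bar> \<le> (C * (b - a)) / (c * (b - a))"
    using bfun_integral_le[OF f assms(2,3)] I[OF True] bfun_nonneg[OF f] True by (intro frac_le) auto
  then show ?thesis using True by (simp add: ramp_def)
next
  case False
  then show ?thesis using bfun_nonneg[OF f] \<open>c > 0\<close> by (simp add: ramp_def)
qed

text \<open>Matches the normalising binomials when moment \<open>m + 1\<close> in one degree turns
  into moment \<open>m\<close> in the next.\<close>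

lemma binomial_mult_shift:
  "real (Suc m) * real ((Suc m + Suc q) choose Suc m) = real (Suc (Suc q)) * real ((m + Suc (Suc q)) choose m)"
proof -
  have "Suc m * ((Suc m + Suc q) choose Suc m) = Suc (Suc q) * ((m + Suc (Suc q)) choose m)"
    using Suc_times_binomial_eq[of "m + Suc q" m] Suc_times_binomial_add[of m "Suc q"]
    by (simp add: add.commute mult.commute)
  then show ?thesis by (metis of_nat_mult)
qed

section \<open>Moments and interior form of the polynomial splines\<close>

context
  fixes n p :: nat assumes n: "n > 0"
begin

text \<open>By parts, moment \<open>m\<close> of the ramp uses moment \<open>m + 1\<close> of
  \<open>f\<close>; this is why all moments are carried together. For a degenerate support the ramp
  is constant, all knots equal 0 or 1, and \<open>hs_const\<close> shows that the same formula
  holds.\<close>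

lemma ramp_moment:
  assumes f: "bfun (knot n p i) (knot n p (i + q + 1)) C f"
    and S: "finite S" "\<And>x. x \<in> {0<..<1} - S \<Longrightarrow> isCont f x"
    and M: "\<And>m. integral {0..1} (\<lambda>x. x ^ m * f x) = (knot n p (i + q + 1) - knot n p i) / real (q + 1)
        * hs (knot n p) i (q + 1) m / real ((m + (q + 1)) choose m)"
  shows "integral {0..1} (\<lambda>x. x ^ m * ramp (knot n p i) (knot n p (i + q + 1)) f x)
    = (1 - hs (knot n p) i (q + 1) (Suc m) / real ((Suc m + (q + 1)) choose Suc m)) / real (Suc m)"
proof (cases "knot n p i < knot n p (i + q + 1)")
  case True
  let ?I = "(knot n p (i + q + 1) - knot n p i) / real (q + 1)"
  have I: "integral {0..1} f = ?I" using M[of 0] by simp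
  have I0: "?I \<noteq> 0" using True by simp
  have "integral {0..1} (\<lambda>x. x ^ m * ramp (knot n p i) (knot n p (i + q + 1)) f x)
     = integral {0..1} (\<lambda>x. (x ^ m * integral {0..x} f) / ?I)"
    by (simp only: ramp_def True if_True I times_divide_eq_right)
  also have "\<dots> = integral {0..1} (\<lambda>x. x ^ m * integral {0..x} f) / ?I"
    by simp
  also have "\<dots> = (?I - ?I * hs (knot n p) i (q + 1) (Suc m) / real ((Suc m + (q + 1)) choose Suc m)) / real (Suc m) / ?I"
    using integral_moment_antiderivative[OF f S, of m] unfolding M I by (simp only: times_divide_eq_left times_divide_eq_right)
  also have "\<dots> = (1 - hs (knot n p) i (q + 1) (Suc m) / real ((Suc m + (q + 1)) choose Suc m)) / real (Suc m)"
    using I0 by (simp add: field_simps del: of_nat_Suc binomial_Suc_Suc)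
  finally show ?thesis .
next
  case False
  then have eq: "knot n p i = knot n p (i + q + 1)"
    using knot_mono[OF n, of i "i + q + 1" p] by simp
  then have "knot n p j = knot n p i" if "i \<le> j" "j \<le> i + (q + 1)" for j
    using knot_mono[OF n, of i j p] knot_mono[OF n, of j "i + q + 1" p] that by simp
  then have h: "hs (knot n p) i (q + 1) (Suc m) = knot n p i ^ Suc m * real ((Suc m + (q + 1)) choose Suc m)"
    by (rule hs_const)
  have "real ((Suc m + (q + 1)) choose Suc m) \<noteq> 0" by (simp del: binomial_Suc_Suc)
  then have h': "hs (knot n p) i (q + 1) (Suc m) / real ((Suc m + (q + 1)) choose Suc m) = knot n p i ^ Suc m"
    unfolding h by simp
  have "((\<lambda>x::real. x ^ m) has_integral 1 / real (Suc m)) {0..1}"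
    using has_integral_power[of 0 1 m] by (simp add: add.commute)
  then have "integral {0..1} (\<lambda>x::real. x ^ m) = 1 / real (Suc m)" by (rule integral_unique)
  moreover have "knot n p i = 0 \<or> knot n p i = 1"
    using knot_degenerate[OF n _ eq] by simp
  ultimately show ?thesis
    unfolding h' using False by (auto simp: ramp_def)
qed

text \<open>A single induction, since the parts feed each other: the integrals normalise the ramps
  and thereby give bound and support in the next degree, while the moments there need integration by
  parts and hence continuity. Step functions are continuous off the mesh only.\<close>

lemma pspl_basic:
  "bfun (knot n p i) (knot n p (i + q + 1)) (pspl_bound q) (pspl n p q i)
   \<and> (\<forall>m. integral {0..1} (\<lambda>x. x ^ m * pspl n p q i x) = (knot n p (i + q + 1) - knot n p i) / real (q + 1)
        * hs (knot n p) i (q + 1) m / real ((m + (q + 1)) choose m))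
   \<and> (\<forall>x\<in>{0<..<1}. (q = 0 \<longrightarrow> real n * x \<notin> \<int>) \<longrightarrow> isCont (pspl n p q i) x)
   \<and> (q > 0 \<longrightarrow> continuous_on {0..1} (pspl n p q i))"
proof (induction q arbitrary: i)
  case 0
  let ?a = "knot n p i" and ?b = "knot n p (i + 1)"
  have ab: "?a \<le> ?b" using knot_mono[OF n, of i "i + 1"] by simp
  have eq: "pspl n p 0 i = indicator {?a..<?b}" by (auto simp: fun_eq_iff indicator_def)
  have "indicat_real {?a..<?b} \<in> borel_measurable lebesgue" by (rule measurable_completion) simp
  then have "bfun ?a ?b 1 (pspl n p 0 i)"
    unfolding eq bfun_def by (auto simp: indicator_def intro!: measurable_restrict_space1)
  moreover have "integral {0..1} (\<lambda>x. x ^ m * pspl n p 0 i x) = (?b - ?a) * hs (knot n p) i 1 m / real ((m + 1) choose m)" for m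
  proof -
    have "integral {0..1} (\<lambda>x. x ^ m * pspl n p 0 i x) = integral {0..1} (\<lambda>x. if x \<in> {?a..?b} then x ^ m else 0)"
      by (rule integral_spike[of "{?b}"]) (auto simp: eq indicator_def)
    also have "\<dots> = integral {?a..?b} (\<lambda>x. x ^ m)"
      using knot_bounds[OF n] unfolding integral_restrict_Int
      by (intro arg_cong2[where f = integral]) auto
    also have "\<dots> = ?b ^ Suc m / real (Suc m) - ?a ^ Suc m / real (Suc m)"
      using has_integral_power[OF ab, of m] by (simp add: add.commute integral_unique)
    also have "?b ^ Suc m / real (Suc m) - ?a ^ Suc m / real (Suc m) = (hs (knot n p) (Suc i) 0 (Suc m) - hs (knot n p) i 0 (Suc m)) / real (Suc m)"
      by (simp add: diff_divide_distrib)
    also have "\<dots> = (?b - ?a) * hs (knot n p) i 1 m / real (Suc m)"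
      unfolding hs_diff by simp
    finally show ?thesis by simp
  qed
  moreover have "isCont (pspl n p 0 i) x" if "real n * x \<notin> \<int>" for x
  proof -
    have "x \<noteq> knot n p k" for k using that knot_Ints[OF n] by metis
    then have ne: "x \<noteq> ?a" "x \<noteq> ?b" by blast+
    have sub: "closure {?a..<?b} \<subseteq> {?a..?b}" by (rule closure_minimal) auto
    have sup: "{?a<..<?b} \<subseteq> interior {?a..<?b}" by (rule interior_maximal) auto
    have "x \<notin> frontier {?a..<?b}"
    proof
      assume "x \<in> frontier {?a..<?b}"
      then have "x \<in> {?a..?b}" "x \<notin> {?a<..<?b}"
        using sub sup unfolding frontier_def by blast+
      then show False using ne by auto
    qed
    then show ?thesis unfolding eq by (simp add: isCont_indicator)
  qed
  ultimately show ?case by (simp del: pspl.simps)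
next
  case (Suc q)
  let ?k = "knot n p"
  let ?f = "\<lambda>i. pspl n p q i"
  let ?r = "\<lambda>i. ramp (?k i) (?k (i + q + 1)) (?f i)"
  let ?S = "{x \<in> {0..1}. real n * x - 0 \<in> \<int>}"
  have eq: "pspl n p (Suc q) i = (\<lambda>x. ?r i x - ?r (i + 1) x)"
    by (simp add: fun_eq_iff)
  have f: "bfun (?k i) (?k (i + q + 1)) (pspl_bound q) (?f i)" for i
    by (rule Suc[THEN conjunct1])
  have M: "integral {0..1} (\<lambda>x. x ^ m * ?f i x) = (?k (i + q + 1) - ?k i) / real (q + 1)
        * hs ?k i (q + 1) m / real ((m + (q + 1)) choose m)" for i m
    by (rule Suc[THEN conjunct2, THEN conjunct1, rule_format])
  have C: "isCont (?f i) x" if "x \<in> {0<..<1} - ?S" for i x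
    by (rule Suc[THEN conjunct2, THEN conjunct2, THEN conjunct1, rule_format]) (use that in auto)
  have S: "finite ?S" by (rule finite_Ints_affine) (use n in auto)
  have le: "?k i \<le> ?k (i + q + 1)" for i by (rule knot_mono[OF n]) auto
  have I: "integral {0..1} (?f i) = (?k (i + q + 1) - ?k i) / real (q + 1)" for i
    using M[of 0 i] by simp
  have rc: "continuous_on {0..1} (?r i)" for i
    by (rule continuous_on_ramp) (rule bfun_integrable[OF f], auto)
  have cont: "continuous_on {0..1} (pspl n p (Suc q) i)"
    unfolding eq by (intro continuous_intros rc)
  have deg: "?k i < ?k (i + q + 1) \<or> ?k i = 0 \<or> ?k i = 1" for i
    using le[of i] knot_degenerate[OF n, of i "i + q + 1" p] by auto
  have bf: "bfun (?k i) (?k (i + Suc q + 1)) (pspl_bound (Suc q)) (pspl n p (Suc q) i)"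
    unfolding bfun_def
  proof (intro conjI ballI impI)
    show "pspl n p (Suc q) i \<in> borel_measurable (lebesgue_on {0..1})"
      by (rule continuous_imp_measurable_on_sets_lebesgue[OF cont]) auto
  next
    fix x :: real assume x: "x \<in> {0..1}"
    have "\<bar>?r i x\<bar> \<le> 1 + pspl_bound q / (1 / real (q + 1))" for i
      by (rule ramp_bound[OF f le]) (use x in \<open>auto simp: I\<close>)
    from this[of i] this[of "i + 1"] show "\<bar>pspl n p (Suc q) i x\<bar> \<le> pspl_bound (Suc q)"
      unfolding eq by (simp add: mult.commute)
  next
    fix x :: real assume x: "x \<in> {0..1}" and out: "x < ?k i \<or> ?k (i + Suc q + 1) < x"
    show "pspl n p (Suc q) i x = 0"
    proof (cases "x < ?k i")
      case True
      then have "x < ?k (i + 1)" using knot_mono[OF n, of i "i + 1" p] by simp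
      then show ?thesis
        using True x ramp_left[OF f _ _ _ deg, of x i] ramp_left[OF f _ _ _ deg, of x "i + 1"]
        unfolding eq by simp
    next
      case False
      then have o2: "?k (i + 1 + q + 1) < x" using out by simp
      then have o1: "?k (i + q + 1) < x" using knot_mono[OF n, of "i + q + 1" "i + 1 + q + 1" p] by simp
      \<comment> \<open>Beyond both supports the two ramps have reached 1 and cancel.\<close>
      have "?r i x = 1" by (rule ramp_right[OF f _ _ o1 le]) (use x I in auto)
      moreover have "?r (i + 1) x = 1" by (rule ramp_right[OF f _ _ o2 le]) (use x I in auto)
      ultimately show ?thesis unfolding eq by simp
    qed
  qed
  have mom: "integral {0..1} (\<lambda>x. x ^ m * pspl n p (Suc q) i x) = (?k (i + Suc q + 1) - ?k i) / real (Suc q + 1)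
        * hs ?k i (Suc q + 1) m / real ((m + (Suc q + 1)) choose m)" for m
  proof -
    let ?c = "real ((Suc m + (q + 1)) choose Suc m)"
    have e: "i + (q + 1) + 1 = i + Suc q + 1" "Suc (q + 1) = Suc q + 1" "Suc (Suc q) = Suc q + 1"
      by simp_all
    \<comment> \<open>The constants of the two ramp moments cancel; \<open>hs_diff\<close> turns the
      rest into the length of the new support times a moment.\<close>
    have g: "(1 - A / c) / l - (1 - B / c) / l = (B - A) / (l * c)" for A B c l :: real
      by (simp add: diff_divide_distrib mult.commute)
    have R: "integral {0..1} (\<lambda>x. x ^ m * ?r i x) = (1 - hs ?k i (q + 1) (Suc m) / ?c) / real (Suc m)" for i
    proof (rule ramp_moment[OF f[of i] S])
      show "isCont (?f i) x" if "x \<in> {0<..<1} - ?S" for x using that by (rule C)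
    qed (rule M)
    have "integral {0..1} (\<lambda>x. x ^ m * pspl n p (Suc q) i x)
       = integral {0..1} (\<lambda>x. x ^ m * ?r i x) - integral {0..1} (\<lambda>x. x ^ m * ?r (i + 1) x)"
      unfolding eq right_diff_distrib
      by (rule Henstock_Kurzweil_Integration.integral_diff)
        (intro integrable_continuous_real continuous_intros rc)+
    also have "\<dots> = (1 - hs ?k i (q + 1) (Suc m) / ?c) / real (Suc m) - (1 - hs ?k (i + 1) (q + 1) (Suc m) / ?c) / real (Suc m)"
      using R[of i] R[of "i + 1"] by (simp only:)
    also have "\<dots> = (hs ?k (Suc i) (q + 1) (Suc m) - hs ?k i (q + 1) (Suc m)) / (real (Suc m) * ?c)"
      unfolding Suc_eq_plus1[of i, symmetric] by (rule g)
    also have "\<dots> = (?k (i + (q + 1) + 1) - ?k i) * hs ?k i (Suc (q + 1)) m / (real (Suc m) * ?c)"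
      unfolding hs_diff ..
    also have "real (Suc m) * ?c = real (Suc (Suc q)) * real ((m + Suc (Suc q)) choose m)"
      using binomial_mult_shift[of m q] by (simp only: Suc_eq_plus1)
    finally show ?thesis
      unfolding e by (simp only: times_divide_eq_left divide_divide_eq_left)
  qed
  have ic: "isCont (pspl n p (Suc q) i) x" if "x \<in> {0<..<1}" for x
    using continuous_on_interior[OF cont, of x] that by simp
  show ?case
    by (intro conjI allI ballI impI bf mom ic cont)
qed

lemmas pspl_bfun = pspl_basic[THEN conjunct1]

lemma pspl_integral: "integral {0..1} (pspl n p q i) = (knot n p (i + q + 1) - knot n p i) / real (q + 1)"
  using pspl_basic[of i q, THEN conjunct2, THEN conjunct1, rule_format, of 0] by simp

text \<open>The index range says that the knots \<open>i, ..., i + q + 1\<close> are equally spaced.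
  Every normalising integral is then \<open>1 / n\<close>, and the recurrence becomes the integrated
  derivative formula of \<open>cardB\<close>.\<close>

lemma pspl_interior:
  assumes "p + 1 \<le> i" "i + q \<le> n + p" "x \<in> {0..1}"
  shows "pspl n p q i x = cardB q (real n * x - (real i - real p - 1))"
  using assms
proof (induction q arbitrary: i x)
  case 0
  have "knot n p i = (real i - real p - 1) / real n" "knot n p (i + 1) = (real i - real p) / real n"
    using 0 n by (auto simp: knot_eq of_nat_diff)
  then show ?case using n
    unfolding pspl.simps cardB.simps by (auto simp: pos_divide_le_eq pos_less_divide_eq algebra_simps)
next
  case (Suc q)
  let ?c = "real i - real p - 1"
  have r: "ramp (knot n p j) (knot n p (j + q + 1)) (pspl n p q j) x
      = integral {0..x} (\<lambda>y. real n * cardB q (real n * y - (real j - real p - 1)))"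
    if j: "p + 1 \<le> j" "j + q \<le> n + p" for j
  proof -
    have k: "knot n p (j + q + 1) - knot n p j = real (q + 1) / real n"
    proof -
      have "knot n p j = (real j - real p - 1) / real n"
        using j by (auto simp: knot_def of_nat_diff)
      moreover have "knot n p (j + q + 1) = (real j + real q - real p) / real n"
        using j by (auto simp: knot_def of_nat_diff)
      ultimately show ?thesis by (simp add: diff_divide_distrib[symmetric])
    qed
    moreover have "0 < real (q + 1) / real n" using n by simp
    ultimately have "knot n p j < knot n p (j + q + 1)" by linarith
    then have "ramp (knot n p j) (knot n p (j + q + 1)) (pspl n p q j) x = real n * integral {0..x} (pspl n p q j)"
      unfolding ramp_def pspl_integral k by simp
    also have "integral {0..x} (pspl n p q j) = integral {0..x} (\<lambda>y. cardB q (real n * y - (real j - real p - 1)))"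
      using Suc.prems by (intro integral_cong Suc.IH j) auto
    finally show ?thesis by simp
  qed
  have i: "(\<lambda>y. real n * cardB q (real n * y - c)) integrable_on {0..x}" for c
  proof (rule bounded_measurable_integrable[where C = "real n * 2 ^ q"])
    have "(\<lambda>y. real n * cardB q (real n * y - c)) \<in> borel_measurable borel" by measurable
    then show "(\<lambda>y. real n * cardB q (real n * y - c)) \<in> borel_measurable (lebesgue_on {0..1})"
      by (intro measurable_restrict_space1 measurable_completion) simp
  qed (use cardB_le[of q] cardB_nonneg[of q] Suc.prems in \<open>auto simp: abs_mult\<close>)
  have "pspl n p (Suc q) i x = integral {0..x} (\<lambda>y. real n * cardB q (real n * y - ?c))
     - integral {0..x} (\<lambda>y. real n * cardB q (real n * y - ?c - 1))"
  proof -
    have e: "i + 1 + q + 1 = i + q + 2" by simp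
    have d: "real n * y - (real (i + 1) - real p - 1) = real n * y - ?c - 1" for y by simp
    have r1: "ramp (knot n p i) (knot n p (i + q + 1)) (pspl n p q i) x
        = integral {0..x} (\<lambda>y. real n * cardB q (real n * y - ?c))"
      using Suc.prems by (intro r) simp_all
    have r2: "ramp (knot n p (i + 1)) (knot n p (i + 1 + q + 1)) (pspl n p q (i + 1)) x
        = integral {0..x} (\<lambda>y. real n * cardB q (real n * y - (real (i + 1) - real p - 1)))"
      using Suc.prems by (intro r) simp_all
    show ?thesis by (simp only: pspl.simps r1 r2[unfolded e d])
  qed
  also have "\<dots> = integral {0..x} (\<lambda>y. real n * (cardB q (real n * y - ?c) - cardB q (real n * y - ?c - 1)))"
    using i[of ?c] i[of "?c + 1"] unfolding right_diff_distrib
    by (subst Henstock_Kurzweil_Integration.integral_diff[symmetric]) (simp_all only: diff_diff_eq)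
  also have "\<dots> = cardB (Suc q) (real n * x - ?c) - cardB (Suc q) (real n * 0 - ?c)"
    using Suc.prems n by (intro integral_unique cardB_affine_has_integral) auto
  finally have "pspl n p (Suc q) i x = cardB (Suc q) (real n * x - ?c) - cardB (Suc q) (real n * 0 - ?c)" .
  \<comment> \<open>The constant of integration. If the first knot is 0, the argument is exactly 0,
    a point that \<open>cardB_support\<close> does not reach; reflection moves it to the right end
    of the support.\<close>
  moreover have "cardB (Suc q) (real n * 0 - ?c) = 0"
  proof (cases "?c = 0")
    case True then show ?thesis using cardB_sym[of q 0] cardB_support[of "real q + 2" "Suc q"] by (simp del: cardB.simps)
  next
    case False then show ?thesis using Suc.prems by (intro cardB_support) auto
  qed
  ultimately show ?case by (simp only: diff_zero)
qed

end

section \<open>GB-splines as perturbations of polynomial B-splines\<close>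

definition gbC :: "gbkind \<Rightarrow> real \<Rightarrow> real \<Rightarrow> real" where
  "gbC Q mu x = (case Q of Trig \<Rightarrow> mu * cos (mu * x) | Hyp \<Rightarrow> mu * cosh (mu * x))"

lemma gbS_DERIV: "(gbS Q mu has_real_derivative gbC Q mu x) (at x)"
  unfolding gbS_def[abs_def] gbC_def
  by (cases Q) (auto intro!: derivative_eq_intros)

lemma gbS_0 [simp]: "gbS Q mu 0 = 0"
  by (cases Q) (auto simp: gbS_def)

lemma gbC_isCont: "isCont (gbC Q mu) x"
  unfolding gbC_def[abs_def] by (cases Q) (auto intro!: continuous_intros)

text \<open>On a short interval at 0 the derivative \<open>gbC\<close> is nearly the constant
  \<open>mu\<close>, and by the mean value theorem \<open>gbS Q mu (1 / real n)\<close> is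
  \<open>1 / n\<close> times one of its values. Hence the normalised slope is nearly
  \<open>n\<close>, with a relative error.\<close>

lemma gbC_profile:
  assumes mu: "mu > 0" and e: "e > 0"
  shows "eventually (\<lambda>n. n > 0 \<and> gbS Q mu (1 / real n) > 0 \<and>
    (\<forall>y\<in>{0..1 / real n}. \<bar>gbC Q mu y / gbS Q mu (1 / real n) - real n\<bar> \<le> e * real n)) sequentially"
proof -
  \<comment> \<open>The bound 1/2 keeps \<open>gbC\<close> above \<open>mu / 2\<close>; then
    \<open>2 * \<eta> * mu\<close> divided by \<open>mu / (2 * n)\<close> is
    \<open>4 * \<eta> * n\<close>, which explains the quarter.\<close>
  define \<eta> where "\<eta> = min (e / 4) (1 / 2)"
  have \<eta>: "0 < \<eta>" "\<eta> \<le> e / 4" "\<eta> \<le> 1 / 2" using e by (auto simp: \<eta>_def)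
  have c0: "gbC Q mu 0 = mu" by (cases Q) (auto simp: gbC_def)
  obtain \<delta> where \<delta>: "\<delta> > 0" "\<And>y. \<bar>y\<bar> < \<delta> \<Longrightarrow> \<bar>gbC Q mu y - mu\<bar> < \<eta> * mu"
    using gbC_isCont[of 0 Q mu] \<eta>(1) mu unfolding continuous_at_eps_delta c0
    by (metis diff_zero mult_pos_pos real_norm_def dist_norm)
  have "eventually (\<lambda>n. 1 / real n < \<delta>) sequentially"
    using \<delta>(1) lim_1_over_n[where 'a = real] by (intro order_tendstoD(2)) auto
  with eventually_gt_at_top[of 0] show ?thesis
  proof eventually_elim
    case (elim n)
    let ?h = "1 / real n"
    have h: "0 < ?h" using elim by simp
    obtain z where z: "0 < z" "z < ?h" "gbS Q mu ?h - gbS Q mu 0 = (?h - 0) * gbC Q mu z"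
      using MVT2[OF h, of "gbS Q mu" "gbC Q mu"] gbS_DERIV by blast
    have Sh: "gbS Q mu ?h = ?h * gbC Q mu z" using z(3) by simp
    have gz: "\<bar>gbC Q mu z - mu\<bar> < \<eta> * mu" using z elim by (intro \<delta>(2)) auto
    have "\<eta> * mu \<le> mu / 2" using \<eta>(3) mu by (simp add: field_simps)
    then have gzl: "gbC Q mu z \<ge> mu / 2" using gz by linarith
    then have S0: "gbS Q mu ?h > 0" unfolding Sh using h mu by (intro mult_pos_pos) auto
    have "\<bar>gbC Q mu y / gbS Q mu ?h - real n\<bar> \<le> e * real n" if y: "y \<in> {0..?h}" for y
    proof -
      have gy: "\<bar>gbC Q mu y - mu\<bar> < \<eta> * mu" using y elim by (intro \<delta>(2)) auto
      have "gbC Q mu y / gbS Q mu ?h - real n = (gbC Q mu y - gbC Q mu z) / gbS Q mu ?h"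
        using elim S0 gzl mu unfolding Sh by (simp add: field_simps)
      also have "\<bar>\<dots>\<bar> = \<bar>gbC Q mu y - gbC Q mu z\<bar> / gbS Q mu ?h" using S0 by simp
      also have "\<dots> \<le> (2 * \<eta> * mu) / (?h * (mu / 2))"
        using gy gz h mu gzl \<eta>(1) unfolding Sh by (intro frac_le mult_left_mono) auto
      also have "\<dots> = 4 * \<eta> * real n" using mu elim by (simp add: field_simps)
      also have "\<dots> \<le> e * real n" using \<eta>(2) by (intro mult_right_mono) auto
      finally show ?thesis .
    qed
    then show ?case using elim S0 by blast
  qed
qed

text \<open>A slope error \<open>e * n\<close>, integrated over a length of at most
  \<open>1 / n\<close>.\<close>

lemma gbS_profile:
  assumes n: "n > 0" and S: "gbS Q mu (1 / real n) > 0" and y: "y \<in> {0..1 / real n}" and e: "e > 0"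
    and C: "\<forall>y\<in>{0..1 / real n}. \<bar>gbC Q mu y / gbS Q mu (1 / real n) - real n\<bar> \<le> e * real n"
  shows "\<bar>gbS Q mu y / gbS Q mu (1 / real n) - real n * y\<bar> \<le> e"
proof (cases "y = 0")
  case False
  let ?h = "1 / real n"
  let ?f = "\<lambda>y. gbS Q mu y / gbS Q mu ?h - real n * y"
  have "\<exists>z. 0 < z \<and> z < y \<and> ?f y - ?f 0 = (y - 0) * (gbC Q mu z / gbS Q mu ?h - real n)"
    using False y S by (intro MVT2) (auto intro!: derivative_eq_intros gbS_DERIV)
  then obtain z where z: "0 < z" "z < y" "?f y = y * (gbC Q mu z / gbS Q mu ?h - real n)" by auto
  have "\<bar>?f y\<bar> = y * \<bar>gbC Q mu z / gbS Q mu ?h - real n\<bar>" unfolding z(3) abs_mult using y by simp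
  also have "\<dots> \<le> ?h * (e * real n)" using z y C by (intro mult_mono) auto
  also have "\<dots> = e" using n by simp
  finally show ?thesis .
qed (use e in simp)

text \<open>A normalised profile \<open>s\<close> started at \<open>a\<close>; clamping extends it
  by constants. \<open>rampR\<close> is the reflected version ending at \<open>b\<close>, and the
  two differ unless \<open>s y + s (h - y) = 1\<close>, so the generalised hat needs both.\<close>

definition rampL :: "(real \<Rightarrow> real) \<Rightarrow> real \<Rightarrow> real \<Rightarrow> real \<Rightarrow> real \<Rightarrow> real" where
  "rampL s h a b x = (if a < b then s (max 0 (min h (x - a))) else if a < 1 then 1 else 0)"

definition rampR :: "(real \<Rightarrow> real) \<Rightarrow> real \<Rightarrow> real \<Rightarrow> real \<Rightarrow> real \<Rightarrow> real" where
  "rampR s h a b x = (if a < b then 1 - s (max 0 (min h (b - x))) else if a < 1 then 1 else 0)"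

text \<open>Degree-1 splines as differences of a rising and a complementary falling ramp; in the
  polynomial case the two ramps coincide.\<close>
lemma hat_eq_ramps:
  assumes s: "s 0 = 0" "s h = 1" and h: "h > (0::real)"
    and ab: "b = a \<and> (a = 0 \<or> a = 1) \<or> b = a + h" and bc: "c = b \<and> (b = 0 \<or> b = 1) \<or> c = b + h"
    and bd: "0 \<le> a" "c \<le> 1" "0 \<le> x" "x \<le> 1"
  shows "(if a < b \<and> a \<le> x \<and> (x < b \<or> (x = b \<and> b = 1 \<and> c = 1)) then s (x - a)
      else if b < c \<and> b \<le> x \<and> (x < c \<or> (x = c \<and> c = 1)) then s (c - x) else 0)
    = rampL s h a b x - rampR s h b c x"
proof -
  consider "b = a" "a = 0" "c = b" | "b = a" "a = 1" "c = b" | "b = a" "a = 0" "c = h" | "b = a" "a = 1" "c = b + h"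
    | "b = a + h" "c = b" "b = 1" | "b = a + h" "c = b + h" | "b = a + h" "c = b" "b = 0"
    using ab bc by auto
  then show ?thesis
  proof cases
    case 3
    have "x \<ge> h \<or> x < h" by linarith
    then show ?thesis using 3 h bd s by (auto simp: rampL_def rampR_def max_def min_def)
  next
    case 5
    have "x < a \<or> x = 1 \<or> a \<le> x \<and> x < 1" using bd by linarith
    moreover have "1 - a = h" using 5 by simp
    then have "s (1 - a) = 1" using s(2) by (simp only:)
    ultimately show ?thesis using 5 h bd s by (auto simp: rampL_def rampR_def max_def min_def)
  next
    case 6
    have "x < a \<or> a \<le> x \<and> x < b \<or> b = x \<or> b < x \<and> x < c \<or> x = c \<or> c < x" by linarith
    then show ?thesis using 6 h bd s by (elim disjE) (auto simp: rampL_def rampR_def max_def min_def)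
  qed (use h bd s in \<open>auto simp: rampL_def rampR_def\<close>)
qed

lemma rampR_linear:
  assumes "n > 0" "b = a \<or> b = a + 1 / real n"
  shows "rampR (\<lambda>y. real n * y) (1 / real n) a b x = rampL (\<lambda>y. real n * y) (1 / real n) a b x"
proof -
  have "b = a + 1 / real n \<Longrightarrow> 1 - real n * (max 0 (min (1 / real n) (b - x))) = real n * (max 0 (min (1 / real n) (x - a)))"
  proof -
    assume b: "b = a + 1 / real n"
    have h: "real n * (1 / real n) = 1" "0 < 1 / real n" using assms(1) by auto
    consider "x \<le> a" | "a < x" "x < b" | "b \<le> x" by linarith
    then show ?thesis
    proof cases
      case 1
      then have "min (1 / real n) (b - x) = 1 / real n" "max 0 (min (1 / real n) (x - a)) = 0" using b h by auto
      then show ?thesis using h by simp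
    next
      case 2
      then have "max 0 (min (1 / real n) (b - x)) = b - x" "max 0 (min (1 / real n) (x - a)) = x - a" using b h by auto
      moreover have "1 - real n * (b - x) = real n * (x - a)"
        using h(1) unfolding b by (simp only: right_diff_distrib distrib_left)
      ultimately show ?thesis by (simp only:)
    next
      case 3
      then have "max 0 (min (1 / real n) (b - x)) = 0" "min (1 / real n) (x - a) = 1 / real n" using b h by auto
      then show ?thesis using h by simp
    qed
  qed
  then show ?thesis using assms by (auto simp: rampR_def rampL_def)
qed

lemma knot_step:
  assumes "n > 0"
  shows "knot n p (i + 1) = knot n p i \<and> (knot n p i = 0 \<or> knot n p i = 1) \<or> knot n p (i + 1) = knot n p i + 1 / real n"
proof (cases "knot n p i = knot n p (i + 1)")
  case True
  then show ?thesis using knot_degenerate[OF assms, of i "i + 1" p] by simp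
next
  case False
  then have "knot n p i < knot n p (i + 1)" using knot_mono[OF assms, of i "i + 1" p] by simp
  from knot_gap[OF assms this] knot_diff_le[OF assms, of p i 1] show ?thesis by simp
qed

lemma ramp_pspl_0:
  assumes n: "n > 0" and x: "x \<in> {0..1}"
  shows "ramp (knot n p i) (knot n p (i + 1)) (pspl n p 0 i) x
    = rampL (\<lambda>y. real n * y) (1 / real n) (knot n p i) (knot n p (i + 1)) x"
proof (cases "knot n p i < knot n p (i + 1)")
  case True
  let ?a = "knot n p i" and ?b = "knot n p (i + 1)"
  have b: "?b = ?a + 1 / real n" using knot_step[OF n, of p i] True by auto
  have I: "integral {0..1} (pspl n p 0 i) = 1 / real n"
    using pspl_integral[OF n, of p 0 i] b by simp
  have "integral {0..x} (pspl n p 0 i) = integral {0..x} (\<lambda>x. if x \<in> {?a..?b} then 1 else 0)"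
    by (rule integral_spike[of "{?b}"]) auto
  also have "\<dots> = integral ({?a..?b} \<inter> {0..x}) (\<lambda>_. 1)"
    by (rule integral_restrict_Int)
  also have "{?a..?b} \<inter> {0..x} = {?a..min ?b x}"
    using knot_bounds[OF n, of p i] by auto
  also have "integral {?a..min ?b x} (\<lambda>_. 1::real) = max 0 (min (1 / real n) (x - ?a))"
    using b by (auto simp: min_def max_def)
  finally show ?thesis using True I n by (simp add: ramp_def rampL_def del: pspl.simps)
qed (simp add: ramp_def rampL_def)

text \<open>The error vanishes off the support, so its integrals carry a factor of the support
  length. Continuity is kept because the next degree is differentiated.\<close>

definition gb_appr :: "gbkind \<Rightarrow> real \<Rightarrow> nat \<Rightarrow> nat \<Rightarrow> real \<Rightarrow> nat \<Rightarrow> bool" where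
  "gb_appr Q mu p q e n \<longleftrightarrow> n > 0 \<and> (\<forall>i. continuous_on {0..1} (gbspl Q mu n p (Suc q) i) \<and>
     bfun (knot n p i) (knot n p (i + q + 2)) e (\<lambda>x. gbspl Q mu n p (Suc q) i x - pspl n p (Suc q) i x))"

lemma gb_hat:
  assumes n: "n > 0" and S: "gbS Q mu (1 / real n) > 0" and x: "x \<in> {0..1}"
  defines "s \<equiv> \<lambda>y. gbS Q mu y / gbS Q mu (1 / real n)"
  shows "gbspl Q mu n p (Suc 0) i x = rampL s (1 / real n) (knot n p i) (knot n p (i + 1)) x
    - rampR s (1 / real n) (knot n p (i + 1)) (knot n p (i + 2)) x"
proof -
  let ?a = "knot n p i" and ?b = "knot n p (i + 1)" and ?c = "knot n p (i + 2)"
  have st: "?b = ?a \<and> (?a = 0 \<or> ?a = 1) \<or> ?b = ?a + 1 / real n" "?c = ?b \<and> (?b = 0 \<or> ?b = 1) \<or> ?c = ?b + 1 / real n"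
    using knot_step[OF n, of p i] knot_step[OF n, of p "i + 1"] by simp_all
  have step: "v - u = h" if "v = u \<and> A \<or> v = u + h" "u < v" for u v h :: real and A
    using that by auto
  have ab: "?a < ?b \<Longrightarrow> ?b - ?a = 1 / real n" and bc: "?b < ?c \<Longrightarrow> ?c - ?b = 1 / real n"
    by (rule step[OF st(1)], assumption) (rule step[OF st(2)], assumption)
  have gen: "(if u < v \<and> A then gbS Q mu y / gbS Q mu (v - u) else if v < w \<and> B then gbS Q mu z / gbS Q mu (w - v) else 0)
      = (if u < v \<and> A then s y else if v < w \<and> B then s z else 0)"
    if "u < v \<Longrightarrow> v - u = 1 / real n" "v < w \<Longrightarrow> w - v = 1 / real n" for u v w y z A B
    using that by (auto simp: s_def)
  have "gbspl Q mu n p (Suc 0) i x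
    = (if ?a < ?b \<and> ?a \<le> x \<and> (x < ?b \<or> (x = ?b \<and> ?b = 1 \<and> ?c = 1)) then s (x - ?a)
      else if ?b < ?c \<and> ?b \<le> x \<and> (x < ?c \<or> (x = ?c \<and> ?c = 1)) then s (?c - x) else 0)"
    unfolding gbspl.simps Let_def by (rule gen[OF ab bc])
  also have "\<dots> = rampL s (1 / real n) ?a ?b x - rampR s (1 / real n) ?b ?c x"
    using S x n knot_bounds[OF n] by (intro hat_eq_ramps st) (auto simp: s_def)
  finally show ?thesis .
qed

lemma continuous_on_rampL:
  "(\<And>y. isCont s y) \<Longrightarrow> continuous_on S (rampL s h a b)" "(\<And>y. isCont s y) \<Longrightarrow> continuous_on S (rampR s h a b)"
proof -
  assume s: "\<And>y. isCont s y"
  have s': "continuous_on UNIV s" using s by (simp add: continuous_at_imp_continuous_on)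
  have "continuous_on S (\<lambda>x. s (max 0 (min h (x - a))))" "continuous_on S (\<lambda>x. s (max 0 (min h (b - x))))"
    by (rule continuous_on_compose2[OF s'], intro continuous_intros, simp)+
  then show "continuous_on S (rampL s h a b)" "continuous_on S (rampR s h a b)"
    unfolding rampL_def[abs_def] rampR_def[abs_def]
    by (cases "a < b"; cases "a < 1"; auto intro!: continuous_intros)+
qed

lemma ramp_profile_close:
  assumes n: "n > 0" and s: "\<And>y. y \<in> {0..1 / real n} \<Longrightarrow> \<bar>s y - real n * y\<bar> \<le> e" and e: "e > 0"
  shows "\<bar>rampL s (1 / real n) a b x - rampL (\<lambda>y. real n * y) (1 / real n) a b x\<bar> \<le> e"
    "\<bar>rampR s (1 / real n) a b x - rampR (\<lambda>y. real n * y) (1 / real n) a b x\<bar> \<le> e"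
  using s[of "max 0 (min (1 / real n) (x - a))"] s[of "max 0 (min (1 / real n) (b - x))"] e
  by (auto simp: rampL_def rampR_def abs_minus_commute)

lemma gb_appr_0:
  assumes mu: "mu > 0" and e: "e > 0"
  shows "eventually (gb_appr Q mu p 0 e) sequentially"
proof -
  have e2: "e / 2 > 0" using e by simp
  from gbC_profile[OF mu e2, of Q] show ?thesis
  proof eventually_elim
    case (elim n)
    then have n: "n > 0" and S: "gbS Q mu (1 / real n) > 0"
      and C: "\<forall>y\<in>{0..1 / real n}. \<bar>gbC Q mu y / gbS Q mu (1 / real n) - real n\<bar> \<le> e / 2 * real n" by auto
    let ?h = "1 / real n"
    define s where "s = (\<lambda>y. gbS Q mu y / gbS Q mu ?h)"
    let ?l = "\<lambda>y. real n * y"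
    have sc: "isCont s y" for y
      unfolding s_def using S by (intro continuous_intros DERIV_isCont[OF gbS_DERIV]) auto
    have close: "\<bar>s y - real n * y\<bar> \<le> e / 2" if "y \<in> {0..?h}" for y
      unfolding s_def using gbS_profile[OF n S that e2 C] .
    show ?case unfolding gb_appr_def
    proof (intro conjI allI n)
      fix i
      let ?a = "knot n p i" and ?b = "knot n p (i + 1)" and ?c = "knot n p (i + 2)"
      let ?G = "gbspl Q mu n p (Suc 0) i"
      have G: "?G x = rampL s ?h ?a ?b x - rampR s ?h ?b ?c x" if "x \<in> {0..1}" for x
        unfolding s_def by (rule gb_hat[OF n S that])
      have P: "pspl n p (Suc 0) i x = rampL ?l ?h ?a ?b x - rampR ?l ?h ?b ?c x" if "x \<in> {0..1}" for x
        using ramp_pspl_0[OF n that, of p i] ramp_pspl_0[OF n that, of p "i + 1"]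
          rampR_linear[OF n, of ?c ?b x] knot_step[OF n, of p "i + 1"] by auto
      show Gc: "continuous_on {0..1} ?G"
      proof (rule continuous_on_eq)
        show "continuous_on {0..1} (\<lambda>x. rampL s ?h ?a ?b x - rampR s ?h ?b ?c x)"
          by (intro continuous_on_diff continuous_on_rampL[OF sc])
        show "rampL s ?h ?a ?b x - rampR s ?h ?b ?c x = ?G x" if "x \<in> {0..1}" for x
          by (rule G[OF that, symmetric])
      qed
      have Pb: "bfun ?a ?c (pspl_bound 1) (pspl n p (Suc 0) i)"
        using pspl_bfun[OF n, of p i 1] by simp
      show "bfun (knot n p i) (knot n p (i + 0 + 2)) e (\<lambda>x. ?G x - pspl n p (Suc 0) i x)"
        unfolding bfun_def
      proof (intro conjI ballI impI)
        have "?G \<in> borel_measurable (lebesgue_on {0..1})"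
          by (rule continuous_imp_measurable_on_sets_lebesgue[OF Gc]) auto
        then show "(\<lambda>x. ?G x - pspl n p (Suc 0) i x) \<in> borel_measurable (lebesgue_on {0..1})"
          using Pb unfolding bfun_def by (intro borel_measurable_diff) (auto simp del: pspl.simps gbspl.simps)
      next
        fix x :: real assume x: "x \<in> {0..1}"
        show "\<bar>?G x - pspl n p (Suc 0) i x\<bar> \<le> e"
          unfolding G[OF x] P[OF x]
          using ramp_profile_close(1)[OF n close e2, of ?a ?b x] ramp_profile_close(2)[OF n close e2, of ?b ?c x]
          by linarith
        assume out: "x < knot n p i \<or> knot n p (i + 0 + 2) < x"
        have "pspl n p (Suc 0) i x = 0" using Pb out x unfolding bfun_def by (auto simp del: pspl.simps)
        moreover have "?G x = 0"
        proof -
          have "?a \<le> ?b" "?b \<le> ?c" using knot_mono[OF n, of i "i + 1" p] knot_mono[OF n, of "i + 1" "i + 2" p] by auto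
          then show ?thesis using out unfolding gbspl.simps Let_def by auto
        qed
        ultimately show "?G x - pspl n p (Suc 0) i x = 0" by simp
      qed
    qed
  qed
qed


lemma bfun_add:
  assumes f: "bfun a b B f" and g: "bfun a b C g"
  shows "bfun a b (B + C) (\<lambda>x. f x + g x)" "bfun a b (B + C) (\<lambda>x. f x - g x)"
proof -
  have "\<bar>f x + g x\<bar> \<le> B + C" "\<bar>f x - g x\<bar> \<le> B + C" if "x \<in> {0..1}" for x
  proof -
    have "\<bar>f x\<bar> \<le> B" "\<bar>g x\<bar> \<le> C" using f g that unfolding bfun_def by blast+
    then show "\<bar>f x + g x\<bar> \<le> B + C" "\<bar>f x - g x\<bar> \<le> B + C" by linarith+
  qed
  then show "bfun a b (B + C) (\<lambda>x. f x + g x)" "bfun a b (B + C) (\<lambda>x. f x - g x)"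
    using f g unfolding bfun_def by (simp_all add: borel_measurable_add borel_measurable_diff)
qed

lemma bfun_weaken:
  "bfun a b B f \<Longrightarrow> a' \<le> a \<Longrightarrow> b \<le> b' \<Longrightarrow> B \<le> B' \<Longrightarrow> bfun a' b' B' f"
  unfolding bfun_def by force

lemma bfun_scale: "bfun a b B f \<Longrightarrow> bfun a b (\<bar>c\<bar> * B) (\<lambda>x. c * f x)"
  unfolding bfun_def by (auto simp: abs_mult mult_left_mono)

lemma bfun_diff_imp:
  assumes "bfun a b e (\<lambda>x. f x - g x)" "bfun a b C g"
  shows "bfun a b (e + C) f"
  using bfun_add(1)[OF assms] by simp

text \<open>The derivative of \<open>ramp\<close> where \<open>f\<close> is continuous; a degenerate
  ramp is constant.\<close>

definition dramp :: "real \<Rightarrow> real \<Rightarrow> (real \<Rightarrow> real) \<Rightarrow> real \<Rightarrow> real" where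
  "dramp a b f x = (if a < b then f x / integral {0..1} f else 0)"

text \<open>Here \<open>V = l / m\<close> is the exact integral of a polynomial spline with support
  length \<open>l\<close>. Errors are measured against \<open>l\<close>, so the length cancels for
  ramps (\<open>w = l\<close>) and leaves \<open>1 / l\<close> for their derivatives
  (\<open>w = 1\<close>). Smallness of \<open>e\<close> keeps \<open>U\<close> above
  \<open>V / 2\<close>.\<close>

lemma quotient_perturbation:
  fixes u v U V :: real
  assumes V: "V = l / m" and l: "l > 0" and m: "m > 0" and U: "\<bar>U - V\<bar> \<le> e * l"
    and e: "2 * m * e \<le> 1" and uv: "\<bar>u - v\<bar> \<le> e * w" and v: "\<bar>v\<bar> \<le> C * w" and w: "w \<ge> 0" and C: "C \<ge> 0"
  shows "\<bar>u / U - v / V\<bar> \<le> 2 * m * (1 + C * m) * e * (w / l)" "U > 0"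
proof -
  have "2 * m * e * l \<le> 1 * l" using e l by (intro mult_right_mono) auto
  then have "e * l \<le> V / 2" using m unfolding V by (simp add: field_simps)
  then have UV: "U \<ge> V / 2" using U by linarith
  have V0: "V > 0" using V l m by simp
  show U0: "U > 0" using UV V0 by linarith
  have "u / U - v / V = (u - v) / U + v * (V - U) / (U * V)"
    using U0 V0 by (simp add: field_simps)
  then have "\<bar>u / U - v / V\<bar> \<le> \<bar>u - v\<bar> / U + \<bar>v\<bar> * \<bar>U - V\<bar> / (U * V)"
    using abs_triangle_ineq[of "(u - v) / U" "v * (V - U) / (U * V)"] U0 V0 by (simp add: abs_mult abs_minus_commute)
  also have "\<dots> \<le> (e * w) / (V / 2) + (C * w) * (e * l) / ((V / 2) * V)"
    using uv v U UV V0 U0 w C by (intro add_mono frac_le mult_mono) auto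
  also have "\<dots> = 2 * m * (1 + C * m) * e * (w / l)"
    using l m unfolding V by (simp add: field_simps)
  finally show "\<bar>u / U - v / V\<bar> \<le> 2 * m * (1 + C * m) * e * (w / l)" .
qed

text \<open>The constant of \<open>quotient_perturbation\<close> in degree \<open>Suc q\<close>,
  with \<open>m = q + 2\<close> and \<open>C\<close> the bound of the polynomial spline.\<close>

definition gb_const :: "nat \<Rightarrow> real" where
  "gb_const q = 2 * real (q + 2) * (1 + pspl_bound (Suc q) * real (q + 2))"

lemma gb_const_pos: "gb_const q > 0"
  using pspl_bound_ge_1[of "Suc q"] unfolding gb_const_def by (intro mult_pos_pos add_pos_nonneg) auto

section \<open>Perturbation from one degree to the next\<close>

context
  fixes Q mu p q e n
  assumes ap: "gb_appr Q mu p q e n" and e: "2 * real (q + 2) * e \<le> 1"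
begin

private abbreviation "k \<equiv> knot n p"
private abbreviation "G \<equiv> gbspl Q mu n p (Suc q)"
private abbreviation "P \<equiv> pspl n p (Suc q)"

lemma gb_n: "n > 0" using ap by (simp add: gb_appr_def)

lemma gb_diff: "bfun (k i) (k (i + q + 2)) e (\<lambda>x. G i x - P i x)"
  using ap unfolding gb_appr_def by blast

lemma gb_cont: "continuous_on {0..1} (G i)"
  using ap unfolding gb_appr_def by blast

lemma gb_P: "bfun (k i) (k (i + q + 2)) (pspl_bound (Suc q)) (P i)"
  using pspl_bfun[OF gb_n, of p i "Suc q"] by (simp del: pspl.simps pspl_bound.simps)

lemma gb_G: "bfun (k i) (k (i + q + 2)) (e + pspl_bound (Suc q)) (G i)"
  by (rule bfun_diff_imp[OF gb_diff gb_P])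

lemma gb_le: "k i \<le> k (i + q + 2)"
  by (rule knot_mono[OF gb_n]) simp

lemma gb_deg: "k i < k (i + q + 2) \<or> k i = 0 \<or> k i = 1"
  using gb_le[of i] knot_degenerate[OF gb_n, of i "i + q + 2" p] by auto

lemma gb_P_integral: "integral {0..1} (P i) = (k (i + q + 2) - k i) / real (q + 2)"
  using pspl_integral[OF gb_n, of p "Suc q" i] by (simp del: pspl.simps)

lemma gb_integral_diff:
  assumes "x \<le> 1" shows "\<bar>integral {0..x} (G i) - integral {0..x} (P i)\<bar> \<le> e * (k (i + q + 2) - k i)"
proof -
  have "integral {0..x} (G i) - integral {0..x} (P i) = integral {0..x} (\<lambda>x. G i x - P i x)"
    using assms by (intro Henstock_Kurzweil_Integration.integral_diff[symmetric] bfun_integrable[OF gb_G] bfun_integrable[OF gb_P]) auto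
  then show ?thesis using bfun_integral_le[OF gb_diff gb_le assms] by (simp only:)
qed

lemma gb_quotient:
  assumes "k i < k (i + q + 2)" "\<bar>u - v\<bar> \<le> e * w" "\<bar>v\<bar> \<le> pspl_bound (Suc q) * w" "w \<ge> 0"
  shows "\<bar>u / integral {0..1} (G i) - v / integral {0..1} (P i)\<bar> \<le> gb_const q * e * (w / (k (i + q + 2) - k i))"
    "integral {0..1} (G i) > 0"
proof -
  have l: "k (i + q + 2) - k i > 0" using assms by simp
  have m: "real (q + 2) > 0" by simp
  have C: "0 \<le> pspl_bound (Suc q)" using pspl_bound_ge_1[of "Suc q"] by linarith
  show "\<bar>u / integral {0..1} (G i) - v / integral {0..1} (P i)\<bar> \<le> gb_const q * e * (w / (k (i + q + 2) - k i))"
    "integral {0..1} (G i) > 0"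
    using quotient_perturbation[OF gb_P_integral[of i] l m gb_integral_diff[OF order.refl, of i] e assms(2-4) C]
    unfolding gb_const_def by blast+
qed

lemma gb_integral_pos: "k i < k (i + q + 2) \<Longrightarrow> integral {0..1} (G i) > 0"
  using gb_quotient(2)[of i 0 0 0] by simp

lemma gb_ramp_diff:
  assumes "x \<in> {0..1}"
  shows "\<bar>ramp (k i) (k (i + q + 2)) (G i) x - ramp (k i) (k (i + q + 2)) (P i) x\<bar> \<le> gb_const q * e"
proof (cases "k i < k (i + q + 2)")
  case True
  let ?l = "k (i + q + 2) - k i"
  have "\<bar>integral {0..x} (G i) / integral {0..1} (G i) - integral {0..x} (P i) / integral {0..1} (P i)\<bar> \<le> gb_const q * e * (?l / ?l)"
    using assms True by (intro gb_quotient(1) gb_integral_diff bfun_integral_le[OF gb_P gb_le]) auto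
  then show ?thesis using True by (simp add: ramp_def del: pspl.simps gbspl.simps)
next
  case False
  have "0 \<le> e" by (rule bfun_nonneg[OF gb_diff])
  then show ?thesis using False gb_const_pos[of q] by (simp add: ramp_def)
qed

text \<open>The leftover factor \<open>1 / l\<close> is at most \<open>n\<close> by
  \<open>knot_gap\<close>; derivatives are of order \<open>n\<close>, so the error is small relative
  to them.\<close>

lemma gb_dramp_diff:
  "bfun (k i) (k (i + q + 2)) (gb_const q * e * real n) (\<lambda>x. dramp (k i) (k (i + q + 2)) (G i) x - dramp (k i) (k (i + q + 2)) (P i) x)"
proof (cases "k i < k (i + q + 2)")
  case True
  let ?l = "k (i + q + 2) - k i"
  have e0: "0 \<le> e" by (rule bfun_nonneg[OF gb_diff])
  have l: "1 / ?l \<le> real n"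
    using knot_gap[OF gb_n True] True gb_n by (simp add: field_simps)
  show ?thesis unfolding bfun_def
  proof (intro conjI ballI impI)
    show "(\<lambda>x. dramp (k i) (k (i + q + 2)) (G i) x - dramp (k i) (k (i + q + 2)) (P i) x) \<in> borel_measurable (lebesgue_on {0..1})"
      using gb_G[of i] gb_P[of i] True unfolding dramp_def bfun_def
      by (auto intro!: borel_measurable_diff borel_measurable_divide simp del: pspl.simps gbspl.simps)
  next
    fix x :: real assume x: "x \<in> {0..1}"
    have "\<bar>G i x - P i x\<bar> \<le> e * 1" "\<bar>P i x\<bar> \<le> pspl_bound (Suc q) * 1"
      using gb_diff[of i] gb_P[of i] x unfolding bfun_def by (auto simp del: pspl.simps gbspl.simps pspl_bound.simps)
    then have "\<bar>G i x / integral {0..1} (G i) - P i x / integral {0..1} (P i)\<bar> \<le> gb_const q * e * (1 / ?l)"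
      by (intro gb_quotient(1)[OF True]) auto
    also have "\<dots> \<le> gb_const q * e * real n" using l e0 gb_const_pos[of q] by (intro mult_left_mono) auto
    finally show "\<bar>dramp (k i) (k (i + q + 2)) (G i) x - dramp (k i) (k (i + q + 2)) (P i) x\<bar> \<le> gb_const q * e * real n"
      using True by (simp add: dramp_def del: pspl.simps gbspl.simps)
    assume "x < k i \<or> k (i + q + 2) < x"
    then show "dramp (k i) (k (i + q + 2)) (G i) x - dramp (k i) (k (i + q + 2)) (P i) x = 0"
      using gb_G[of i] gb_P[of i] x unfolding dramp_def bfun_def by (auto simp del: pspl.simps gbspl.simps)
  qed
next
  case False
  have "0 \<le> e" by (rule bfun_nonneg[OF gb_diff])
  then show ?thesis using False gb_const_pos[of q] by (simp add: dramp_def bfun_def)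
qed

text \<open>The primitive in \<open>gbspl\<close> starts at the first knot, but below it the
  function vanishes. For \<open>x\<close> left of the support the interval \<open>{k i..x}\<close>
  is empty and both integrals are 0.\<close>

lemma gb_Phi_eq_ramp:
  assumes x: "x \<in> {0..1}"
  shows "(if k i < k (i + q + 2) then integral {k i..x} (G i) / integral {k i..k (i + q + 2)} (G i)
      else if k i < 1 \<and> k i \<le> x then 1 else 0) = ramp (k i) (k (i + q + 2)) (G i) x"
proof (cases "k i < k (i + q + 2)")
  case True
  note bd = knot_bounds[OF gb_n]
  have z: "integral {u..v} (G i) = 0" if "\<And>y. y \<in> {u<..<v} \<Longrightarrow> y \<in> {0..1} \<and> (y < k i \<or> k (i + q + 2) < y)" for u v
  proof -
    have "integral {u..v} (G i) = integral {u..v} (\<lambda>_. 0)"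
    proof (rule integral_spike[of "{u, v}"])
      fix y assume "y \<in> {u..v} - {u, v}"
      then have "y \<in> {u<..<v}" by auto
      from that[OF this] show "0 = G i y" using gb_G[of i] unfolding bfun_def by auto
    qed simp
    then show ?thesis by simp
  qed
  have c: "integral {0..y} (G i) = integral {0..k i} (G i) + integral {k i..y} (G i)" if "k i \<le> y" "y \<le> 1" for y
    using that bd[of p i] by (intro Henstock_Kurzweil_Integration.integral_combine[symmetric] bfun_integrable[OF gb_G]) auto
  have z0: "integral {0..k i} (G i) = 0" using bd[of p i] by (intro z) auto
  have x1: "integral {k i..x} (G i) = integral {0..x} (G i)"
  proof (cases "k i \<le> x")
    case False
    then show ?thesis using z[of 0 x] x by auto
  qed (use c z0 x in auto)
  have "integral {0..1} (G i) = integral {0..k (i + q + 2)} (G i) + integral {k (i + q + 2)..1} (G i)"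
    using bd[of p "i + q + 2"] by (intro Henstock_Kurzweil_Integration.integral_combine[symmetric] bfun_integrable[OF gb_G]) auto
  also have "integral {k (i + q + 2)..1} (G i) = 0" using bd[of p "i + q + 2"] by (intro z) auto
  also have "integral {0..k (i + q + 2)} (G i) = integral {k i..k (i + q + 2)} (G i)"
    using c[of "k (i + q + 2)"] z0 True bd[of p "i + q + 2"] by simp
  finally show ?thesis using True x1 by (simp add: ramp_def del: gbspl.simps)
next
  case False
  then show ?thesis using gb_deg[of i] x by (auto simp: ramp_def)
qed

lemma gbspl_eq_ramp:
  assumes x: "x \<in> {0..1}"
  shows "gbspl Q mu n p (Suc (Suc q)) i x
    = ramp (k i) (k (i + q + 2)) (G i) x - ramp (k (i + 1)) (k (i + 1 + q + 2)) (G (i + 1)) x"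
  unfolding gbspl.simps(3) Let_def gb_Phi_eq_ramp[OF x] ..

text \<open>Each of the two ramps is off by at most \<open>gb_const q * e\<close>; left and right of
  the support they cancel exactly, both being 0 or both being 1.\<close>

lemma gb_appr_step: "gb_appr Q mu p (Suc q) (2 * gb_const q * e) n"
  unfolding gb_appr_def
proof (intro conjI allI gb_n)
  fix i
  let ?G' = "gbspl Q mu n p (Suc (Suc q)) i" and ?P' = "pspl n p (Suc (Suc q)) i"
  let ?a = "k i" and ?b = "k (i + q + 2)" and ?c = "k (i + 1)" and ?d = "k (i + 1 + q + 2)"
  have P': "?P' x = ramp ?a ?b (P i) x - ramp ?c ?d (P (i + 1)) x" for x
    by (subst pspl.simps(2)) (simp del: pspl.simps)
  have Pb: "bfun ?a ?d (pspl_bound (Suc (Suc q))) ?P'"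
    using pspl_bfun[OF gb_n, of p i "Suc (Suc q)"] by (simp del: pspl.simps pspl_bound.simps)
  have rc: "continuous_on {0..1} (ramp (k i) (k (i + q + 2)) (G i))" for i
    by (rule continuous_on_ramp) (rule bfun_integrable[OF gb_G], auto)
  show Gc: "continuous_on {0..1} ?G'"
    by (rule continuous_on_eq[OF continuous_on_diff[OF rc[of i] rc[of "i + 1"]]])
      (rule gbspl_eq_ramp[symmetric])
  show "bfun ?a (k (i + Suc q + 2)) (2 * gb_const q * e) (\<lambda>x. ?G' x - ?P' x)"
    unfolding bfun_def
  proof (intro conjI ballI impI)
    have "?G' \<in> borel_measurable (lebesgue_on {0..1})"
      by (rule continuous_imp_measurable_on_sets_lebesgue[OF Gc]) auto
    then show "(\<lambda>x. ?G' x - ?P' x) \<in> borel_measurable (lebesgue_on {0..1})"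
      using Pb unfolding bfun_def by (intro borel_measurable_diff) (auto simp del: pspl.simps gbspl.simps)
  next
    fix x :: real assume x: "x \<in> {0..1}"
    show "\<bar>?G' x - ?P' x\<bar> \<le> 2 * gb_const q * e"
      unfolding gbspl_eq_ramp[OF x] P'
      using gb_ramp_diff[OF x, of i] gb_ramp_diff[OF x, of "i + 1"] by linarith
    assume out: "x < ?a \<or> k (i + Suc q + 2) < x"
    have "?P' x = 0" using Pb out x unfolding bfun_def by (auto simp del: pspl.simps)
    moreover have "?G' x = 0"
    proof (cases "x < ?a")
      case True
      then have "x < ?c" using knot_mono[OF gb_n, of i "i + 1" p] by simp
      then show ?thesis
        using True x ramp_left[OF gb_G _ _ _ gb_deg, of x i] ramp_left[OF gb_G _ _ _ gb_deg, of x "i + 1"]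
        unfolding gbspl_eq_ramp[OF x] by (simp del: gbspl.simps)
    next
      case False
      then have o2: "?d < x" using out by simp
      then have o1: "?b < x" using knot_mono[OF gb_n, of "i + q + 2" "i + 1 + q + 2" p] by simp
      have "ramp ?a ?b (G i) x = 1"
        by (rule ramp_right[OF gb_G _ _ o1 gb_le]) (use x gb_integral_pos[of i] in \<open>auto simp del: gbspl.simps\<close>)
      moreover have "ramp ?c ?d (G (i + 1)) x = 1"
        by (rule ramp_right[OF gb_G _ _ o2 gb_le]) (use x gb_integral_pos[of "i + 1"] in \<open>auto simp del: gbspl.simps\<close>)
      ultimately show ?thesis unfolding gbspl_eq_ramp[OF x] by (simp del: gbspl.simps)
    qed
    ultimately show "?G' x - ?P' x = 0" by simp
  qed
qed

lemma gb_ramp_DERIV: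
  assumes x: "x \<in> {0<..<1}"
  shows "(ramp (k i) (k (i + q + 2)) (G i) has_real_derivative dramp (k i) (k (i + q + 2)) (G i) x) (at x)"
proof (cases "k i < k (i + q + 2)")
  case True
  have "((\<lambda>u. integral {0..u} (G i)) has_real_derivative G i x) (at x within {0..1})"
    using x by (intro integral_has_real_derivative gb_cont) auto
  then have "((\<lambda>u. integral {0..u} (G i)) has_real_derivative G i x) (at x)"
    using x by (simp add: at_within_Icc_at del: gbspl.simps)
  then show ?thesis using True DERIV_cdivide unfolding ramp_def[abs_def] dramp_def by auto
qed (simp add: ramp_def[abs_def] dramp_def)

lemma deriv_gbspl:
  assumes x: "x \<in> {0<..<1}"
  shows "deriv (gbspl Q mu n p (Suc (Suc q)) i) x
    = dramp (k i) (k (i + q + 2)) (G i) x - dramp (k (i + 1)) (k (i + 1 + q + 2)) (G (i + 1)) x"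
proof (rule DERIV_imp_deriv)
  have "eventually (\<lambda>u. u \<in> {0<..<1}) (nhds x)" using x by (intro eventually_nhds_in_open) auto
  then have ev: "eventually (\<lambda>u. gbspl Q mu n p (Suc (Suc q)) i u
     = ramp (k i) (k (i + q + 2)) (G i) u - ramp (k (i + 1)) (k (i + 1 + q + 2)) (G (i + 1)) u) (nhds x)"
    by eventually_elim (rule gbspl_eq_ramp, auto)
  show "(gbspl Q mu n p (Suc (Suc q)) i has_real_derivative
     dramp (k i) (k (i + q + 2)) (G i) x - dramp (k (i + 1)) (k (i + 1 + q + 2)) (G (i + 1)) x) (at x)"
    unfolding DERIV_cong_ev[OF refl ev refl] by (intro DERIV_diff gb_ramp_DERIV x)
qed

end

lemma gb_appr_eventually:
  assumes mu: "mu > 0" and e: "e > 0"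
  shows "eventually (gb_appr Q mu p q e) sequentially"
  using e
proof (induction q arbitrary: e)
  case 0
  then show ?case by (rule gb_appr_0[OF mu])
next
  case (Suc q)
  \<comment> \<open>The first bound undoes the growth of the error, the second is the smallness that
    the quotient estimate requires.\<close>
  define e' where "e' = min (e / (2 * gb_const q)) (1 / (2 * real (q + 2)))"
  have e': "e' > 0" "2 * gb_const q * e' \<le> e" "2 * real (q + 2) * e' \<le> 1"
    using Suc.prems gb_const_pos[of q] by (auto simp: e'_def min_def field_simps)
  from Suc.IH[OF e'(1)] show ?case
  proof eventually_elim
    case (elim n)
    from gb_appr_step[OF elim e'(3)] show ?case
      unfolding gb_appr_def using e'(2) by (auto intro: bfun_weaken simp del: pspl.simps gbspl.simps)
  qed
qed

section \<open>Derivatives and matrix entries\<close>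

lemma rampL_DERIV:
  assumes s: "\<And>y. (s has_real_derivative s' y) (at y)" and b: "b = a + h" "h > 0" and x: "x \<noteq> a" "x \<noteq> b"
  shows "(rampL s h a b has_real_derivative (if a \<le> x \<and> x < b then s' (x - a) else 0)) (at x)"
    "(rampR s h a b has_real_derivative (if a \<le> x \<and> x < b then s' (b - x) else 0)) (at x)"
proof -
  have ab: "a < b" using b by simp
  have ev: "eventually (\<lambda>u. u \<in> S) (nhds x)" if "open S" "x \<in> S" for S
    using that by (rule eventually_nhds_in_open)
  consider "x < a" | "a < x" "x < b" | "b < x" using x by linarith
  then have "(rampL s h a b has_real_derivative (if a \<le> x \<and> x < b then s' (x - a) else 0)) (at x)
    \<and> (rampR s h a b has_real_derivative (if a \<le> x \<and> x < b then s' (b - x) else 0)) (at x)"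
  proof cases
    case 1
    have e1: "eventually (\<lambda>u. rampL s h a b u = s 0) (nhds x)"
      using ev[of "{..<a}"] 1 by (auto elim!: eventually_mono simp: rampL_def ab b)
    have e2: "eventually (\<lambda>u. rampR s h a b u = 1 - s h) (nhds x)"
      using ev[of "{..<a}"] 1 b(2) by (auto elim!: eventually_mono simp: rampR_def ab b)
    show ?thesis using 1 unfolding DERIV_cong_ev[OF refl e1 refl] DERIV_cong_ev[OF refl e2 refl] by simp
  next
    case 2
    have e1: "eventually (\<lambda>u. rampL s h a b u = s (u - a)) (nhds x)"
      using ev[of "{a<..<b}"] 2 by (auto elim!: eventually_mono simp: rampL_def b)
    have e2: "eventually (\<lambda>u. rampR s h a b u = 1 - s (b - u)) (nhds x)"
      using ev[of "{a<..<b}"] 2 by (auto elim!: eventually_mono simp: rampR_def b)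
    have d1: "((\<lambda>u. s (u - a)) has_real_derivative s' (x - a) * 1) (at x)"
      by (rule DERIV_chain2[OF s]) (auto intro!: derivative_eq_intros)
    have d2: "((\<lambda>u. s (b - u)) has_real_derivative s' (b - x) * -1) (at x)"
      by (rule DERIV_chain2[OF s]) (auto intro!: derivative_eq_intros)
    have d3: "((\<lambda>u. 1 - s (b - u)) has_real_derivative s' (b - x)) (at x)"
      using DERIV_diff[OF DERIV_const d2, of 1] by simp
    show ?thesis using 2 d1 d3 unfolding DERIV_cong_ev[OF refl e1 refl] DERIV_cong_ev[OF refl e2 refl] by simp
  next
    case 3
    have e1: "eventually (\<lambda>u. rampL s h a b u = s h) (nhds x)"
      using ev[of "{b<..}"] 3 b(2) by (auto elim!: eventually_mono simp: rampL_def b)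
    have e2: "eventually (\<lambda>u. rampR s h a b u = 1 - s 0) (nhds x)"
      using ev[of "{b<..}"] 3 b(2) by (auto elim!: eventually_mono simp: rampR_def b)
    show ?thesis using 3 unfolding DERIV_cong_ev[OF refl e1 refl] DERIV_cong_ev[OF refl e2 refl] by simp
  qed
  then show "(rampL s h a b has_real_derivative (if a \<le> x \<and> x < b then s' (x - a) else 0)) (at x)"
    "(rampR s h a b has_real_derivative (if a \<le> x \<and> x < b then s' (b - x) else 0)) (at x)" by auto
qed

text \<open>Formally the derivative of \<open>pspl n p p i\<close>; it serves as the explicit
  comparison function in the stiffness integrals.\<close>

definition dspl :: "nat \<Rightarrow> nat \<Rightarrow> nat \<Rightarrow> real \<Rightarrow> real" where
  "dspl n p i x = dramp (knot n p i) (knot n p (i + p)) (pspl n p (p - 1) i) x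
     - dramp (knot n p (i + 1)) (knot n p (i + 1 + p)) (pspl n p (p - 1) (i + 1)) x"

text \<open>\<open>deriv\<close> is replaced by an explicit \<open>E\<close> because a hat has no
  derivative at its knots. The mesh points form a null set, and the factor \<open>n\<close> in the
  tolerance is the natural size of the derivatives.\<close>

definition deriv_appr :: "gbkind \<Rightarrow> real \<Rightarrow> nat \<Rightarrow> real \<Rightarrow> nat \<Rightarrow> (nat \<Rightarrow> real \<Rightarrow> real) \<Rightarrow> bool" where
  "deriv_appr Q mu p e n E \<longleftrightarrow> (\<forall>i. (\<forall>x\<in>{0<..<1}. real n * x \<notin> \<int> \<longrightarrow> deriv (GBN Q mu n p i) x = E i x) \<and>
     bfun (knot n p i) (knot n p (i + p + 1)) (e * real n) (\<lambda>x. E i x - dspl n p i x))"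

text \<open>Degree 1 stands apart: its derivative jumps at knots and comes from the slope estimate
  of the profile, not from the integral recurrence.\<close>

lemma deriv_appr_1:
  assumes mu: "mu > 0" and e: "e > 0"
  shows "eventually (\<lambda>n. n > 0 \<and> (\<exists>E. deriv_appr Q mu 1 e n E)) sequentially"
proof -
  have e2: "e / 2 > 0" using e by simp
  from gbC_profile[OF mu e2, of Q] show ?thesis
  proof eventually_elim
    case (elim n)
    then have n: "n > 0" and S: "gbS Q mu (1 / real n) > 0"
      and C: "\<And>y. y \<in> {0..1 / real n} \<Longrightarrow> \<bar>gbC Q mu y / gbS Q mu (1 / real n) - real n\<bar> \<le> e / 2 * real n" by auto
    let ?h = "1 / real n"
    let ?k = "knot n 1"
    define s where "s = (\<lambda>y. gbS Q mu y / gbS Q mu ?h)"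
    define s' where "s' = (\<lambda>y. gbC Q mu y / gbS Q mu ?h)"
    have sd: "(s has_real_derivative s' y) (at y)" for y
      unfolding s_def s'_def by (rule DERIV_cdivide[OF gbS_DERIV])
    have close: "\<bar>s' y - real n\<bar> \<le> e / 2 * real n" if "0 \<le> y" "y \<le> ?h" for y
      unfolding s'_def using C[of y] that by simp
    \<comment> \<open>Derivatives of the two ramps off the knots. In the falling one the reflection
      and the outer minus sign cancel.\<close>
    define U where "U = (\<lambda>a b x. if a < b \<and> a \<le> x \<and> x < b then s' (x - a) else 0)"
    define V where "V = (\<lambda>a b x. if a < b \<and> a \<le> x \<and> x < b then s' (b - x) else 0)"
    have step: "?k (i + 1) = ?k i \<or> ?k (i + 1) = ?k i + ?h" for i using knot_step[OF n, of 1 i] by blast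
    have hpos: "?h > 0" using n by simp
    have dU: "(rampL s ?h a b has_real_derivative U a b x) (at x)"
      and dV: "(rampR s ?h a b has_real_derivative V a b x) (at x)"
      if "b = a \<or> b = a + ?h" "x \<noteq> a" "x \<noteq> b" for a b x
    proof -
      have "(rampL s ?h a b has_real_derivative U a b x) (at x) \<and> (rampR s ?h a b has_real_derivative V a b x) (at x)"
      proof (cases "a < b")
        case True
        then have b: "b = a + ?h" using that(1) by auto
        show ?thesis
          using rampL_DERIV[OF sd b hpos that(2,3)] True by (simp add: U_def V_def)
      next
        case False
        then show ?thesis by (simp add: U_def V_def rampL_def[abs_def] rampR_def[abs_def])
      qed
      then show "(rampL s ?h a b has_real_derivative U a b x) (at x)" "(rampR s ?h a b has_real_derivative V a b x) (at x)"
        by auto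
    qed
    have dr0: "dramp (?k i) (?k (i + 1)) (pspl n 1 0 i) x = (if ?k i < ?k (i + 1) \<and> ?k i \<le> x \<and> x < ?k (i + 1) then real n else 0)" for i x
    proof (cases "?k i < ?k (i + 1)")
      case True
      then have "?k (i + 1) - ?k i = ?h" using step[of i] by auto
      then have "integral {0..1} (pspl n 1 0 i) = ?h" using pspl_integral[OF n, of 1 0 i] by simp
      then show ?thesis using True unfolding dramp_def by simp
    qed (simp add: dramp_def)
    have bf: "bfun (?k i) (?k (i + 1)) (e / 2 * real n) (\<lambda>x. T (?k i) (?k (i + 1)) x - dramp (?k i) (?k (i + 1)) (pspl n 1 0 i) x)"
      if T: "T = U \<or> T = V" for T i
    proof -
      let ?a = "?k i" and ?b = "?k (i + 1)"
      have sm: "(\<lambda>x. s' (x - ?a)) \<in> borel_measurable borel" "(\<lambda>x. s' (?b - x)) \<in> borel_measurable borel"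
        unfolding s'_def using S
        by (intro borel_measurable_continuous_onI continuous_intros continuous_at_imp_continuous_on ballI
            isCont_o2[OF _ gbC_isCont]; auto intro!: continuous_intros)+
      have "(\<lambda>x. T ?a ?b x - dramp ?a ?b (pspl n 1 0 i) x) \<in> borel_measurable borel"
        unfolding dr0 U_def V_def using T sm unfolding U_def V_def by auto
      then have m: "(\<lambda>x. T ?a ?b x - dramp ?a ?b (pspl n 1 0 i) x) \<in> borel_measurable (lebesgue_on {0..1})"
        by (intro measurable_restrict_space1 measurable_completion) simp
      have "\<bar>T ?a ?b x - dramp ?a ?b (pspl n 1 0 i) x\<bar> \<le> e / 2 * real n" for x
      proof (cases "?a < ?b \<and> ?a \<le> x \<and> x < ?b")
        case True
        then have "?b = ?a + ?h" using step[of i] by auto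
        then have "\<bar>s' (x - ?a) - real n\<bar> \<le> e / 2 * real n" "\<bar>s' (?b - x) - real n\<bar> \<le> e / 2 * real n"
          using True by (intro close; simp)+
        then show ?thesis using T True unfolding dr0 U_def V_def by auto
      next
        case False
        have "T ?a ?b x = 0" using T False unfolding U_def V_def by auto
        then show ?thesis using False e unfolding dr0 by auto
      qed
      moreover have "T ?a ?b x - dramp ?a ?b (pspl n 1 0 i) x = 0" if "x < ?a \<or> ?b < x" for x
        using T that unfolding dr0 U_def V_def by auto
      ultimately show ?thesis using m unfolding bfun_def by blast
    qed
    define E where "E = (\<lambda>i x. U (?k i) (?k (i + 1)) x - V (?k (i + 1)) (?k (i + 2)) x)"
    have "deriv_appr Q mu 1 e n E" unfolding deriv_appr_def
    proof (intro allI conjI ballI impI)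
      fix i x assume x: "x \<in> {0<..<1::real}" "real n * x \<notin> \<int>"
      have ne: "x \<noteq> ?k j" for j using knot_Ints[OF n, of 1 j] x(2) by metis
      have "eventually (\<lambda>u. u \<in> {0<..<1}) (nhds x)" using x by (intro eventually_nhds_in_open) auto
      then have ev: "eventually (\<lambda>u. GBN Q mu n 1 i u = rampL s ?h (?k i) (?k (i + 1)) u - rampR s ?h (?k (i + 1)) (?k (i + 2)) u) (nhds x)"
        unfolding GBN_def s_def One_nat_def by eventually_elim (rule gb_hat[OF n S, unfolded One_nat_def], auto)
      have st2: "?k (i + 2) = ?k (i + 1) \<or> ?k (i + 2) = ?k (i + 1) + ?h" using step[of "i + 1"] by simp
      show "deriv (GBN Q mu n 1 i) x = E i x"
        unfolding E_def
        by (rule DERIV_imp_deriv, unfold DERIV_cong_ev[OF refl ev refl])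
          (intro DERIV_diff dU dV step st2 ne)
    next
      fix i
      have mono: "?k i \<le> ?k (i + 1)" "?k (i + 1) \<le> ?k (i + 2)"
        using knot_mono[OF n, of i "i + 1" 1] knot_mono[OF n, of "i + 1" "i + 2" 1] by auto
      let ?u = "\<lambda>x. U (?k i) (?k (i + 1)) x - dramp (?k i) (?k (i + 1)) (pspl n 1 0 i) x"
      let ?v = "\<lambda>x. V (?k (i + 1)) (?k (i + 2)) x - dramp (?k (i + 1)) (?k (i + 2)) (pspl n 1 0 (i + 1)) x"
      have u: "bfun (?k i) (?k (i + 2)) (e / 2 * real n) ?u"
        by (rule bfun_weaken[OF bf]) (use mono in auto)
      have "bfun (?k (i + 1)) (?k (i + 1 + 1)) (e / 2 * real n) (\<lambda>x. V (?k (i + 1)) (?k (i + 1 + 1)) x - dramp (?k (i + 1)) (?k (i + 1 + 1)) (pspl n 1 0 (i + 1)) x)"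
        by (rule bf) simp
      then have "bfun (?k (i + 1)) (?k (i + 2)) (e / 2 * real n) ?v" by (simp only: add.assoc one_add_one)
      then have v: "bfun (?k i) (?k (i + 2)) (e / 2 * real n) ?v"
        by (rule bfun_weaken) (use mono in auto)
      have eq: "E i x - dspl n 1 i x = ?u x - ?v x" for x
        unfolding E_def dspl_def by (simp only: add.assoc one_add_one diff_self_eq_0)
      have "e / 2 * real n + e / 2 * real n = e * real n" by simp
      then show "bfun (?k i) (?k (i + 1 + 1)) (e * real n) (\<lambda>x. E i x - dspl n 1 i x)"
        using bfun_add(2)[OF u v] unfolding eq by (simp only: add.assoc one_add_one)
    qed
    then show ?case using n by blast
  qed
qed

lemma deriv_appr_Suc:
  assumes ap: "gb_appr Q mu (Suc (Suc q)) q e n" and e: "2 * real (q + 2) * e \<le> 1"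
  shows "\<exists>E. deriv_appr Q mu (Suc (Suc q)) (2 * gb_const q * e) n E"
proof -
  let ?p = "Suc (Suc q)"
  let ?k = "knot n ?p" and ?G = "gbspl Q mu n ?p (Suc q)" and ?P = "pspl n ?p (Suc q)"
  note n = gb_n[OF ap e]
  define E where "E = (\<lambda>i x. dramp (?k i) (?k (i + q + 2)) (?G i) x - dramp (?k (i + 1)) (?k (i + 1 + q + 2)) (?G (i + 1)) x)"
  have "deriv_appr Q mu ?p (2 * gb_const q * e) n E" unfolding deriv_appr_def
  proof (intro allI conjI ballI impI)
    fix i x assume "x \<in> {0<..<1::real}"
    then show "deriv (GBN Q mu n ?p i) x = E i x"
      unfolding GBN_def E_def by (rule deriv_gbspl[OF ap e])
  next
    fix i
    let ?d = "\<lambda>i x. dramp (?k i) (?k (i + q + 2)) (?G i) x - dramp (?k i) (?k (i + q + 2)) (?P i) x"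
    have u: "bfun (?k i) (?k (i + ?p + 1)) (gb_const q * e * real n) (?d i)"
      by (rule bfun_weaken[OF gb_dramp_diff[OF ap e]]) (auto intro!: knot_mono[OF n])
    have v: "bfun (?k i) (?k (i + ?p + 1)) (gb_const q * e * real n) (?d (i + 1))"
      by (rule bfun_weaken[OF gb_dramp_diff[OF ap e]]) (auto intro!: knot_mono[OF n])
    have e1: "i + ?p = i + q + 2" "i + 1 + ?p = i + 1 + q + 2" "?p - 1 = Suc q" by simp_all
    have eq: "E i x - dspl n ?p i x = ?d i x - ?d (i + 1) x" for x
      unfolding E_def dspl_def e1 by linarith
    have "gb_const q * e * real n + gb_const q * e * real n = 2 * gb_const q * e * real n" by simp
    then show "bfun (?k i) (?k (i + ?p + 1)) (2 * gb_const q * e * real n) (\<lambda>x. E i x - dspl n ?p i x)"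
      using bfun_add(2)[OF u v] unfolding eq by (simp only:)
  qed
  then show ?thesis by (rule exI[of _ E])
qed

lemma deriv_appr_eventually:
  assumes mu: "mu > 0" and e: "e > 0" and p: "p \<ge> 1"
  shows "eventually (\<lambda>n. n > 0 \<and> (\<exists>E. deriv_appr Q mu p e n E)) sequentially"
proof (cases "p = 1")
  case True
  then show ?thesis using deriv_appr_1[OF mu e] by simp
next
  case False
  then obtain q where q: "p = Suc (Suc q)" using p by (metis One_nat_def Suc_le_D Suc_le_mono le_zero_eq not0_implies_Suc)
  define e' where "e' = min (e / (2 * gb_const q)) (1 / (2 * real (q + 2)))"
  have e': "e' > 0" "2 * gb_const q * e' \<le> e" "2 * real (q + 2) * e' \<le> 1"
    using e gb_const_pos[of q] by (auto simp: e'_def min_def field_simps)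
  from gb_appr_eventually[OF mu e'(1), of Q p q] show ?thesis
  proof eventually_elim
    case (elim n)
    from deriv_appr_Suc[OF elim[unfolded q] e'(3)] obtain E where E: "deriv_appr Q mu p (2 * gb_const q * e') n E"
      unfolding q by blast
    have "2 * gb_const q * e' * real n \<le> e * real n" using e'(2) by (intro mult_right_mono) auto
    then have "deriv_appr Q mu p e n E"
      using E unfolding deriv_appr_def by (blast intro: bfun_weaken order.refl)
    moreover have "n > 0" using elim by (simp add: gb_appr_def)
    ultimately show ?case by blast
  qed
qed

text \<open>Two normalised splines of degree \<open>p - 1\<close>, each at most
  \<open>p * pspl_bound (p - 1) * n\<close> because a support is at least \<open>1 / n\<close> long;
  the factor \<open>n\<close> is kept outside.\<close>

definition dspl_bound :: "nat \<Rightarrow> real" where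
  "dspl_bound p = 2 * (real p * pspl_bound (p - 1))"

lemma dramp_bfun:
  assumes n: "n > 0"
  shows "bfun (knot n p i) (knot n p (i + q + 1)) (real (q + 1) * pspl_bound q * real n)
    (dramp (knot n p i) (knot n p (i + q + 1)) (pspl n p q i))"
proof (cases "knot n p i < knot n p (i + q + 1)")
  case True
  let ?l = "knot n p (i + q + 1) - knot n p i"
  have "1 / ?l \<le> real n" using knot_gap[OF n True] True n by (simp add: field_simps)
  then have "real (q + 1) / ?l \<le> real (q + 1) * real n"
    using mult_left_mono[of "1 / ?l" "real n" "real (q + 1)"] by simp
  then have c: "\<bar>real (q + 1) / ?l\<bar> * pspl_bound q \<le> real (q + 1) * pspl_bound q * real n"
    using mult_right_mono[of "real (q + 1) / ?l" "real (q + 1) * real n" "pspl_bound q"] pspl_bound_ge_1[of q] True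
    by (simp add: mult.commute mult.left_commute)
  have "dramp (knot n p i) (knot n p (i + q + 1)) (pspl n p q i) = (\<lambda>x. real (q + 1) / ?l * pspl n p q i x)"
    using True unfolding dramp_def[abs_def] pspl_integral[OF n] by (simp add: mult.commute del: pspl.simps)
  then show ?thesis
    using bfun_weaken[OF bfun_scale[OF pspl_bfun[OF n]] order.refl order.refl c] by (simp only:)
next
  case False
  then show ?thesis using pspl_bound_ge_1[of q] by (auto simp: bfun_def dramp_def[abs_def])
qed

lemma dspl_bfun:
  assumes n: "n > 0" and p: "p \<ge> 1"
  shows "bfun (knot n p i) (knot n p (i + p + 1)) (dspl_bound p * real n) (dspl n p i)"
proof -
  let ?k = "knot n p"
  have d: "bfun (?k i) (?k (i + p)) (real p * pspl_bound (p - 1) * real n) (dramp (?k i) (?k (i + p)) (pspl n p (p - 1) i))" for i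
    using dramp_bfun[OF n, of p i "p - 1"] p by simp
  have u: "bfun (?k i) (?k (i + p + 1)) (real p * pspl_bound (p - 1) * real n) (dramp (?k i) (?k (i + p)) (pspl n p (p - 1) i))"
    by (rule bfun_weaken[OF d]) (auto intro!: knot_mono[OF n])
  have v: "bfun (?k i) (?k (i + p + 1)) (real p * pspl_bound (p - 1) * real n) (dramp (?k (i + 1)) (?k (i + 1 + p)) (pspl n p (p - 1) (i + 1)))"
    by (rule bfun_weaken[OF d]) (auto intro!: knot_mono[OF n])
  have "real p * pspl_bound (p - 1) * real n + real p * pspl_bound (p - 1) * real n = dspl_bound p * real n"
    by (simp add: dspl_bound_def)
  then show ?thesis using bfun_add(2)[OF u v] unfolding dspl_def[abs_def] by (simp only:)
qed

section \<open>Bilinear forms and matrix entries\<close>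

lemma bilinear_bound:
  assumes "bfun a b A f" "bfun c d B g" "a \<le> b"
  shows "\<bar>integral {0..1} (\<lambda>x. f x * g x)\<bar> \<le> A * B * (b - a)"
  by (rule bfun_integral_le[OF bfun_mult[OF assms(1,2)] assms(3)]) simp

lemma bilinear_close:
  assumes f0: "bfun a b A f0" and df: "bfun a b e1 (\<lambda>x. f x - f0 x)"
    and g0: "bfun c d B g0" and dg: "bfun c d e2 (\<lambda>x. g x - g0 x)" and ab: "a \<le> b"
  shows "\<bar>integral {0..1} (\<lambda>x. f x * g x) - integral {0..1} (\<lambda>x. f0 x * g0 x)\<bar> \<le> (e1 * (e2 + B) + A * e2) * (b - a)"
proof -
  have f: "bfun a b (e1 + A) f" and g: "bfun c d (e2 + B) g"
    by (rule bfun_diff_imp[OF df f0], rule bfun_diff_imp[OF dg g0])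
  have "bfun a b (e1 * (e2 + B) + A * e2) (\<lambda>x. (f x - f0 x) * g x + f0 x * (g x - g0 x))"
    by (rule bfun_add(1)[OF bfun_mult[OF df g] bfun_mult[OF f0 dg]])
  moreover have "(\<lambda>x. (f x - f0 x) * g x + f0 x * (g x - g0 x)) = (\<lambda>x. f x * g x - f0 x * g0 x)"
    by (auto simp: algebra_simps)
  ultimately have "\<bar>integral {0..1} (\<lambda>x. f x * g x - f0 x * g0 x)\<bar> \<le> (e1 * (e2 + B) + A * e2) * (b - a)"
    using bfun_integral_le[OF _ ab order.refl] by simp
  then show ?thesis
    by (subst Henstock_Kurzweil_Integration.integral_diff[symmetric])
      (rule bfun_integrable[OF bfun_mult[OF f g]] bfun_integrable[OF bfun_mult[OF f0 g0]] order.refl | assumption)+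
qed

lemma bilinear_disjoint:
  assumes "bfun a b A f" "bfun c d B g" "b \<le> c"
  shows "integral {0..1} (\<lambda>x. f x * g x) = 0" "integral {0..1} (\<lambda>x. g x * f x) = 0"
proof -
  have "integral {0..1} (\<lambda>x. f x * g x) = integral {0..1} (\<lambda>_::real. 0::real)"
  \<comment> \<open>If \<open>b = c\<close>, the supports share this one point.\<close>
  proof (rule integral_spike[of "{c}"])
    fix x assume x: "x \<in> {0..1} - {c}"
    then have "x < c \<or> b < x" using assms(3) by auto
    then show "0 = f x * g x" using assms(1,2) x unfolding bfun_def by auto
  qed simp
  then show "integral {0..1} (\<lambda>x. f x * g x) = 0" by simp
  then show "integral {0..1} (\<lambda>x. g x * f x) = 0" by (simp add: mult.commute)
qed


definition Ment :: "gbkind \<Rightarrow> real \<Rightarrow> nat \<Rightarrow> nat \<Rightarrow> nat \<Rightarrow> nat \<Rightarrow> real" where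
  "Ment Q mu n p i j = real n * integral {0..1} (\<lambda>x. GBN Q mu n p j x * GBN Q mu n p i x)"

definition Kent :: "gbkind \<Rightarrow> real \<Rightarrow> nat \<Rightarrow> nat \<Rightarrow> nat \<Rightarrow> nat \<Rightarrow> real" where
  "Kent Q mu n p i j = (1 / real n) * integral {0..1} (\<lambda>x. deriv (GBN Q mu n p j) x * deriv (GBN Q mu n p i) x)"

definition Hent :: "gbkind \<Rightarrow> real \<Rightarrow> nat \<Rightarrow> nat \<Rightarrow> nat \<Rightarrow> nat \<Rightarrow> real" where
  "Hent Q mu n p i j = integral {0..1} (\<lambda>x. deriv (GBN Q mu n p j) x * GBN Q mu n p i x)"

text \<open>All entries are of order 1: the overlap has length at most \<open>(p + 1) / n\<close>,
  each derivative contributes a factor \<open>n\<close>, and these powers cancel against the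
  prefactors \<open>n\<close>, \<open>1 / n\<close> and 1. The tolerance is at most 1 so that
  \<open>1 + B\<close> can replace \<open>e + B\<close>.\<close>

lemma entries_main:
  assumes p: "p \<ge> 1" and mu: "mu > 0" and e: "e > 0" "e \<le> 1"
  defines "B \<equiv> pspl_bound p" and "Bd \<equiv> dspl_bound p"
  shows "eventually (\<lambda>n. n > 0 \<and> (\<forall>i j.
     \<bar>Ment Q mu n p i j - real n * integral {0..1} (\<lambda>x. pspl n p p j x * pspl n p p i x)\<bar> \<le> e * ((1 + 2 * B) * real (p + 1)) \<and>
     \<bar>Kent Q mu n p i j - (1 / real n) * integral {0..1} (\<lambda>x. dspl n p j x * dspl n p i x)\<bar> \<le> e * ((1 + 2 * Bd) * real (p + 1)) \<and>
     \<bar>Ment Q mu n p i j\<bar> \<le> (1 + B) * (1 + B) * real (p + 1) \<and>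
     \<bar>Kent Q mu n p i j\<bar> \<le> (1 + Bd) * (1 + Bd) * real (p + 1) \<and>
     \<bar>Hent Q mu n p i j\<bar> \<le> (1 + Bd) * (1 + B) * real (p + 1) \<and>
     (i + p + 1 \<le> j \<or> j + p + 1 \<le> i \<longrightarrow> Ment Q mu n p i j = 0 \<and> Kent Q mu n p i j = 0 \<and> Hent Q mu n p i j = 0))) sequentially"
proof -
  obtain q where q: "p = Suc q" using p by (cases p) auto
  from gb_appr_eventually[OF mu e(1), of Q p q] deriv_appr_eventually[OF mu e(1) p, of Q] show ?thesis
  proof eventually_elim
    case (elim n)
    obtain E where "deriv_appr Q mu p e n E" using elim(2) by blast
    then have E: "\<And>i x. x \<in> {0<..<1} \<Longrightarrow> real n * x \<notin> \<int> \<Longrightarrow> deriv (GBN Q mu n p i) x = E i x"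
      and dE: "\<And>i. bfun (knot n p i) (knot n p (i + p + 1)) (e * real n) (\<lambda>x. E i x - dspl n p i x)"
      unfolding deriv_appr_def by auto
    have n: "n > 0" using elim by blast
    let ?k = "knot n p" and ?N = "GBN Q mu n p"
    have B0: "0 \<le> B" and Bd0: "0 \<le> Bd"
      using pspl_bound_ge_1[of p] pspl_bound_ge_1[of "p - 1"] unfolding B_def Bd_def dspl_bound_def by auto
    have D0: "bfun (?k i) (?k (i + p + 1)) (Bd * real n) (dspl n p i)" for i
      unfolding Bd_def by (rule dspl_bfun[OF n p])
    have P0: "bfun (?k i) (?k (i + p + 1)) B (pspl n p p i)" for i
      unfolding B_def by (rule pspl_bfun[OF n])
    have dN: "bfun (?k i) (?k (i + p + 1)) e (\<lambda>x. ?N i x - pspl n p p i x)" for i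
    proof -
      have "i + q + 2 = i + p + 1" using q by simp
      moreover have "bfun (?k i) (?k (i + q + 2)) e (\<lambda>x. gbspl Q mu n p (Suc q) i x - pspl n p (Suc q) i x)"
        using elim(1) unfolding gb_appr_def by blast
      ultimately show ?thesis unfolding GBN_def by (simp only: q)
    qed
    have N: "bfun (?k i) (?k (i + p + 1)) (e + B) (?N i)" for i by (rule bfun_diff_imp[OF dN P0])
    have Eb: "bfun (?k i) (?k (i + p + 1)) (e * real n + Bd * real n) (E i)" for i by (rule bfun_diff_imp[OF dE D0])
    have le: "?k i \<le> ?k (i + p + 1)" for i by (rule knot_mono[OF n]) simp
    have w: "?k (j + p + 1) - ?k j \<le> real (p + 1) / real n" for j
      using knot_diff_le[OF n, of p j "p + 1"] by (simp only: add.assoc)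
    \<comment> \<open>The mesh points, including 0 and 1, where \<open>E\<close> and
      \<open>deriv\<close> may differ.\<close>
    let ?Z = "{x \<in> {0..1}. real n * x - 0 \<in> \<int>}"
    have Z: "negligible ?Z" by (intro negligible_finite finite_Ints_affine) (use n in simp)
    have Zx: "x \<in> {0<..<1} \<and> real n * x \<notin> \<int>" if "x \<in> {0..1} - ?Z" for x
    proof -
      have "x \<noteq> 0" "x \<noteq> 1" using that by auto
      then show ?thesis using that by auto
    qed
    have K: "Kent Q mu n p i j = (1 / real n) * integral {0..1} (\<lambda>x. E j x * E i x)" for i j
      unfolding Kent_def using Zx E by (intro arg_cong2[where f = "(*)"] refl integral_spike[OF Z]) auto
    have H: "Hent Q mu n p i j = integral {0..1} (\<lambda>x. E j x * ?N i x)" for i j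
      unfolding Hent_def using Zx E by (intro integral_spike[OF Z]) auto
    have scale: "c * y \<le> x * real (p + 1)" if "y \<le> z * (?k (j + p + 1) - ?k j)" "c * z / real n \<le> x" "0 \<le> c" "0 \<le> z" for c y z x j
    proof -
      have "y \<le> z * (real (p + 1) / real n)" using that(1) mult_left_mono[OF w[of j] that(4)] by linarith
      then have "c * y \<le> c * (z * (real (p + 1) / real n))" by (rule mult_left_mono[OF _ that(3)])
      also have "\<dots> = (c * z / real n) * real (p + 1)" by simp
      also have "\<dots> \<le> x * real (p + 1)" using that(2) by (intro mult_right_mono) auto
      finally show ?thesis .
    qed
    have n0: "real n > 0" using n by simp
    show ?case
    proof (intro conjI allI impI n)
      fix i j
      have eB: "e * (e + B) + B * e \<le> e * (1 + 2 * B)"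
        using mult_left_mono[of "e + B" "1 + B" e] e by (simp add: algebra_simps)
      have eBd: "e * (e + Bd) + Bd * e \<le> e * (1 + 2 * Bd)"
        using mult_left_mono[of "e + Bd" "1 + Bd" e] e by (simp add: algebra_simps)
      have "real n * \<bar>integral {0..1} (\<lambda>x. ?N j x * ?N i x) - integral {0..1} (\<lambda>x. pspl n p p j x * pspl n p p i x)\<bar> \<le> (e * (1 + 2 * B)) * real (p + 1)"
        by (rule scale[OF bilinear_close[OF P0 dN P0 dN le]]) (use eB B0 e n0 in auto)
      then show "\<bar>Ment Q mu n p i j - real n * integral {0..1} (\<lambda>x. pspl n p p j x * pspl n p p i x)\<bar> \<le> e * ((1 + 2 * B) * real (p + 1))"
        unfolding Ment_def by (simp add: abs_mult mult.assoc flip: right_diff_distrib del: pspl.simps)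
      have id: "(1 / real n) * (e * real n * (e * real n + Bd * real n) + Bd * real n * (e * real n)) / real n = e * (e + Bd) + Bd * e"
        using n0 by (simp add: field_simps)
      have "(1 / real n) * \<bar>integral {0..1} (\<lambda>x. E j x * E i x) - integral {0..1} (\<lambda>x. dspl n p j x * dspl n p i x)\<bar> \<le> (e * (1 + 2 * Bd)) * real (p + 1)"
        by (rule scale[OF bilinear_close[OF D0 dE D0 dE le]]) (use id eBd Bd0 e n0 in auto)
      then show "\<bar>Kent Q mu n p i j - (1 / real n) * integral {0..1} (\<lambda>x. dspl n p j x * dspl n p i x)\<bar> \<le> e * ((1 + 2 * Bd) * real (p + 1))"
        unfolding K by (simp add: abs_mult mult.assoc flip: right_diff_distrib diff_divide_distrib)
      have mB: "(e + B) * (e + B) \<le> (1 + B) * (1 + B)" "(e + Bd) * (e + Bd) \<le> (1 + Bd) * (1 + Bd)" "(e + Bd) * (e + B) \<le> (1 + Bd) * (1 + B)"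
        using e B0 Bd0 by (intro mult_mono; simp)+
      have "real n * \<bar>integral {0..1} (\<lambda>x. ?N j x * ?N i x)\<bar> \<le> ((1 + B) * (1 + B)) * real (p + 1)"
        by (rule scale[OF bilinear_bound[OF N N le]]) (use mB B0 e n0 in auto)
      then show "\<bar>Ment Q mu n p i j\<bar> \<le> (1 + B) * (1 + B) * real (p + 1)"
        unfolding Ment_def by (simp add: abs_mult)
      have id2: "(1 / real n) * ((e * real n + Bd * real n) * (e * real n + Bd * real n)) / real n = (e + Bd) * (e + Bd)"
        using n0 by (simp add: field_simps)
      have "(1 / real n) * \<bar>integral {0..1} (\<lambda>x. E j x * E i x)\<bar> \<le> ((1 + Bd) * (1 + Bd)) * real (p + 1)"
        by (rule scale[OF bilinear_bound[OF Eb Eb le]]) (use id2 mB Bd0 e n0 in auto)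
      then show "\<bar>Kent Q mu n p i j\<bar> \<le> (1 + Bd) * (1 + Bd) * real (p + 1)"
        unfolding K by (simp add: abs_mult)
      have id3: "1 * ((e * real n + Bd * real n) * (e + B)) / real n = (e + Bd) * (e + B)"
        using n0 by (simp add: field_simps)
      have "1 * \<bar>integral {0..1} (\<lambda>x. E j x * ?N i x)\<bar> \<le> ((1 + Bd) * (1 + B)) * real (p + 1)"
        by (rule scale[OF bilinear_bound[OF Eb N le]]) (use id3 mB B0 Bd0 e n0 in auto)
      then show "\<bar>Hent Q mu n p i j\<bar> \<le> (1 + Bd) * (1 + B) * real (p + 1)"
        unfolding H by simp
      assume "i + p + 1 \<le> j \<or> j + p + 1 \<le> i"
      then have "?k (i + p + 1) \<le> ?k j \<or> ?k (j + p + 1) \<le> ?k i" using knot_mono[OF n] by blast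
      then show "Ment Q mu n p i j = 0" "Kent Q mu n p i j = 0" "Hent Q mu n p i j = 0"
        unfolding K H Ment_def
        using bilinear_disjoint[OF N[of i] N[of j]] bilinear_disjoint[OF N[of j] N[of i]]
          bilinear_disjoint[OF Eb[of i] Eb[of j]] bilinear_disjoint[OF Eb[of j] Eb[of i]]
          bilinear_disjoint[OF N[of i] Eb[of j]] bilinear_disjoint[OF Eb[of j] N[of i]] by auto
    qed
  qed
qed

text \<open>The support of the first factor lies in [0,1] and localises the product, so the integral
  may be taken over the whole line, rescaled and evaluated by
  \<open>cardB_correlation\<close>.\<close>

lemma affine_correlation:
  fixes u v :: real
  assumes n: "n > 0" and u: "0 \<le> u" "u + real q + 1 \<le> real n"
  shows "real n * integral {0..1} (\<lambda>x. cardB q (real n * x - u) * cardB q (real n * x - v))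
    = cardB (2 * q + 1) (real q + 1 + u - v)"
proof -
  define F where "F = (\<lambda>t. cardB q t * cardB q (t + (u - v)))"
  let ?f = "\<lambda>x. cardB q (real n * x - u) * cardB q (real n * x - v)"
  have f: "?f = (\<lambda>x. F (- u + real n * x))" by (auto simp: F_def algebra_simps)
  have "integrable lborel F" unfolding F_def
    by (rule integrable_cardB_mult[where B = "2 ^ q"]) (use cardB_le cardB_nonneg in auto)
  then have fi: "integrable lborel ?f" unfolding f
    using n by (intro lborel_integrable_real_affine) auto
  have ind: "(\<lambda>x. indicator {0..1} x *\<^sub>R ?f x) = ?f"
  proof
    fix x
    have "?f x = 0" if "x \<notin> {0..1}"
    proof -
      have "x < 0 \<or> 1 < x" using that by auto
      then have "real n * x - u < 0 \<or> real n * x - u \<ge> real q + 1"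
      proof
        assume "x < 0"
        then have "real n * x < 0" using n by (simp add: mult_pos_neg)
        then show ?thesis using u by linarith
      next
        assume "1 < x"
        then have "real n * 1 \<le> real n * x" by (intro mult_left_mono) auto
        then show ?thesis using u by linarith
      qed
      then show ?thesis using cardB_support by simp
    qed
    then show "indicator {0..1} x *\<^sub>R ?f x = ?f x" by (auto simp: indicator_def)
  qed
  have "set_integrable lborel {0..1} ?f" unfolding set_integrable_def ind by (rule fi)
  from set_borel_integral_eq_integral(2)[OF this]
  have "integral {0..1} ?f = (\<integral>x. ?f x \<partial>lborel)" unfolding set_lebesgue_integral_def ind ..
  also have "real n * \<dots> = (\<integral>t. F t \<partial>lborel)"
    unfolding f using n by (subst lborel_integral_real_affine[where c = "real n" and t = "- u" and f = F]) auto
  also have "\<dots> = cardB (q + q + 1) (real q + 1 + (u - v))" unfolding F_def by (rule cardB_correlation)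
  finally show ?thesis by (simp add: mult_2 add_diff_eq del: cardB.simps)
qed

lemma mass_interior:
  assumes n: "n > 0" and i: "p + 1 \<le> i" "i \<le> n" and j: "p + 1 \<le> j" "j \<le> n"
  shows "real n * integral {0..1} (\<lambda>x. pspl n p p j x * pspl n p p i x)
    = cardB (2 * p + 1) (real p + 1 - (real i - real j))"
proof -
  let ?c = "\<lambda>i. real i - real p - 1"
  have "integral {0..1} (\<lambda>x. pspl n p p j x * pspl n p p i x)
     = integral {0..1} (\<lambda>x. cardB p (real n * x - ?c j) * cardB p (real n * x - ?c i))"
    using pspl_interior[OF n, of p i p] pspl_interior[OF n, of p j p] i j
    by (intro integral_cong) (simp del: pspl.simps cardB.simps)
  then have "real n * integral {0..1} (\<lambda>x. pspl n p p j x * pspl n p p i x)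
      = cardB (2 * p + 1) (real p + 1 + ?c j - ?c i)"
    using affine_correlation[OF n, of "?c j" p "?c i"] j by (simp del: pspl.simps cardB.simps)
  also have "real p + 1 + ?c j - ?c i = real p + 1 - (real i - real j)" by simp
  finally show ?thesis .
qed

lemma dspl_interior:
  assumes n: "n > 0" and p: "p \<ge> 1" and i: "p + 1 \<le> i" "i \<le> n" and x: "x \<in> {0..1}"
  shows "dspl n p i x = real n * (cardB (p - 1) (real n * x - (real i - real p - 1)) - cardB (p - 1) (real n * x - (real i - real p)))"
proof -
  have dr: "dramp (knot n p j) (knot n p (j + p)) (pspl n p (p - 1) j) x = real n * cardB (p - 1) (real n * x - (real j - real p - 1))"
    if j: "p + 1 \<le> j" "j \<le> n + 1" for j
  proof -
    have "knot n p j = (real j - real p - 1) / real n" "knot n p (j + p) = (real j - 1) / real n"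
      using j p by (auto simp: knot_def of_nat_diff)
    then have k: "knot n p (j + p) - knot n p j = real p / real n" by (simp add: diff_divide_distrib[symmetric])
    moreover have "real p / real n > 0" using n p by simp
    ultimately have lt: "knot n p j < knot n p (j + p)" by linarith
    have "integral {0..1} (pspl n p (p - 1) j) = 1 / real n"
      using pspl_integral[OF n, of p "p - 1" j] k p by (simp del: pspl.simps)
    moreover have "pspl n p (p - 1) j x = cardB (p - 1) (real n * x - (real j - real p - 1))"
      using j p by (intro pspl_interior[OF n] x) auto
    ultimately show ?thesis using lt unfolding dramp_def by (simp del: pspl.simps cardB.simps)
  qed
  have "real (i + 1) - real p - 1 = real i - real p" by simp
  then show ?thesis
    unfolding dspl_def using dr[of i] dr[of "i + 1"] i by (simp only: right_diff_distrib)
qed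

text \<open>Each derivative is \<open>n\<close> times a first difference of splines of degree
  \<open>p - 1\<close>. Expanding yields four correlations of degree \<open>2 * p - 1\<close>, which
  combine to the negative second difference of \<open>deriv2_cardB\<close>.\<close>

lemma stiffness_interior:
  assumes n: "n > 0" and p: "p \<ge> 1" and i: "p + 1 \<le> i" "i \<le> n" and j: "p + 1 \<le> j" "j \<le> n"
  shows "(1 / real n) * integral {0..1} (\<lambda>x. dspl n p j x * dspl n p i x)
    = - deriv (deriv (cardB (2 * p + 1))) (real p + 1 - (real i - real j))"
proof -
  let ?u = "real j - real p - 1" and ?v = "real i - real p - 1"
  let ?q = "p - 1"
  let ?f = "\<lambda>u v x. cardB ?q (real n * x - u) * cardB ?q (real n * x - v)"
  have int: "?f u v integrable_on {0..1}" for u v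
  proof (rule bounded_measurable_integrable)
    have "?f u v \<in> borel_measurable borel" by measurable
    then show "?f u v \<in> borel_measurable (lebesgue_on {0..1})"
      by (intro measurable_restrict_space1 measurable_completion) simp
    show "\<bar>?f u v x\<bar> \<le> 2 ^ ?q * 2 ^ ?q" for x
      unfolding abs_mult using cardB_le[of ?q] cardB_nonneg[of ?q] by (intro mult_mono) auto
  qed auto
  have q: "2 * ?q + 1 = Suc (2 * p - 2)" "real ?q + 1 = real p" "2 * p + 1 = Suc (Suc (Suc (2 * p - 2)))"
    using p by auto
  have A: "real n * integral {0..1} (?f u v) = cardB (Suc (2 * p - 2)) (real p + u - v)"
    if "0 \<le> u" "u + real p \<le> real n" for u v
  proof -
    have "u + real ?q + 1 \<le> real n" using that(2) q(2) by linarith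
    from affine_correlation[OF n that(1) this, of v] show ?thesis unfolding q by (simp only: q)
  qed
  have "dspl n p j x * dspl n p i x = (real n * real n) * (?f ?u ?v x - ?f ?u (?v + 1) x - ?f (?u + 1) ?v x + ?f (?u + 1) (?v + 1) x)"
    if "x \<in> {0..1}" for x
  proof -
    have expand: "(N * (a - b)) * (N * (c - d)) = (N * N) * (a * c - a * d - b * c + b * d)" for N a b c d :: real
      by (simp add: algebra_simps)
    have e: "real n * x - (real i - real p) = real n * x - (?v + 1)"
      "real n * x - (real j - real p) = real n * x - (?u + 1)" by simp_all
    show ?thesis
      unfolding dspl_interior[OF n p i that] dspl_interior[OF n p j that] e
      by (rule expand)
  qed
  then have "integral {0..1} (\<lambda>x. dspl n p j x * dspl n p i x)
     = integral {0..1} (\<lambda>x. (real n * real n) * (?f ?u ?v x - ?f ?u (?v + 1) x - ?f (?u + 1) ?v x + ?f (?u + 1) (?v + 1) x))"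
    by (rule integral_cong)
  also have "\<dots> = (real n * real n) * (integral {0..1} (?f ?u ?v) - integral {0..1} (?f ?u (?v + 1)) - integral {0..1} (?f (?u + 1) ?v) + integral {0..1} (?f (?u + 1) (?v + 1)))"
    unfolding integral_mult_right
    by (subst Henstock_Kurzweil_Integration.integral_add Henstock_Kurzweil_Integration.integral_diff; (intro integrable_diff int)?)+ (rule refl)
  finally have X: "integral {0..1} (\<lambda>x. dspl n p j x * dspl n p i x) = (real n * real n) * (integral {0..1} (?f ?u ?v) - integral {0..1} (?f ?u (?v + 1)) - integral {0..1} (?f (?u + 1) ?v) + integral {0..1} (?f (?u + 1) (?v + 1)))" .
  have g: "(1 / N) * Y = N * a - N * b - N * c + N * d" if "Y = (N * N) * (a - b - c + d)" "N > 0" for N Y a b c d :: real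
    using that by (simp add: field_simps)
  have "(1 / real n) * integral {0..1} (\<lambda>x. dspl n p j x * dspl n p i x)
     = real n * integral {0..1} (?f ?u ?v) - real n * integral {0..1} (?f ?u (?v + 1))
      - real n * integral {0..1} (?f (?u + 1) ?v) + real n * integral {0..1} (?f (?u + 1) (?v + 1))"
    by (rule g[OF X]) (use n in simp)
  also have "\<dots> = cardB (Suc (2 * p - 2)) (real p + ?u - ?v) - cardB (Suc (2 * p - 2)) (real p + ?u - (?v + 1))
     - cardB (Suc (2 * p - 2)) (real p + (?u + 1) - ?v) + cardB (Suc (2 * p - 2)) (real p + (?u + 1) - (?v + 1))"
    using j by (intro arg_cong2[where f = "(+)"] arg_cong2[where f = "(-)"] A) auto
  also have "\<dots> = - deriv (deriv (cardB (2 * p + 1))) (real p + 1 - (real i - real j))"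
  proof -
    have "real p + ?u - ?v = real p + 1 - (real i - real j) - 1" "real p + ?u - (?v + 1) = real p + 1 - (real i - real j) - 2"
      "real p + (?u + 1) - ?v = real p + 1 - (real i - real j)" "real p + (?u + 1) - (?v + 1) = real p + 1 - (real i - real j) - 1"
      by simp_all
    then show ?thesis unfolding q(3) deriv2_cardB by (simp only:)
  qed
  finally show ?thesis .
qed

section \<open>Eigenvalues and traces\<close>

lemma index_mult_mat_sum:
  "A \<in> carrier_mat d d \<Longrightarrow> B \<in> carrier_mat d d \<Longrightarrow> i < d \<Longrightarrow> j < d \<Longrightarrow>
    (A * B) $$ (i, j) = (\<Sum>l<d. A $$ (i, l) * B $$ (l, j))"
  by (auto simp: scalar_prod_def lessThan_atLeast0)

lemma proots_linear_factors: "proots (\<Prod>a\<leftarrow>as. [:- a, 1:]) = mset (as :: complex list)"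
proof (induction as)
  case (Cons a as)
  have "(\<Prod>a\<leftarrow>as. [:- a, 1:]) \<noteq> 0" by (auto simp: prod_list_zero_iff)
  then show ?case using Cons by (simp add: proots_mult del: mult_pCons_left)
qed simp

lemma trace_mult_commute:
  fixes A B :: "'a :: comm_semiring_0 mat"
  assumes "A \<in> carrier_mat d d" "B \<in> carrier_mat d d"
  shows "(\<Sum>i<d. (A * B) $$ (i, i)) = (\<Sum>i<d. (B * A) $$ (i, i))"
proof -
  have "(\<Sum>i<d. (A * B) $$ (i, i)) = (\<Sum>i<d. \<Sum>l<d. A $$ (i, l) * B $$ (l, i))"
    using assms by (intro sum.cong refl index_mult_mat_sum) auto
  also have "\<dots> = (\<Sum>l<d. \<Sum>i<d. B $$ (l, i) * A $$ (i, l))"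
    by (subst sum.swap) (simp add: mult.commute)
  also have "\<dots> = (\<Sum>i<d. (B * A) $$ (i, i))"
    using assms by (intro sum.cong refl index_mult_mat_sum[symmetric]) auto
  finally show ?thesis .
qed

lemma upper_triangular_power:
  fixes B :: "'a :: comm_semiring_1 mat"
  assumes B: "B \<in> carrier_mat d d" "upper_triangular B"
  shows "(\<forall>i<d. \<forall>j<i. (B ^\<^sub>m k) $$ (i, j) = 0) \<and> (\<forall>i<d. (B ^\<^sub>m k) $$ (i, i) = B $$ (i, i) ^ k)"
proof (induction k)
  case (Suc k)
  have Bk: "B ^\<^sub>m k \<in> carrier_mat d d" using B by simp
  have B0: "B $$ (i, j) = 0" if "i < d" "j < i" for i j
    using B that by (auto simp: upper_triangular_def)
  have prod: "(B ^\<^sub>m k) $$ (i, l) * B $$ (l, j) = (if l = i \<and> j = i then B $$ (i, i) ^ Suc k else 0)"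
    if "i < d" "j \<le> i" "l < d" for i j l
  proof (cases "l < i")
    case True
    then show ?thesis using Suc that by auto
  next
    case False
    then show ?thesis using Suc that B0[of l j] by (cases "l = i"; cases "j = i") (auto simp: mult.commute)
  qed
  have "(B ^\<^sub>m Suc k) $$ (i, j) = (\<Sum>l<d. if l = i \<and> j = i then B $$ (i, i) ^ Suc k else 0)"
    if "i < d" "j \<le> i" for i j
    using that prod unfolding pow_mat.simps by (subst index_mult_mat_sum[OF Bk B(1)]) (auto intro!: sum.cong)
  then show ?case by (auto simp: sum.delta)
qed (use B in auto)

text \<open>Schur triangularisation needs no diagonalisability: the diagonal lists the roots with
  multiplicity, powers keep the triangular shape, and the trace is cyclic.\<close>

lemma sum_eigenvalue_power:
  fixes A :: "complex mat"
  assumes A: "A \<in> carrier_mat d d"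
  shows "(\<Sum>z\<in>#proots (char_poly A). z ^ k) = (\<Sum>i<d. (A ^\<^sub>m k) $$ (i, i))"
proof -
  obtain as where as: "char_poly A = (\<Prod>a\<leftarrow>as. [:- a, 1:])" "length as = d"
    using char_poly_factorized[OF A] by blast
  obtain B P Q where "schur_decomposition A as = (B, P, Q)"
    by (cases "schur_decomposition A as")
  from schur_decomposition[OF A as(1) this]
  have sim: "similar_mat_wit A B P Q" and B: "upper_triangular B" "diag_mat B = as" by auto
  note D = similar_mat_witD2[OF A sim]
  have Bk: "B ^\<^sub>m k \<in> carrier_mat d d" using D by simp
  have "A ^\<^sub>m k = P * B ^\<^sub>m k * Q" by (rule similar_mat_wit_pow_id[OF sim])
  then have "(\<Sum>i<d. (A ^\<^sub>m k) $$ (i, i)) = (\<Sum>i<d. (P * B ^\<^sub>m k * Q) $$ (i, i))" by simp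
  also have "\<dots> = (\<Sum>i<d. (Q * (P * B ^\<^sub>m k)) $$ (i, i))"
    using D Bk by (intro trace_mult_commute) auto
  also have "Q * (P * B ^\<^sub>m k) = (Q * P) * B ^\<^sub>m k"
    using D Bk by (intro assoc_mult_mat[symmetric]) auto
  also have "\<dots> = B ^\<^sub>m k" using D Bk by simp
  also have "(\<Sum>i<d. (B ^\<^sub>m k) $$ (i, i)) = (\<Sum>i<d. B $$ (i, i) ^ k)"
    using upper_triangular_power[OF D(5) B(1), of k] by (intro sum.cong) auto
  also have "\<dots> = (\<Sum>i<d. (as ! i) ^ k)"
    using B(2) D(5) by (intro sum.cong) (auto simp: diag_mat_def)
  also have "\<dots> = sum_list (map (\<lambda>z. z ^ k) as)"
    using as(2) by (simp add: sum_list_sum_nth lessThan_atLeast0)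
  also have "\<dots> = (\<Sum>z\<in>#proots (char_poly A). z ^ k)"
    unfolding as(1) proots_linear_factors by (metis mset_map sum_mset_sum_list)
  finally show ?thesis ..
qed

lemma proots_char_poly_eigenvector:
  fixes A :: "complex mat"
  assumes A: "A \<in> carrier_mat d d" and z: "z \<in># proots (char_poly A)"
  obtains v where "\<exists>i<d. v i \<noteq> 0" "\<And>i. i < d \<Longrightarrow> (\<Sum>j<d. A $$ (i, j) * v j) = z * v i"
proof -
  have "char_poly A \<noteq> 0" using degree_monic_char_poly[OF A] by auto
  then have "poly (char_poly A) z = 0" using z by simp
  then have "eigenvalue A z" using eigenvalue_root_char_poly[OF A] by simp
  then obtain v where v: "v \<in> carrier_vec d" "v \<noteq> 0\<^sub>v d" "A *\<^sub>v v = z \<cdot>\<^sub>v v"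
    using A by (auto simp: eigenvalue_def eigenvector_def)
  show thesis
  proof (rule that[of "\<lambda>i. v $ i"])
    show "\<exists>i<d. v $ i \<noteq> 0"
      using v(1,2) by (metis carrier_vecD eq_vecI index_zero_vec)
    fix i assume i: "i < d"
    have "(A *\<^sub>v v) $ i = z * v $ i" using v i by simp
    then show "(\<Sum>j<d. A $$ (i, j) * v $ j) = z * v $ i"
      using A v(1) i by (simp add: scalar_prod_def lessThan_atLeast0)
  qed
qed

text \<open>The eigenvector equation, read at a component of largest modulus.\<close>

lemma eigenvalue_row_sum_bound:
  fixes A :: "complex mat"
  assumes A: "A \<in> carrier_mat d d" and z: "z \<in># proots (char_poly A)"
    and R: "\<And>i. i < d \<Longrightarrow> (\<Sum>j<d. norm (A $$ (i, j))) \<le> R"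
  shows "norm z \<le> R"
proof -
  obtain v where v: "\<exists>i<d. v i \<noteq> 0" "\<And>i. i < d \<Longrightarrow> (\<Sum>j<d. A $$ (i, j) * v j) = z * v i"
    using proots_char_poly_eigenvector[OF A z] by blast
  define m where "m = Max ((\<lambda>i. norm (v i)) ` {..<d})"
  have ne: "(\<lambda>i. norm (v i)) ` {..<d} \<noteq> {}" using v(1) by auto
  have le: "norm (v i) \<le> m" if "i < d" for i unfolding m_def using that by (intro Max_ge) auto
  obtain i where i: "i < d" "m = norm (v i)"
    using Max_in[OF _ ne] unfolding m_def by auto
  have pos: "m > 0" using v(1) le by (meson less_le_trans zero_less_norm_iff)
  have "norm z * m = norm (\<Sum>j<d. A $$ (i, j) * v j)" using v(2)[OF i(1)] i by (simp add: norm_mult)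
  also have "\<dots> \<le> (\<Sum>j<d. norm (A $$ (i, j)) * norm (v j))"
    by (rule order.trans[OF norm_sum]) (simp add: norm_mult)
  also have "\<dots> \<le> (\<Sum>j<d. norm (A $$ (i, j)) * m)"
    by (intro sum_mono mult_left_mono le) auto
  also have "\<dots> \<le> R * m" using R[OF i(1)] pos by (simp add: sum_distrib_right[symmetric])
  finally show ?thesis using pos by simp
qed

text \<open>Bendixson: the imaginary part of \<open>v\<^sup>* A v\<close> only sees the skew-symmetric part of \<open>A\<close>,
  which the Schur test bounds.\<close>
lemma eigenvalue_Im_bound:
  fixes A :: "real mat"
  assumes A: "A \<in> carrier_mat d d" and z: "z \<in># proots (char_poly (map_mat complex_of_real A))"
    and D: "\<And>i. i < d \<Longrightarrow> (\<Sum>j<d. \<bar>A $$ (i, j) - A $$ (j, i)\<bar>) \<le> D"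
  shows "2 * \<bar>Im z\<bar> \<le> D"
proof -
  have A': "map_mat complex_of_real A \<in> carrier_mat d d" using A by simp
  obtain v where v: "\<exists>i<d. v i \<noteq> 0"
    "\<And>i. i < d \<Longrightarrow> (\<Sum>j<d. map_mat complex_of_real A $$ (i, j) * v j) = z * v i"
    using proots_char_poly_eigenvector[OF A' z] by blast
  let ?a = "\<lambda>i j. complex_of_real (A $$ (i, j))"
  let ?b = "\<lambda>i j. \<bar>A $$ (i, j) - A $$ (j, i)\<bar>"
  let ?n = "\<lambda>i. (norm (v i))\<^sup>2"
  define s where "s = (\<Sum>i<d. ?n i)"
  have s: "s > 0"
  proof -
    obtain i where "i < d" "v i \<noteq> 0" using v(1) by blast
    then show ?thesis unfolding s_def by (intro sum_pos2[of _ i]) auto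
  qed
  have Av: "(\<Sum>j<d. ?a i j * v j) = z * v i" if "i < d" for i
    using v(2)[OF that] that A by simp
  define q where "q = (\<Sum>i<d. \<Sum>j<d. cnj (v i) * (?a i j * v j))"
  have q: "q = z * of_real s"
  proof -
    have "q = (\<Sum>i<d. cnj (v i) * (z * v i))"
      unfolding q_def sum_distrib_left[symmetric] by (intro sum.cong refl) (simp add: Av)
    also have "\<dots> = (\<Sum>i<d. z * of_real (?n i))"
      by (intro sum.cong refl) (simp only: complex_norm_square mult.commute mult.left_commute)
    finally show ?thesis by (simp add: s_def sum_distrib_left)
  qed
  have "cnj q = (\<Sum>i<d. \<Sum>j<d. v i * (?a i j * cnj (v j)))"
    unfolding q_def by simp
  also have "\<dots> = (\<Sum>i<d. \<Sum>j<d. cnj (v i) * (?a j i * v j))"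
    by (subst sum.swap) (simp add: mult.commute mult.left_commute)
  finally have "q - cnj q = (\<Sum>i<d. \<Sum>j<d. cnj (v i) * (of_real (A $$ (i, j) - A $$ (j, i)) * v j))"
    unfolding q_def by (simp add: sum_subtractf[symmetric] algebra_simps)
  then have "norm (q - cnj q) \<le> (\<Sum>i<d. \<Sum>j<d. norm (v i) * (?b i j * norm (v j)))"
    by (simp only:) (intro order.trans[OF norm_sum] sum_mono, simp add: norm_mult del: of_real_diff)
  \<comment> \<open>The inequality of arithmetic and geometric mean; as \<open>?b\<close> is
    symmetric, the two halves coincide and row sums suffice.\<close>
  also have "\<dots> \<le> (\<Sum>i<d. \<Sum>j<d. ?b i j * (?n i + ?n j) / 2)"
  proof (intro sum_mono)
    fix i j
    have "norm (v i) * norm (v j) \<le> (?n i + ?n j) / 2"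
      using sum_squares_bound[of "norm (v i)" "norm (v j)"] by simp
    then have "?b i j * (norm (v i) * norm (v j)) \<le> ?b i j * ((?n i + ?n j) / 2)"
      by (rule mult_left_mono) simp
    then show "norm (v i) * (?b i j * norm (v j)) \<le> ?b i j * (?n i + ?n j) / 2"
      by (simp only: mult.left_commute times_divide_eq_right)
  qed
  also have "\<dots> = (\<Sum>i<d. \<Sum>j<d. ?b i j * ?n i) / 2 + (\<Sum>i<d. \<Sum>j<d. ?b i j * ?n j) / 2"
    by (simp add: distrib_left add_divide_distrib sum.distrib sum_divide_distrib)
  also have "(\<Sum>i<d. \<Sum>j<d. ?b i j * ?n j) = (\<Sum>i<d. \<Sum>j<d. ?b i j * ?n i)"
    by (subst sum.swap) (simp add: abs_minus_commute)
  also have "(\<Sum>i<d. \<Sum>j<d. ?b i j * ?n i) / 2 + (\<Sum>i<d. \<Sum>j<d. ?b i j * ?n i) / 2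
      = (\<Sum>i<d. (\<Sum>j<d. ?b i j) * ?n i)"
    by (simp add: sum_distrib_right)
  also have "\<dots> \<le> (\<Sum>i<d. D * ?n i)"
    by (intro sum_mono mult_right_mono D) auto
  also have "\<dots> = D * s" by (simp add: s_def sum_distrib_left)
  also have "q - cnj q = \<i> * of_real (2 * Im z * s)"
    unfolding q by (simp add: complex_eq_iff)
  finally have "2 * \<bar>Im z\<bar> * s \<le> D * s" using s by (simp add: norm_mult abs_mult)
  then show ?thesis using s by simp
qed

section \<open>Banded asymptotically Toeplitz matrices\<close>

text \<open>The first component of an offset belongs to direction 1 and is paired with the second
  angle, because the symbol has its \<open>p1\<close> factors in the second angle.\<close>

definition fexp :: "int \<times> int \<Rightarrow> real \<times> real \<Rightarrow> complex" where
  "fexp z \<theta> = cis (of_int (snd z) * fst \<theta> + of_int (fst z) * snd \<theta>)"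

lemma fexp_add: "fexp (z + w) \<theta> = fexp z \<theta> * fexp w \<theta>"
  by (simp add: fexp_def cis_mult algebra_simps)

lemma continuous_on_fexp [continuous_intros]: "continuous_on S (fexp z)"
  unfolding fexp_def cis_conv_exp by (intro continuous_intros)

lemma integral_cis:
  "integral {-pi..pi} (\<lambda>x. cis (of_int k * x)) = (if k = 0 then of_real (2 * pi) else 0)"
proof (cases "k = 0")
  case False
  let ?f = "\<lambda>x. cis (of_int k * x) / (\<i> * of_int k)"
  have "((\<lambda>x. cis (of_int k * x)) has_integral (?f pi - ?f (-pi))) {-pi..pi}"
  proof (rule fundamental_theorem_of_calculus)
    fix x :: real
    have "((\<lambda>z. exp (\<i> * of_int k * z) / (\<i> * of_int k)) has_field_derivative exp (\<i> * of_int k * of_real x)) (at (of_real x))"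
      using False by (auto intro!: derivative_eq_intros)
    from has_vector_derivative_real_field[OF this]
    show "(?f has_vector_derivative cis (of_int k * x)) (at x within {-pi..pi})"
      by (simp add: cis_conv_exp mult.assoc)
  qed simp
  moreover have "cis (of_int k * pi) = cis (of_int k * - pi)"
    by (simp add: cis.ctr complex_eq_iff sin_zero_iff_int2)
  ultimately show ?thesis using False by (simp add: integral_unique)
qed (simp add: scaleR_conv_of_real)

lemma integral_fexp:
  "integral (cbox (-pi, -pi) (pi, pi)) (fexp z) = (if z = 0 then of_real (4 * pi\<^sup>2) else 0)"
proof -
  have "integral (cbox (-pi, -pi) (pi, pi)) (fexp z)
      = integral (cbox (-pi) pi) (\<lambda>x. integral (cbox (-pi) pi) (\<lambda>y. fexp z (x, y)))"
    by (rule integral_prod_continuous) (rule continuous_on_fexp)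
  also have "\<dots> = integral {-pi..pi} (\<lambda>x. integral {-pi..pi} (\<lambda>y. cis (of_int (snd z) * x) * cis (of_int (fst z) * y)))"
    by (simp add: fexp_def cis_mult)
  also have "\<dots> = integral {-pi..pi} (\<lambda>x. cis (of_int (snd z) * x)) * integral {-pi..pi} (\<lambda>x. cis (of_int (fst z) * x))"
    by simp
  finally show ?thesis
    by (auto simp: integral_cis prod_eq_iff power2_eq_square)
qed

text \<open>Fourier coefficients of the \<open>k\<close>-th power of a trigonometric polynomial, in
  the recursive form produced by matrix multiplication on the right.\<close>

fun conv_pow :: "(int \<times> int \<Rightarrow> complex) \<Rightarrow> (int \<times> int) set \<Rightarrow> nat \<Rightarrow> int \<times> int \<Rightarrow> complex" where
  "conv_pow a W 0 z = (if z = 0 then 1 else 0)"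
| "conv_pow a W (Suc k) z = (\<Sum>w\<in>W. conv_pow a W k (z - w) * a w)"

lemma conv_pow_fourier:
  assumes "finite W"
  shows "of_real (4 * pi\<^sup>2) * conv_pow a W k z
    = integral (cbox (-pi, -pi) (pi, pi)) (\<lambda>\<theta>. (\<Sum>w\<in>W. a w * fexp w \<theta>) ^ k * fexp (- z) \<theta>)"
proof (induction k arbitrary: z)
  case 0
  show ?case using integral_fexp[of "- z"] by simp
next
  case (Suc k)
  let ?g = "\<lambda>\<theta>. \<Sum>w\<in>W. a w * fexp w \<theta>"
  have "?g \<theta> ^ Suc k * fexp (- z) \<theta> = (\<Sum>w\<in>W. a w * (?g \<theta> ^ k * fexp (- (z - w)) \<theta>))" for \<theta>
  proof -
    have "fexp (- (z - w)) \<theta> = fexp w \<theta> * fexp (- z) \<theta>" for w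
      using fexp_add[of w "- z" \<theta>] by simp
    then show ?thesis
      by (simp add: sum_distrib_right sum_distrib_left mult.assoc mult.commute mult.left_commute)
  qed
  then have "integral (cbox (-pi, -pi) (pi, pi)) (\<lambda>\<theta>. ?g \<theta> ^ Suc k * fexp (- z) \<theta>)
     = integral (cbox (-pi, -pi) (pi, pi)) (\<lambda>\<theta>. \<Sum>w\<in>W. a w * (?g \<theta> ^ k * fexp (- (z - w)) \<theta>))"
    by (simp only:)
  also have "\<dots> = (\<Sum>w\<in>W. integral (cbox (-pi, -pi) (pi, pi)) (\<lambda>\<theta>. a w * (?g \<theta> ^ k * fexp (- (z - w)) \<theta>)))"
    by (intro integral_sum assms integrable_continuous) (intro continuous_intros)
  also have "\<dots> = (\<Sum>w\<in>W. a w * (of_real (4 * pi\<^sup>2) * conv_pow a W k (z - w)))"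
    unfolding Suc by simp
  finally show ?case by (simp add: sum_distrib_left mult.commute mult.left_commute)
qed

lemma conv_pow_bounded: "\<exists>B. \<forall>z. norm (conv_pow a W k z) \<le> B"
proof (induction k)
  case 0
  show ?case by (intro exI[of _ 1]) simp
next
  case (Suc k)
  then obtain B where B: "\<And>z. norm (conv_pow a W k z) \<le> B" by blast
  have "norm (conv_pow a W (Suc k) z) \<le> (\<Sum>w\<in>W. B * norm (a w))" for z
    unfolding conv_pow.simps
    by (intro order.trans[OF norm_sum] sum_mono) (simp add: norm_mult mult_right_mono B)
  then show ?case by blast
qed

text \<open>Real and imaginary part are approximated separately and padded to a common degree.
  Complex coefficients make the result a polynomial that can also be evaluated at non-real
  eigenvalues.\<close>

lemma complex_polynomial_approximation:
  fixes f :: "real \<Rightarrow> complex"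
  assumes f: "continuous_on {-R..R} f" and e: "e > 0"
  obtains N c where "\<And>x. x \<in> {-R..R} \<Longrightarrow> norm (f x - (\<Sum>i\<le>N. c i * of_real x ^ i)) \<le> e"
proof -
  have "\<exists>a n. \<forall>x\<in>{-R..R}. \<bar>h x - (\<Sum>i\<le>n. a i * x ^ i)\<bar> < e / 2" if h: "continuous_on {-R..R} h" for h :: "real \<Rightarrow> real"
  proof -
    obtain g where "real_polynomial_function g" "\<And>x. x \<in> {-R..R} \<Longrightarrow> \<bar>h x - g x\<bar> < e / 2"
      using Stone_Weierstrass_real_polynomial_function[OF compact_Icc h, of "e / 2"] e by auto
    then show ?thesis unfolding real_polynomial_function_iff_sum by blast
  qed
  note ex = this
  obtain a n where a: "\<And>x. x \<in> {-R..R} \<Longrightarrow> \<bar>Re (f x) - (\<Sum>i\<le>n. a i * x ^ i)\<bar> < e / 2"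
    using ex[OF continuous_on_Re[OF f]] by blast
  obtain b m where b: "\<And>x. x \<in> {-R..R} \<Longrightarrow> \<bar>Im (f x) - (\<Sum>i\<le>m. b i * x ^ i)\<bar> < e / 2"
    using ex[OF continuous_on_Im[OF f]] by blast
  define c where "c = (\<lambda>i. Complex (if i \<le> n then a i else 0) (if i \<le> m then b i else 0))"
  show thesis
  proof (rule that[of c "max n m"])
    fix x assume x: "x \<in> {-R..R}"
    let ?s = "\<Sum>i\<le>max n m. c i * of_real x ^ i"
    have ext: "(\<Sum>i\<le>max n m. (if i \<le> l then a' i else 0) * x ^ i) = (\<Sum>i\<le>l. a' i * x ^ i)"
      if "l \<le> max n m" for l and a' :: "nat \<Rightarrow> real"
      using that by (intro sum.mono_neutral_cong_right) auto
    have "Re ?s = (\<Sum>i\<le>n. a i * x ^ i)"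
      using ext[of n a] by (simp add: c_def Re_sum flip: of_real_power)
    moreover have "Im ?s = (\<Sum>i\<le>m. b i * x ^ i)"
      using ext[of m b] by (simp add: c_def Im_sum flip: of_real_power)
    ultimately have "\<bar>Re (f x - ?s)\<bar> < e / 2" "\<bar>Im (f x - ?s)\<bar> < e / 2"
      using a[OF x] b[OF x] by auto
    then show "norm (f x - ?s) \<le> e"
      using cmod_le[of "f x - ?s"] by linarith
  qed
qed

lemma norm_sum_mset_le:
  "(\<And>z. z \<in># M \<Longrightarrow> norm (f z) \<le> B) \<Longrightarrow> norm (\<Sum>z\<in>#M. f z) \<le> real (size M) * B"
proof (induction M)
  case (add x M)
  have "norm (\<Sum>z\<in>#add_mset x M. f z) \<le> norm (f x) + norm (\<Sum>z\<in>#M. f z)"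
    by (simp add: norm_triangle_ineq)
  also have "\<dots> \<le> B + real (size M) * B"
    using add by (intro add_mono) auto
  finally show ?case by (simp add: algebra_simps)
qed simp

text \<open>A flat index \<open>r < N\<^sub>1 N\<^sub>2\<close> stands for the pair \<open>(r mod N\<^sub>1, r div N\<^sub>1)\<close>.\<close>
definition offset :: "nat \<Rightarrow> nat \<Rightarrow> nat \<Rightarrow> int \<times> int" where
  "offset N r s = (int (r mod N) - int (s mod N), int (r div N) - int (s div N))"

lemma offset_diff: "offset N r t = offset N r s - offset N t s"
  by (simp add: offset_def)

lemma offset_self [simp]: "offset N r r = 0"
  by (simp add: offset_def zero_prod_def)

lemma inj_offset: "inj (\<lambda>r. offset N r s)" "inj (\<lambda>s. offset N r s)"
  by (rule injI, simp add: offset_def, metis mod_mult_div_eq)+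

text \<open>Distance from the sides of the index rectangle: the whole window around a deep index
  stays inside and does not wrap into a neighbouring row of the flat numbering.\<close>

definition deep :: "nat \<Rightarrow> nat \<Rightarrow> nat \<Rightarrow> nat \<Rightarrow> bool" where
  "deep L N1 N2 s \<longleftrightarrow> L \<le> s mod N1 \<and> s mod N1 + L < N1 \<and> L \<le> s div N1 \<and> s div N1 + L < N2"

definition window :: "nat \<Rightarrow> (int \<times> int) set" where
  "window L = {-int L..int L} \<times> {-int L..int L}"

lemma finite_window [simp]: "finite (window L)"
  by (simp add: window_def)

text \<open>Injectivity of offsets bounds the non-zero entries per row and per column independently
  of the size.\<close>

lemma card_offset_le:
  "card {t \<in> S. offset N t s \<in> window L} \<le> card (window L)"
  "card {t \<in> S. offset N s t \<in> window L} \<le> card (window L)"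
  by (rule card_inj_on_le[OF inj_on_subset[OF inj_offset(1)[of N s]]], auto)
    (rule card_inj_on_le[OF inj_on_subset[OF inj_offset(2)[of N s]]], auto)

lemma sum_window_le:
  fixes f :: "nat \<Rightarrow> real"
  assumes "finite S" "\<And>t. t \<in> S \<Longrightarrow> f t \<le> B" "B \<ge> 0" "card {t \<in> S. P t} \<le> m"
    "\<And>t. t \<in> S \<Longrightarrow> \<not> P t \<Longrightarrow> f t = 0"
  shows "(\<Sum>t\<in>S. f t) \<le> real m * B"
proof -
  have "(\<Sum>t\<in>S. f t) = (\<Sum>t\<in>{t \<in> S. P t}. f t)"
    using assms by (intro sum.mono_neutral_right) auto
  also have "\<dots> \<le> real (card {t \<in> S. P t}) * B"
    using assms by (intro sum_bounded_above) auto
  also have "\<dots> \<le> real m * B" using assms by (intro mult_right_mono) auto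
  finally show ?thesis .
qed

lemma deep_window:
  assumes "deep (K + L) N1 N2 s" "w \<in> window L"
  obtains t where "t < N1 * N2" "offset N1 t s = w"
proof -
  define x where "x = nat (int (s mod N1) + fst w)"
  define y where "y = nat (int (s div N1) + snd w)"
  have x: "int x = int (s mod N1) + fst w" "K \<le> x" "x + K < N1"
    and y: "int y = int (s div N1) + snd w" "K \<le> y" "y + K < N2"
    using assms unfolding x_def y_def deep_def window_def by auto
  have m: "(y * N1 + x) mod N1 = x" "(y * N1 + x) div N1 = y" using x by auto
  show thesis
  proof (rule that[of "y * N1 + x"])
    have "y * N1 + x < (y + 1) * N1" using x by simp
    also have "\<dots> \<le> N2 * N1" using y by (intro mult_right_mono) auto
    finally show "y * N1 + x < N1 * N2" by (simp add: mult.commute)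
    show "offset N1 (y * N1 + x) s = w"
      using x y by (simp add: offset_def m prod_eq_iff)
  qed
qed

lemma deep_offset:
  assumes "deep (K + L) N1 N2 s" "offset N1 t s \<in> window L"
  shows "deep K N1 N2 t"
  using assms unfolding deep_def offset_def window_def by auto

text \<open>A frame of width \<open>L\<close>: of order \<open>N1 + N2\<close> among
  \<open>N1 * N2\<close> indices, hence negligible on average.\<close>

lemma card_not_deep: "card {s \<in> {..<N1 * N2}. \<not> deep L N1 N2 s} \<le> 2 * L * N2 + 2 * L * N1"
proof -
  let ?B = "\<lambda>N. {x. x < N \<and> (x < L \<or> N \<le> x + L)}"
  have B: "card (?B N) \<le> 2 * L" for N
  proof -
    have "?B N \<subseteq> {..<L} \<union> {N - L..<N}" by auto
    then have "card (?B N) \<le> card ({..<L} \<union> {N - L..<N})" by (intro card_mono) auto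
    also have "\<dots> \<le> card {..<L} + card {N - L..<N}" by (rule card_Un_le)
    finally show ?thesis by simp
  qed
  have fin: "finite (?B N)" for N by simp
  have "card {s \<in> {..<N1 * N2}. \<not> deep L N1 N2 s} \<le> card (?B N1 \<times> {..<N2} \<union> {..<N1} \<times> ?B N2)"
  proof (rule card_inj_on_le[of "\<lambda>s. (s mod N1, s div N1)"])
    show "inj_on (\<lambda>s. (s mod N1, s div N1)) {s \<in> {..<N1 * N2}. \<not> deep L N1 N2 s}"
      by (rule inj_onI) (metis mod_mult_div_eq prod.inject)
    show "(\<lambda>s. (s mod N1, s div N1)) ` {s \<in> {..<N1 * N2}. \<not> deep L N1 N2 s} \<subseteq> ?B N1 \<times> {..<N2} \<union> {..<N1} \<times> ?B N2"
    proof (rule image_subsetI)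
      fix s assume "s \<in> {s \<in> {..<N1 * N2}. \<not> deep L N1 N2 s}"
      then have s: "s < N1 * N2" "\<not> deep L N1 N2 s" by auto
      have "N1 > 0" using s by (cases N1) auto
      then have "s mod N1 < N1" "s div N1 < N2" using s by (auto simp: less_mult_imp_div_less mult.commute)
      then show "(s mod N1, s div N1) \<in> ?B N1 \<times> {..<N2} \<union> {..<N1} \<times> ?B N2"
        using s by (auto simp: deep_def)
    qed
  qed (use fin in auto)
  also have "\<dots> \<le> card (?B N1 \<times> {..<N2}) + card ({..<N1} \<times> ?B N2)" by (rule card_Un_le)
  also have "\<dots> = card (?B N1) * N2 + N1 * card (?B N2)" by (simp add: card_cartesian_product)
  also have "\<dots> \<le> 2 * L * N2 + N1 * (2 * L)" by (intro add_mono mult_mono B) auto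
  finally show ?thesis by (simp add: mult.commute)
qed

text \<open>Decouples the spectral argument from splines. Columns near the boundary are constrained
  only through band, bound and asymmetry.\<close>

locale asymptotic_toeplitz =
  fixes A :: "nat \<Rightarrow> real mat" and N1 N2 :: "nat \<Rightarrow> nat" and L :: nat and C :: real
    and a :: "int \<times> int \<Rightarrow> real"
  assumes carrier: "\<And>n. A n \<in> carrier_mat (N1 n * N2 n) (N1 n * N2 n)"
    and N1: "filterlim N1 at_top sequentially" and N2: "filterlim N2 at_top sequentially"
    and band: "eventually (\<lambda>n. \<forall>r<N1 n * N2 n. \<forall>s<N1 n * N2 n.
       offset (N1 n) r s \<notin> window L \<longrightarrow> A n $$ (r, s) = 0) sequentially"
    and bound: "eventually (\<lambda>n. \<forall>r<N1 n * N2 n. \<forall>s<N1 n * N2 n. \<bar>A n $$ (r, s)\<bar> \<le> C) sequentially"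
    and conv: "\<And>e. e > 0 \<Longrightarrow> eventually (\<lambda>n. \<forall>r<N1 n * N2 n. \<forall>s<N1 n * N2 n.
       deep L (N1 n) (N2 n) s \<longrightarrow> offset (N1 n) r s \<in> window L
         \<longrightarrow> \<bar>A n $$ (r, s) - a (offset (N1 n) r s)\<bar> \<le> e) sequentially"
    and asym: "\<And>e. e > 0 \<Longrightarrow> eventually (\<lambda>n. \<forall>r<N1 n * N2 n. \<forall>s<N1 n * N2 n.
       \<bar>A n $$ (r, s) - A n $$ (s, r)\<bar> \<le> e) sequentially"
begin

abbreviation "d n \<equiv> N1 n * N2 n"
abbreviation "W \<equiv> window L"
abbreviation "Ac n \<equiv> map_mat complex_of_real (A n)"
abbreviation "ac \<equiv> \<lambda>z. complex_of_real (a z)"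

definition D where "D = real (card W) * (\<bar>C\<bar> + 1)"

lemma D_nonneg: "0 \<le> D" by (simp add: D_def)

lemma Ac_carrier: "Ac n \<in> carrier_mat (d n) (d n)" using carrier[of n] by simp

lemma Ac_index: "r < d n \<Longrightarrow> s < d n \<Longrightarrow> Ac n $$ (r, s) = complex_of_real (A n $$ (r, s))"
  using carrier[of n] by simp

lemma sums_le:
  "eventually (\<lambda>n. \<forall>r<d n. (\<Sum>s<d n. norm (Ac n $$ (r, s))) \<le> D \<and> (\<Sum>s<d n. norm (Ac n $$ (s, r))) \<le> D) sequentially"
  using band bound
proof eventually_elim
  case (elim n)
  show ?case
  proof (intro allI impI conjI)
    fix r assume r: "r < d n"
    have le: "norm (Ac n $$ (i, j)) \<le> \<bar>C\<bar> + 1" if "i < d n" "j < d n" for i j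
      using elim(2) that by (fastforce simp: Ac_index)
    show "(\<Sum>s<d n. norm (Ac n $$ (r, s))) \<le> D" unfolding D_def
      using elim(1) r le
      by (intro sum_window_le[where P = "\<lambda>s. offset (N1 n) r s \<in> W"] card_offset_le) (auto simp: Ac_index)
    show "(\<Sum>s<d n. norm (Ac n $$ (s, r))) \<le> D" unfolding D_def
      using elim(1) r le
      by (intro sum_window_le[where P = "\<lambda>s. offset (N1 n) s r \<in> W"] card_offset_le) (auto simp: Ac_index)
  qed
qed

text \<open>Induction with the column sums; the bound is crude but independent of \<open>n\<close>,
  and controls the diagonal entries near the boundary.\<close>

lemma power_bound:
  "eventually (\<lambda>n. \<forall>r<d n. \<forall>s<d n. norm ((Ac n ^\<^sub>m k) $$ (r, s)) \<le> D ^ k) sequentially"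
proof (induction k)
  case 0
  show ?case by (auto intro!: always_eventually simp: carrier_matD(1)[OF carrier])
next
  case (Suc k)
  from Suc sums_le show ?case
  proof eventually_elim
    case (elim n)
    show ?case
    proof (intro allI impI)
      fix r s assume rs: "r < d n" "s < d n"
      have "norm ((Ac n ^\<^sub>m Suc k) $$ (r, s)) = norm (\<Sum>t<d n. (Ac n ^\<^sub>m k) $$ (r, t) * Ac n $$ (t, s))"
        unfolding pow_mat.simps
        by (subst index_mult_mat_sum[OF pow_carrier_mat[OF Ac_carrier] Ac_carrier rs]) simp
      also have "\<dots> \<le> (\<Sum>t<d n. D ^ k * norm (Ac n $$ (t, s)))"
        using elim(1) rs by (intro order.trans[OF norm_sum] sum_mono) (simp add: norm_mult mult_right_mono)
      also have "\<dots> = D ^ k * (\<Sum>t<d n. norm (Ac n $$ (t, s)))" by (simp add: sum_distrib_left)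
      also have "\<dots> \<le> D ^ k * D" using elim(2) rs D_nonneg by (intro mult_left_mono) auto
      finally show "norm ((Ac n ^\<^sub>m Suc k) $$ (r, s)) \<le> D ^ Suc k" by (simp only: power_Suc2)
    qed
  qed
qed

text \<open>A factor of \<open>A\<close> moves the column by at most \<open>L\<close>, so each
  factor uses up depth \<open>L\<close>. A deep column sees its full window, and the matrix product
  becomes the recursion of \<open>conv_pow\<close>.\<close>

lemma power_conv:
  "e > 0 \<Longrightarrow> eventually (\<lambda>n. \<forall>r<d n. \<forall>s<d n. deep (k * L) (N1 n) (N2 n) s \<longrightarrow>
     norm ((Ac n ^\<^sub>m k) $$ (r, s) - conv_pow ac W k (offset (N1 n) r s)) \<le> e) sequentially"
proof (induction k arbitrary: e)
  case 0
  have "offset (N1 n) r s = 0 \<longleftrightarrow> r = s" for n r s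
    using injD[OF inj_offset(1), of "N1 n" r s s] by auto
  then show ?case using 0 by (auto intro!: always_eventually simp: carrier_matD(1)[OF carrier])
next
  case (Suc k)
  obtain B where B: "\<And>z. norm (conv_pow ac W k z) \<le> B" using conv_pow_bounded by blast
  have B0: "0 \<le> B" using norm_ge_zero B order.trans by blast
  \<comment> \<open>At most \<open>card W\<close> neighbours contribute
    \<open>e' * (\<bar>C\<bar> + B)\<close> each; the added 1 prevents division by zero.\<close>
  define e' where "e' = e / (real (card W) * (\<bar>C\<bar> + B) + 1)"
  have den: "real (card W) * (\<bar>C\<bar> + B) + 1 > 0" using B0 by (intro add_nonneg_pos mult_nonneg_nonneg) auto
  have e': "e' > 0" unfolding e'_def using Suc.prems den by simp
  from Suc.IH[OF e'] conv[OF e'] band bound show ?case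
  proof eventually_elim
    case (elim n)
    show ?case
    proof (intro allI impI)
      fix r s assume rs: "r < d n" "s < d n" and dp: "deep (Suc k * L) (N1 n) (N2 n) s"
      define T where "T = {t \<in> {..<d n}. offset (N1 n) t s \<in> W}"
      have dp': "deep (k * L + L) (N1 n) (N2 n) s" using dp by (simp add: add.commute)
      have dL: "deep L (N1 n) (N2 n) s" using dp' unfolding deep_def by auto
      \<comment> \<open>Every offset in the window is realised by exactly one neighbour of a deep
        column.\<close>
      have bij: "bij_betw (\<lambda>t. offset (N1 n) t s) T W"
        unfolding bij_betw_def
      proof
        show "inj_on (\<lambda>t. offset (N1 n) t s) T" using inj_offset(1) inj_on_subset by blast
        show "(\<lambda>t. offset (N1 n) t s) ` T = W"
        proof (intro equalityI subsetI)
          fix w assume "w \<in> W"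
          from deep_window[OF dp' this] show "w \<in> (\<lambda>t. offset (N1 n) t s) ` T"
            unfolding T_def using \<open>w \<in> W\<close> by (metis (mono_tags, lifting) image_eqI lessThan_iff mem_Collect_eq)
        qed (auto simp: T_def)
      qed
      have cardT: "card T = card W" using bij by (rule bij_betw_same_card)
      have "(Ac n ^\<^sub>m Suc k) $$ (r, s) = (\<Sum>t<d n. (Ac n ^\<^sub>m k) $$ (r, t) * Ac n $$ (t, s))"
        unfolding pow_mat.simps
        by (rule index_mult_mat_sum[OF pow_carrier_mat[OF Ac_carrier] Ac_carrier rs])
      also have "\<dots> = (\<Sum>t\<in>T. (Ac n ^\<^sub>m k) $$ (r, t) * Ac n $$ (t, s))"
        unfolding T_def using elim(3) rs by (intro sum.mono_neutral_right) (auto simp: Ac_index)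
      finally have lhs: "(Ac n ^\<^sub>m Suc k) $$ (r, s) = (\<Sum>t\<in>T. (Ac n ^\<^sub>m k) $$ (r, t) * Ac n $$ (t, s))" .
      have rhs: "conv_pow ac W (Suc k) (offset (N1 n) r s)
          = (\<Sum>t\<in>T. conv_pow ac W k (offset (N1 n) r t) * ac (offset (N1 n) t s))"
        unfolding conv_pow.simps
        by (subst sum.reindex_bij_betw[OF bij, symmetric]) (simp add: offset_diff[of "N1 n" r _ s, symmetric])
      have term_le: "norm ((Ac n ^\<^sub>m k) $$ (r, t) * Ac n $$ (t, s) - conv_pow ac W k (offset (N1 n) r t) * ac (offset (N1 n) t s))
          \<le> e' * (\<bar>C\<bar> + B)" if t: "t \<in> T" for t
      proof -
        have td: "t < d n" "offset (N1 n) t s \<in> W" using t by (auto simp: T_def)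
        let ?x = "(Ac n ^\<^sub>m k) $$ (r, t)" and ?x' = "conv_pow ac W k (offset (N1 n) r t)"
        let ?y = "Ac n $$ (t, s)" and ?y' = "ac (offset (N1 n) t s)"
        have x: "norm (?x - ?x') \<le> e'"
          using elim(1) rs td deep_offset[OF dp' td(2)] by blast
        have "norm (?y - ?y') = \<bar>A n $$ (t, s) - a (offset (N1 n) t s)\<bar>"
          unfolding Ac_index[OF td(1) rs(2)] by (metis norm_of_real of_real_diff)
        then have y: "norm (?y - ?y') \<le> e'" using elim(2) rs td dL by simp
        have yC: "norm ?y \<le> \<bar>C\<bar>" using elim(4) rs td by (fastforce simp: Ac_index)
        have "u * v - u' * v' = (u - u') * v + u' * (v - v')" for u u' v v' :: complex by (simp add: algebra_simps)
        then have "norm (?x * ?y - ?x' * ?y') \<le> norm (?x - ?x') * norm ?y + norm ?x' * norm (?y - ?y')"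
          unfolding norm_mult[symmetric] by (simp only: norm_triangle_ineq)
        also have "\<dots> \<le> e' * \<bar>C\<bar> + B * e'"
          using x y yC B e' B0 by (intro add_mono mult_mono) auto
        finally show ?thesis by (simp add: algebra_simps)
      qed
      have "norm ((Ac n ^\<^sub>m Suc k) $$ (r, s) - conv_pow ac W (Suc k) (offset (N1 n) r s))
         \<le> (\<Sum>t\<in>T. e' * (\<bar>C\<bar> + B))"
        unfolding lhs rhs sum_subtractf[symmetric]
        by (intro order.trans[OF norm_sum] sum_mono term_le)
      also have "\<dots> = e' * (real (card W) * (\<bar>C\<bar> + B))" by (simp add: cardT)
      also have "\<dots> \<le> e' * (real (card W) * (\<bar>C\<bar> + B) + 1)" using e' by (intro mult_left_mono) auto
      also have "\<dots> = e" using den by (simp add: e'_def)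
      finally show "norm ((Ac n ^\<^sub>m Suc k) $$ (r, s) - conv_pow ac W (Suc k) (offset (N1 n) r s)) \<le> e" .
    qed
  qed
qed

lemma d_pos: "eventually (\<lambda>n. N1 n > 0 \<and> N2 n > 0) sequentially"
  using filterlim_at_top[THEN iffD1, OF N1, rule_format, of 1] filterlim_at_top[THEN iffD1, OF N2, rule_format, of 1]
  by eventually_elim auto

text \<open>Deep diagonal entries are close to the limit. The others are bounded, and their number
  divided by \<open>d n\<close> is of order \<open>1 / N1 + 1 / N2\<close>.\<close>

lemma trace_limit:
  "(\<lambda>n. (\<Sum>i<d n. (Ac n ^\<^sub>m k) $$ (i, i)) / of_nat (d n)) \<longlonglongrightarrow> conv_pow ac W k 0"
proof (rule LIMSEQ_I)
  fix e :: real assume e: "e > 0"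
  obtain B where B: "\<And>z. norm (conv_pow ac W k z) \<le> B" using conv_pow_bounded by blast
  have B0: "0 \<le> B" using norm_ge_zero B order.trans by blast
  let ?l = "real (2 * (k * L))"
  have "(\<lambda>n. (D ^ k + B) * (?l / real (N1 n) + ?l / real (N2 n))) \<longlonglongrightarrow> (D ^ k + B) * (0 + 0)"
    by (intro tendsto_intros real_tendsto_divide_at_top[OF tendsto_const]
        filterlim_compose[OF filterlim_real_sequentially] N1 N2)
  then have "eventually (\<lambda>n. (D ^ k + B) * (?l / real (N1 n) + ?l / real (N2 n)) < e / 2) sequentially"
    using e by (intro order_tendstoD(2)) auto
  moreover have "eventually (\<lambda>n. \<forall>r<d n. \<forall>s<d n. deep (k * L) (N1 n) (N2 n) s \<longrightarrow>
     norm ((Ac n ^\<^sub>m k) $$ (r, s) - conv_pow ac W k (offset (N1 n) r s)) \<le> e / 4) sequentially"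
    using e by (intro power_conv) auto
  ultimately have "eventually (\<lambda>n. norm ((\<Sum>i<d n. (Ac n ^\<^sub>m k) $$ (i, i)) / of_nat (d n) - conv_pow ac W k 0) < e) sequentially"
    using power_bound[of k] d_pos
  proof eventually_elim
    case (elim n)
    have d0: "real (d n) > 0" using elim(4) by simp
    define Z where "Z = {s \<in> {..<d n}. \<not> deep (k * L) (N1 n) (N2 n) s}"
    let ?X = "\<lambda>i. (Ac n ^\<^sub>m k) $$ (i, i) - conv_pow ac W k 0"
    have "(\<Sum>i<d n. norm (?X i)) \<le> (\<Sum>i<d n. e / 4 + (if i \<in> Z then D ^ k + B else 0))"
    proof (rule sum_mono)
      fix i assume i: "i \<in> {..<d n}"
      show "norm (?X i) \<le> e / 4 + (if i \<in> Z then D ^ k + B else 0)"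
      proof (cases "i \<in> Z")
        case True
        have "norm (?X i) \<le> D ^ k + B"
          using elim(3) i by (intro order.trans[OF norm_triangle_ineq4] add_mono B) auto
        then show ?thesis using True e by simp
      next
        case False
        then have "deep (k * L) (N1 n) (N2 n) i" using i by (simp add: Z_def)
        then have "norm ((Ac n ^\<^sub>m k) $$ (i, i) - conv_pow ac W k (offset (N1 n) i i)) \<le> e / 4"
          using elim(2) i by blast
        then show ?thesis using False by simp
      qed
    qed
    also have "\<dots> = real (d n) * (e / 4) + real (card Z) * (D ^ k + B)"
    proof -
      have "{..<d n} \<inter> Z = Z" by (auto simp: Z_def)
      then show ?thesis by (simp add: sum.distrib sum.If_cases)
    qed
    also have "\<dots> \<le> real (d n) * (e / 4) + (?l * real (N2 n) + ?l * real (N1 n)) * (D ^ k + B)"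
    proof -
      have "real (card Z) \<le> real (2 * (k * L) * N2 n + 2 * (k * L) * N1 n)"
        unfolding Z_def of_nat_le_iff by (rule card_not_deep)
      then show ?thesis using D_nonneg B0 by (intro add_left_mono mult_right_mono) auto
    qed
    also have "(?l * real (N2 n) + ?l * real (N1 n)) * (D ^ k + B)
        = real (d n) * ((D ^ k + B) * (?l / real (N1 n) + ?l / real (N2 n)))"
      using elim(4) by (simp add: field_simps)
    also have "real (d n) * (e / 4) + \<dots> < real (d n) * e"
    proof -
      have "real (d n) * (e / 4 + (D ^ k + B) * (?l / real (N1 n) + ?l / real (N2 n))) < real (d n) * e"
        using elim(1) e d0 by (intro mult_strict_left_mono) auto
      then show ?thesis by (simp only: distrib_left)
    qed
    finally have S: "(\<Sum>i<d n. norm (?X i)) < real (d n) * e" .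
    have "(\<Sum>i<d n. (Ac n ^\<^sub>m k) $$ (i, i)) / of_nat (d n) - conv_pow ac W k 0 = (\<Sum>i<d n. ?X i) / of_nat (d n)"
      using d0 by (simp add: sum_subtractf diff_divide_distrib del: of_nat_mult)
    then have "norm ((\<Sum>i<d n. (Ac n ^\<^sub>m k) $$ (i, i)) / of_nat (d n) - conv_pow ac W k 0)
        = norm (\<Sum>i<d n. ?X i) / real (d n)"
      by (simp add: norm_divide del: of_nat_mult)
    also have "\<dots> \<le> (\<Sum>i<d n. norm (?X i)) / real (d n)"
      by (intro divide_right_mono norm_sum) auto
    also have "\<dots> < e" using S d0 by (simp add: pos_divide_less_eq mult.commute)
    finally show ?case .
  qed
  then show "\<exists>no. \<forall>n\<ge>no. norm ((\<Sum>i<d n. (Ac n ^\<^sub>m k) $$ (i, i)) / of_nat (d n) - conv_pow ac W k 0) < e"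
    by (simp add: eventually_sequentially)
qed

lemma eigvals_bound: "eventually (\<lambda>n. \<forall>z\<in>#eigvals (A n). norm z \<le> D) sequentially"
  using sums_le
proof eventually_elim
  case (elim n)
  then show ?case unfolding eigvals_def
    by (intro ballI) (rule eigenvalue_row_sum_bound[OF Ac_carrier], auto)
qed

lemma eigvals_Im:
  assumes e: "e > 0"
  shows "eventually (\<lambda>n. \<forall>z\<in>#eigvals (A n). \<bar>Im z\<bar> \<le> e) sequentially"
proof -
  define e' where "e' = e / (real (card W) + 1)"
  have e': "e' > 0" using e by (simp add: e'_def)
  from asym[OF e'] band show ?thesis
  proof eventually_elim
    case (elim n)
    show ?case
    proof
      fix z assume z: "z \<in># eigvals (A n)"
      have "(\<Sum>j<d n. \<bar>A n $$ (i, j) - A n $$ (j, i)\<bar>) \<le> real (2 * card W) * e'" if i: "i < d n" for i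
      proof (rule sum_window_le)
        \<comment> \<open>The difference can be non-zero when either entry lies in the band, hence
          twice the window size.\<close>
        let ?P = "\<lambda>j. offset (N1 n) i j \<in> W \<or> offset (N1 n) j i \<in> W"
        have "{t \<in> {..<d n}. ?P t} = {t \<in> {..<d n}. offset (N1 n) i t \<in> W} \<union> {t \<in> {..<d n}. offset (N1 n) t i \<in> W}"
          by blast
        then have "card {t \<in> {..<d n}. ?P t} \<le> card {t \<in> {..<d n}. offset (N1 n) i t \<in> W} + card {t \<in> {..<d n}. offset (N1 n) t i \<in> W}"
          by (simp only: card_Un_le)
        also have "\<dots> \<le> card W + card W" by (intro add_mono card_offset_le)
        finally show "card {t \<in> {..<d n}. ?P t} \<le> 2 * card W" by simp
      qed (use elim e' i in auto)
      then have "2 * \<bar>Im z\<bar> \<le> real (2 * card W) * e'"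
        using z carrier[of n] unfolding eigvals_def by (intro eigenvalue_Im_bound) auto
      also have "\<dots> \<le> 2 * (real (card W) + 1) * e'" using e' by (intro mult_right_mono) auto
      also have "\<dots> = 2 * e" by (simp add: e'_def field_simps)
      finally show "\<bar>Im z\<bar> \<le> e" by simp
    qed
  qed
qed

text \<open>Traces only see polynomials in \<open>z\<close>, and these cannot approximate a general
  continuous \<open>F\<close> on a disc. So \<open>P\<close> is fitted on a real interval, then
  \<open>\<delta>\<close> is chosen for the fixed function \<open>F - P\<close>, and only then
  \<open>n\<close>, such that all eigenvalues lie within \<open>\<delta> / 2\<close> of the real
  axis.\<close>

theorem eigenvalue_distribution:
  fixes F :: "complex \<Rightarrow> complex" and g :: "real \<times> real \<Rightarrow> real"
  assumes F: "continuous_on UNIV F"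
    and g: "\<And>\<theta>. complex_of_real (g \<theta>) = (\<Sum>w\<in>W. ac w * fexp w \<theta>)"
  shows "(\<lambda>n. (\<Sum>z\<in>#eigvals (A n). F z) / of_nat (d n))
    \<longlonglongrightarrow> (1 / (4 * pi\<^sup>2)) *\<^sub>R integral (cbox (-pi, -pi) (pi, pi)) (\<lambda>\<theta>. F (complex_of_real (g \<theta>)))"
proof (rule LIMSEQ_I)
  fix e :: real assume e: "e > 0"
  let ?Q = "cbox (-pi, -pi) (pi, pi) :: (real \<times> real) set"
  define G where "G = (\<Sum>w\<in>W. \<bar>a w\<bar>)"
  \<comment> \<open>One interval for the real parts of the eigenvalues and for the range of the
    symbol.\<close>
  define R where "R = max D G"
  have gR: "g \<theta> \<in> {-R..R}" for \<theta>
  proof -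
    have "\<bar>g \<theta>\<bar> = norm (\<Sum>w\<in>W. ac w * fexp w \<theta>)" unfolding g[symmetric] by simp
    also have "\<dots> \<le> G" unfolding G_def
      by (rule order.trans[OF norm_sum]) (simp add: norm_mult fexp_def)
    finally show ?thesis unfolding R_def by auto
  qed
  have gc: "continuous_on S (\<lambda>\<theta>. complex_of_real (g \<theta>))" for S
    unfolding g by (intro continuous_intros)
  have Fc: "continuous_on {-R..R} (\<lambda>x. F (complex_of_real x))"
    by (rule continuous_on_compose2[OF F]) (auto intro!: continuous_intros)
  have e8: "e / 8 > 0" using e by simp
  obtain N c where c: "\<And>x. x \<in> {-R..R} \<Longrightarrow> norm (F (complex_of_real x) - (\<Sum>i\<le>N. c i * of_real x ^ i)) \<le> e / 8"
    using complex_polynomial_approximation[OF Fc e8] by blast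
  define P where "P = (\<lambda>z. \<Sum>i\<le>N. c i * z ^ i)"
  have Pc: "continuous_on S P" for S unfolding P_def by (intro continuous_intros)
  have "uniformly_continuous_on (cball 0 R) (\<lambda>z. F z - P z)"
    by (intro compact_uniformly_continuous continuous_intros Pc continuous_on_subset[OF F]) auto
  then obtain \<delta> where \<delta>: "\<delta> > 0" "\<And>x y. x \<in> cball 0 R \<Longrightarrow> y \<in> cball 0 R \<Longrightarrow> dist x y < \<delta>
      \<Longrightarrow> dist (F x - P x) (F y - P y) < e / 8"
    unfolding uniformly_continuous_on_def using e by (metis zero_less_divide_iff zero_less_numeral)
  have FP: "norm (F z - P z) \<le> e / 4" if "norm z \<le> R" "\<bar>Im z\<bar> \<le> \<delta> / 2" for z
  proof -
    have re: "\<bar>Re z\<bar> \<le> R" using abs_Re_le_cmod[of z] that by linarith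
    have "z - complex_of_real (Re z) = \<i> * of_real (Im z)" by (simp add: complex_eq_iff)
    then have "dist z (complex_of_real (Re z)) < \<delta>"
      using that \<delta>(1) by (simp add: dist_norm norm_mult)
    then have "dist (F z - P z) (F (complex_of_real (Re z)) - P (complex_of_real (Re z))) < e / 8"
      using that re by (intro \<delta>(2)) auto
    moreover have "norm (F (complex_of_real (Re z)) - P (complex_of_real (Re z))) \<le> e / 8"
      unfolding P_def using re by (intro c) auto
    ultimately show ?thesis unfolding dist_norm
      using norm_triangle_sub[of "F z - P z" "F (complex_of_real (Re z)) - P (complex_of_real (Re z))"]
      by linarith
  qed
  let ?I = "\<lambda>f. (1 / (4 * pi\<^sup>2)) *\<^sub>R integral ?Q (\<lambda>\<theta>. f (complex_of_real (g \<theta>)))"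
  have mom: "?I (\<lambda>z. z ^ k) = conv_pow ac W k 0" for k
  proof -
    have "fexp (- 0) \<theta> = 1" for \<theta> by (simp add: fexp_def)
    then have "integral ?Q (\<lambda>\<theta>. complex_of_real (g \<theta>) ^ k) = of_real (4 * pi\<^sup>2) * conv_pow ac W k 0"
      using conv_pow_fourier[of W ac k 0] unfolding g by simp
    then show ?thesis by (simp add: scaleR_conv_of_real)
  qed
  have int: "(\<lambda>\<theta>. f (complex_of_real (g \<theta>))) integrable_on ?Q" if "continuous_on UNIV f" for f :: "complex \<Rightarrow> complex"
    by (intro integrable_continuous continuous_on_compose2[OF that gc]) auto
  have IP: "?I P = (\<Sum>i\<le>N. c i * conv_pow ac W i 0)"
  proof -
    have "integral ?Q (\<lambda>\<theta>. P (complex_of_real (g \<theta>))) = (\<Sum>i\<le>N. integral ?Q (\<lambda>\<theta>. c i * complex_of_real (g \<theta>) ^ i))"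
      unfolding P_def by (intro integral_sum int[of "\<lambda>z. _ * z ^ _"]) (auto intro!: continuous_intros)
    then show ?thesis unfolding mom[symmetric] by (simp add: scaleR_sum_right)
  qed
  have "(\<lambda>n. \<Sum>i\<le>N. c i * ((\<Sum>j<d n. (Ac n ^\<^sub>m i) $$ (j, j)) / of_nat (d n))) \<longlonglongrightarrow> ?I P"
    unfolding IP by (intro tendsto_intros trace_limit)
  moreover have "(\<Sum>i\<le>N. c i * ((\<Sum>j<d n. (Ac n ^\<^sub>m i) $$ (j, j)) / of_nat (d n)))
      = (\<Sum>z\<in>#eigvals (A n). P z) / of_nat (d n)" for n
  proof -
    have "(\<Sum>z\<in>#M. P z) = (\<Sum>i\<le>N. c i * (\<Sum>z\<in>#M. z ^ i))" for M
      by (induction M) (auto simp: P_def sum.distrib distrib_left)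
    then show ?thesis
      unfolding eigvals_def sum_eigenvalue_power[OF Ac_carrier, symmetric]
      by (simp add: sum_divide_distrib)
  qed
  ultimately have "(\<lambda>n. (\<Sum>z\<in>#eigvals (A n). P z) / of_nat (d n)) \<longlonglongrightarrow> ?I P" by (simp only:)
  then have evP: "eventually (\<lambda>n. norm ((\<Sum>z\<in>#eigvals (A n). P z) / of_nat (d n) - ?I P) < e / 4) sequentially"
    unfolding tendsto_iff dist_norm using e by (meson zero_less_divide_iff zero_less_numeral)
  have IFP: "norm (?I F - ?I P) \<le> e / 8"
  proof -
    have "norm (integral ?Q (\<lambda>\<theta>. F (complex_of_real (g \<theta>)) - P (complex_of_real (g \<theta>))))
       \<le> integral ?Q (\<lambda>\<theta>. e / 8)"
    proof (rule integral_norm_bound_integral)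
      show "norm (F (complex_of_real (g \<theta>)) - P (complex_of_real (g \<theta>))) \<le> e / 8" for \<theta>
        unfolding P_def by (rule c[OF gR])
      show "(\<lambda>\<theta>. F (complex_of_real (g \<theta>)) - P (complex_of_real (g \<theta>))) integrable_on ?Q"
        by (intro integrable_diff int F Pc)
    qed (rule integrable_const)
    also have "\<dots> = 4 * pi\<^sup>2 * (e / 8)"
      by (simp add: content_Pair power2_eq_square)
    finally have "norm (integral ?Q (\<lambda>\<theta>. F (complex_of_real (g \<theta>))) - integral ?Q (\<lambda>\<theta>. P (complex_of_real (g \<theta>))))
       \<le> 4 * pi\<^sup>2 * (e / 8)"
      by (subst Henstock_Kurzweil_Integration.integral_diff[symmetric]) (intro int F Pc | simp)+
    moreover have "norm (?I F - ?I P) = norm (integral ?Q (\<lambda>\<theta>. F (complex_of_real (g \<theta>)))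
       - integral ?Q (\<lambda>\<theta>. P (complex_of_real (g \<theta>)))) / (4 * pi\<^sup>2)"
      unfolding scaleR_diff_right[symmetric] by simp
    ultimately show ?thesis by (simp add: pos_divide_le_eq mult.commute)
  qed
  have evI: "eventually (\<lambda>n. \<forall>z\<in>#eigvals (A n). \<bar>Im z\<bar> \<le> \<delta> / 2) sequentially"
    using \<delta>(1) by (intro eigvals_Im) simp
  have "eventually (\<lambda>n. norm ((\<Sum>z\<in>#eigvals (A n). F z) / of_nat (d n) - ?I F) < e) sequentially"
    using evP evI eigvals_bound d_pos
  proof eventually_elim
    case (elim n)
    let ?M = "eigvals (A n)"
    have d0: "real (d n) > 0" using elim by simp
    have "size ?M = d n"
      unfolding eigvals_def using degree_monic_char_poly[OF Ac_carrier] by (simp add: size_proots_complex)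
    moreover have "norm (\<Sum>z\<in>#?M. F z - P z) \<le> real (size ?M) * (e / 4)"
      using elim by (intro norm_sum_mset_le FP) (auto simp: R_def)
    moreover have "(\<Sum>z\<in>#M. F z - P z) = (\<Sum>z\<in>#M. F z) - (\<Sum>z\<in>#M. P z)" for M
      by (induction M) auto
    ultimately have "norm ((\<Sum>z\<in>#?M. F z) - (\<Sum>z\<in>#?M. P z)) / real (d n) \<le> e / 4"
      using d0 by (simp add: pos_divide_le_eq mult.commute)
    then have x: "norm ((\<Sum>z\<in>#?M. F z) / of_nat (d n) - (\<Sum>z\<in>#?M. P z) / of_nat (d n)) \<le> e / 4"
      by (simp add: diff_divide_distrib[symmetric] norm_divide del: of_nat_mult)
    have tri: "norm (u - w) < e" if "norm (u - v) \<le> e / 4" "norm (v - y) < e / 4" "norm (w - y) \<le> e / 8" for u v w y :: complex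
    proof -
      have "norm (u - w) \<le> norm (u - v) + norm (v - y) + norm (w - y)"
        using norm_triangle_ineq[of "u - v" "v - y"] norm_triangle_ineq4[of "u - y" "w - y"] by simp
      then show ?thesis using that e by linarith
    qed
    show ?case by (rule tri[OF x elim(1) IFP])
  qed
  then show "\<exists>no. \<forall>n\<ge>no. norm ((\<Sum>z\<in>#eigvals (A n). F z) / of_nat (d n) - ?I F) < e"
    by (simp add: eventually_sequentially)
qed

end

section \<open>The isogeometric matrices\<close>

text \<open>The Toeplitz coefficients of \<open>hsym\<close>, taken at every integer; beyond
  \<open>p\<close> they vanish, so a window wider than the band causes no harm.\<close>

definition msym :: "nat \<Rightarrow> int \<Rightarrow> real" where
  "msym p k = cardB (2 * p + 1) (real p + 1 - real_of_int k)"

definition ksym :: "nat \<Rightarrow> int \<Rightarrow> real" where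
  "ksym p k = - deriv (deriv (cardB (2 * p + 1))) (real p + 1 - real_of_int k)"

text \<open>Symmetry and support of \<open>ksym\<close> are read off this second difference.\<close>

lemma ksym_eq:
  assumes "p \<ge> 1"
  shows "ksym p k = 2 * cardB (Suc (2 * p - 2)) (real p - real_of_int k)
    - cardB (Suc (2 * p - 2)) (real p + 1 - real_of_int k) - cardB (Suc (2 * p - 2)) (real p - 1 - real_of_int k)"
proof -
  have e: "2 * p + 1 = Suc (Suc (Suc (2 * p - 2)))" using assms by simp
  have a: "real p + 1 - real_of_int k - 1 = real p - real_of_int k"
    "real p + 1 - real_of_int k - 2 = real p - 1 - real_of_int k" by simp_all
  show ?thesis unfolding ksym_def e deriv2_cardB a by linarith
qed

lemma msym_uminus: "msym p (- k) = msym p k"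
proof -
  have "real (2 * p) + 2 - (real p + 1 - real_of_int k) = real p + 1 - real_of_int (- k)" by simp
  then show ?thesis using cardB_sym[of "2 * p" "real p + 1 - real_of_int k"]
    unfolding msym_def by (simp only: Suc_eq_plus1)
qed

lemma ksym_uminus:
  assumes "p \<ge> 1"
  shows "ksym p (- k) = ksym p k"
proof -
  have s: "cardB (Suc (2 * p - 2)) (2 * real p - t) = cardB (Suc (2 * p - 2)) t" for t
    using cardB_sym[of "2 * p - 2" t] assms by (simp add: of_nat_diff del: cardB.simps)
  have "2 * real p - (real p - real_of_int k) = real p - real_of_int (- k)"
    "2 * real p - (real p + 1 - real_of_int k) = real p - 1 - real_of_int (- k)"
    "2 * real p - (real p - 1 - real_of_int k) = real p + 1 - real_of_int (- k)" by simp_all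
  then show ?thesis
    unfolding ksym_eq[OF assms]
    using s[of "real p - real_of_int k"] s[of "real p + 1 - real_of_int k"] s[of "real p - 1 - real_of_int k"]
    by (simp only:)
qed

lemma msym_zero: "\<bar>k\<bar> > int p \<Longrightarrow> msym p k = 0"
proof -
  have *: "msym p k = 0" if "k < - int p" for k
  proof -
    have "real_of_int k \<le> - real p - 1" using that by linarith
    then show ?thesis unfolding msym_def by (intro cardB_support) auto
  qed
  show "\<bar>k\<bar> > int p \<Longrightarrow> msym p k = 0"
    using *[of k] *[of "- k"] msym_uminus[of p k] by (cases "k < 0") auto
qed

lemma ksym_zero:
  assumes "p \<ge> 1" "\<bar>k\<bar> > int p"
  shows "ksym p k = 0"
proof -
  have *: "ksym p k = 0" if "k < - int p" for k
  proof -
    have k: "real_of_int k \<le> - real p - 1" using that by linarith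
    have z: "cardB (Suc (2 * p - 2)) t = 0" if "t \<ge> 2 * real p" for t
      using that assms(1) by (intro cardB_support) (auto simp: of_nat_diff)
    show ?thesis unfolding ksym_eq[OF assms(1)] using k by (simp add: z del: cardB.simps)
  qed
  show ?thesis
    using *[of k] *[of "- k"] ksym_uminus[OF assms(1), of k] assms(2) by (cases "k < 0") auto
qed

lemma sum_symmetric_int:
  fixes f :: "int \<Rightarrow> 'a :: comm_monoid_add"
  shows "(\<Sum>k\<in>{- int p..int p}. f k) = f 0 + (\<Sum>k=1..p. f (int k) + f (- int k))"
proof (induction p)
  case (Suc p)
  have "{- int (Suc p)..int (Suc p)} = insert (int (Suc p)) (insert (- int (Suc p)) {- int p..int p})" by auto
  then have "(\<Sum>k\<in>{- int (Suc p)..int (Suc p)}. f k) = f (int (Suc p)) + (f (- int (Suc p)) + (\<Sum>k\<in>{- int p..int p}. f k))"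
    by simp
  then show ?case unfolding Suc by (simp add: ac_simps)
qed simp

lemma fourier_symmetric:
  assumes "\<And>k. s (- k) = s k" "\<And>k. \<bar>k\<bar> > int p \<Longrightarrow> s k = 0" "p \<le> L"
  shows "(\<Sum>k\<in>{- int L..int L}. complex_of_real (s k) * cis (of_int k * \<theta>))
    = complex_of_real (s 0 + 2 * (\<Sum>k=1..p. s (int k) * cos (real k * \<theta>)))"
proof -
  have "(\<Sum>k\<in>{- int L..int L}. complex_of_real (s k) * cis (of_int k * \<theta>))
      = (\<Sum>k\<in>{- int p..int p}. complex_of_real (s k) * cis (of_int k * \<theta>))"
    using assms(2,3) by (intro sum.mono_neutral_right) auto
  also have "\<dots> = complex_of_real (s 0) + (\<Sum>k=1..p. complex_of_real (s (int k)) * cis (real k * \<theta>) + complex_of_real (s (int k)) * cis (- (real k * \<theta>)))"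
    unfolding sum_symmetric_int by (simp add: assms(1))
  also have "(\<Sum>k=1..p. complex_of_real (s (int k)) * cis (real k * \<theta>) + complex_of_real (s (int k)) * cis (- (real k * \<theta>)))
      = (\<Sum>k=1..p. complex_of_real (2 * (s (int k) * cos (real k * \<theta>))))"
    by (intro sum.cong refl) (simp add: complex_eq_iff)
  finally show ?thesis by (simp add: sum_distrib_left)
qed

lemma hsym_fourier:
  "p \<le> L \<Longrightarrow> complex_of_real (hsym p \<theta>) = (\<Sum>k\<in>{- int L..int L}. complex_of_real (msym p k) * cis (of_int k * \<theta>))"
  using fourier_symmetric[of "msym p" p L \<theta>, OF msym_uminus msym_zero]
  by (simp add: hsym_def msym_def del: cardB.simps)

lemma fsym_fourier:
  "p \<ge> 1 \<Longrightarrow> p \<le> L \<Longrightarrow> complex_of_real (fsym p \<theta>) = (\<Sum>k\<in>{- int L..int L}. complex_of_real (ksym p k) * cis (of_int k * \<theta>))"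
  using fourier_symmetric[of "ksym p" p L \<theta>, OF ksym_uminus ksym_zero]
  by (simp add: fsym_def ksym_def sum_negf del: cardB.simps)

text \<open>Depth \<open>2 * p\<close> of the column leaves depth \<open>p\<close> for every row in
  its band, so both splines have equally spaced knots. \<open>Hmat\<close> gets neither a limit nor
  symmetry, because it enters with a factor of order \<open>1 / n\<close>.\<close>

definition entries_ok :: "gbkind \<Rightarrow> real \<Rightarrow> nat \<Rightarrow> real \<Rightarrow> real \<Rightarrow> nat \<Rightarrow> nat \<Rightarrow> nat \<Rightarrow> bool" where
  "entries_ok Q mu p C e n i j \<longleftrightarrow>
     \<bar>Mmat Q mu n p $$ (i, j)\<bar> \<le> C \<and> \<bar>Kmat Q mu n p $$ (i, j)\<bar> \<le> C \<and> \<bar>Hmat Q mu n p $$ (i, j)\<bar> \<le> C \<and>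
     Mmat Q mu n p $$ (i, j) = Mmat Q mu n p $$ (j, i) \<and> Kmat Q mu n p $$ (i, j) = Kmat Q mu n p $$ (j, i) \<and>
     (\<bar>int i - int j\<bar> > int p \<longrightarrow> Mmat Q mu n p $$ (i, j) = 0 \<and> Kmat Q mu n p $$ (i, j) = 0 \<and> Hmat Q mu n p $$ (i, j) = 0) \<and>
     (2 * p \<le> j \<and> j + 2 * p < n + p - 2 \<longrightarrow>
        \<bar>Mmat Q mu n p $$ (i, j) - msym p (int i - int j)\<bar> \<le> e \<and> \<bar>Kmat Q mu n p $$ (i, j) - ksym p (int i - int j)\<bar> \<le> e)"

lemma matrix_entries:
  assumes p: "p \<ge> 1" and mu: "mu > 0"
  obtains C where "C \<ge> 0" "\<And>e. e > 0 \<Longrightarrow> eventually (\<lambda>n. \<forall>i<n + p - 2. \<forall>j<n + p - 2. entries_ok Q mu p C e n i j) sequentially"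
proof -
  define B where "B = pspl_bound p"
  define Bd where "Bd = dspl_bound p"
  define C where "C = max ((1 + B) * (1 + B) * real (p + 1)) (max ((1 + Bd) * (1 + Bd) * real (p + 1)) ((1 + Bd) * (1 + B) * real (p + 1)))"
  have B0: "0 \<le> B" and Bd0: "0 \<le> Bd"
    using pspl_bound_ge_1[of p] pspl_bound_ge_1[of "p - 1"] unfolding B_def Bd_def dspl_bound_def by auto
  show thesis
  proof (rule that[of C])
    have "0 \<le> (1 + B) * (1 + B) * real (p + 1)" using B0 by (intro mult_nonneg_nonneg) auto
    then show "0 \<le> C" by (simp only: C_def le_max_iff_disj simp_thms)
    fix e :: real assume e: "e > 0"
    define D where "D = max ((1 + 2 * B) * real (p + 1)) ((1 + 2 * Bd) * real (p + 1))"
    have "0 < (1 + 2 * B) * real (p + 1)" using B0 by (intro mult_pos_pos) auto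
    then have D: "0 < D" unfolding D_def by (rule less_le_trans) simp
    define e' where "e' = min 1 (e / D)"
    have e': "e' > 0" "e' \<le> 1" and "e' \<le> e / D" using e D by (auto simp: e'_def)
    then have eD: "e' * D \<le> e" using D by (simp add: pos_le_divide_eq)
    have e1: "e' * ((1 + 2 * B) * real (p + 1)) \<le> e" "e' * ((1 + 2 * Bd) * real (p + 1)) \<le> e"
    proof -
      have "(1 + 2 * B) * real (p + 1) \<le> D" "(1 + 2 * Bd) * real (p + 1) \<le> D" unfolding D_def by (rule max.cobounded1, rule max.cobounded2)
      from this[THEN mult_left_mono, of e'] show "e' * ((1 + 2 * B) * real (p + 1)) \<le> e" "e' * ((1 + 2 * Bd) * real (p + 1)) \<le> e"
        using eD e' by linarith+
    qed
    from entries_main[OF p mu e', of Q] show "eventually (\<lambda>n. \<forall>i<n + p - 2. \<forall>j<n + p - 2. entries_ok Q mu p C e n i j) sequentially"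
    proof eventually_elim
      case (elim n)
      have n: "n > 0" using elim by blast
      have M: "Mmat Q mu n p $$ (i, j) = Ment Q mu n p (i + 2) (j + 2)"
        and K: "Kmat Q mu n p $$ (i, j) = Kent Q mu n p (i + 2) (j + 2)"
        and H: "Hmat Q mu n p $$ (i, j) = Hent Q mu n p (i + 2) (j + 2)"
        if "i < n + p - 2" "j < n + p - 2" for i j
        using that unfolding Mmat_def Kmat_def Hmat_def Ment_def Kent_def Hent_def by (simp_all only: index_mat split)
      show ?case
      proof (intro allI impI)
        fix i j assume ij: "i < n + p - 2" "j < n + p - 2"
        note el = elim[THEN conjunct2, THEN spec, THEN spec, of "i + 2" "j + 2"]
        note c1 = el[THEN conjunct1] and el2 = el[THEN conjunct2]
        note c2 = el2[THEN conjunct1] and el3 = el2[THEN conjunct2]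
        note c3 = el3[THEN conjunct1] and el4 = el3[THEN conjunct2]
        note c4 = el4[THEN conjunct1] and el5 = el4[THEN conjunct2]
        note c5 = el5[THEN conjunct1] and c6 = el5[THEN conjunct2, THEN mp]
        have bd: "\<bar>Ment Q mu n p (i + 2) (j + 2)\<bar> \<le> C" "\<bar>Kent Q mu n p (i + 2) (j + 2)\<bar> \<le> C" "\<bar>Hent Q mu n p (i + 2) (j + 2)\<bar> \<le> C"
          using c3 c4 c5 unfolding C_def B_def Bd_def le_max_iff_disj by blast+
        have sym: "Ment Q mu n p (i + 2) (j + 2) = Ment Q mu n p (j + 2) (i + 2)" "Kent Q mu n p (i + 2) (j + 2) = Kent Q mu n p (j + 2) (i + 2)"
          by (simp_all add: Ment_def Kent_def mult.commute)
        have band: "Ment Q mu n p (i + 2) (j + 2) = 0 \<and> Kent Q mu n p (i + 2) (j + 2) = 0 \<and> Hent Q mu n p (i + 2) (j + 2) = 0"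
          if "\<bar>int i - int j\<bar> > int p"
        proof -
          have "i + 2 + p + 1 \<le> j + 2 \<or> j + 2 + p + 1 \<le> i + 2" using that by linarith
          then show ?thesis by (rule c6)
        qed
        have conv: "\<bar>Ment Q mu n p (i + 2) (j + 2) - msym p (int i - int j)\<bar> \<le> e \<and> \<bar>Kent Q mu n p (i + 2) (j + 2) - ksym p (int i - int j)\<bar> \<le> e"
          if j: "2 * p \<le> j \<and> j + 2 * p < n + p - 2"
        proof (cases "\<bar>int i - int j\<bar> > int p")
          case True
          then show ?thesis using band e msym_zero ksym_zero[OF p] by simp
        next
          case False
          \<comment> \<open>Matrix index \<open>i\<close> stands for spline number
            \<open>i + 2\<close>: zero-based counting plus the omitted first spline.\<close>
          then have I: "p + 1 \<le> i + 2" "i + 2 \<le> n" and J: "p + 1 \<le> j + 2" "j + 2 \<le> n" using j by linarith+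
          have "real (i + 2) - real (j + 2) = real_of_int (int i - int j)" by simp
          then have mm: "real n * integral {0..1} (\<lambda>x. pspl n p p (j + 2) x * pspl n p p (i + 2) x) = msym p (int i - int j)"
            and kk: "(1 / real n) * integral {0..1} (\<lambda>x. dspl n p (j + 2) x * dspl n p (i + 2) x) = ksym p (int i - int j)"
            using mass_interior[OF n I J] stiffness_interior[OF n p I J] unfolding msym_def ksym_def by (simp_all only:)
          show ?thesis
            using order.trans[OF c1[unfolded mm] e1(1)[unfolded B_def]] order.trans[OF c2[unfolded kk] e1(2)[unfolded Bd_def]] by (rule conjI)
        qed
        show "entries_ok Q mu p C e n i j"
          unfolding entries_ok_def M[OF ij] K[OF ij] H[OF ij] M[OF ij(2,1)] K[OF ij(2,1)]
          using bd sym band conv by blast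
      qed
    qed
  qed
qed

section \<open>Assembly of the two-dimensional matrices\<close>

lemma filterlim_n2of:
  assumes "\<nu> > 0" shows "filterlim (n2of \<nu>) at_top sequentially"
  unfolding filterlim_at_top
proof
  fix Z :: nat
  obtain m :: nat where m: "real Z + 1 \<le> \<nu> * real m"
    using real_arch_simple[of "(real Z + 1) / \<nu>"] assms by (auto simp: field_simps)
  show "eventually (\<lambda>n. Z \<le> n2of \<nu> n) sequentially"
    using eventually_ge_at_top[of m]
  proof eventually_elim
    case (elim n)
    have "\<nu> * real m \<le> \<nu> * real n" using elim assms by (intro mult_left_mono) auto
    then have "real Z + 1 \<le> \<nu> * real n" using m by linarith
    then have "int Z \<le> round (\<nu> * real n)"
      using of_int_round_ge[of "\<nu> * real n"] by linarith
    then show ?case unfolding n2of_def by linarith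
  qed
qed

lemma abs_mult_diff_le:
  fixes x y x' y' :: real
  assumes "\<bar>x - x'\<bar> \<le> e" "\<bar>y - y'\<bar> \<le> e" "\<bar>x\<bar> \<le> C" "\<bar>y\<bar> \<le> C" "e \<le> 1"
  shows "\<bar>x * y - x' * y'\<bar> \<le> e * (2 * C + 1)"
proof -
  have C: "0 \<le> C" "0 \<le> e" using assms by linarith+
  have "x * y - x' * y' = (x - x') * y + x' * (y - y')" by (simp add: algebra_simps)
  then have "\<bar>x * y - x' * y'\<bar> \<le> \<bar>x - x'\<bar> * \<bar>y\<bar> + \<bar>x'\<bar> * \<bar>y - y'\<bar>"
    by (metis abs_mult abs_triangle_ineq)
  also have "\<dots> \<le> e * C + (C + 1) * e"
    using assms C by (intro add_mono mult_mono) auto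
  finally show ?thesis by (simp add: algebra_simps)
qed

lemma kron_carrier:
  "X \<in> carrier_mat a a \<Longrightarrow> Y \<in> carrier_mat b b \<Longrightarrow> kron X Y \<in> carrier_mat (b * a) (b * a)"
  by (simp add: kron_def mult.commute)

lemma kron_index:
  "X \<in> carrier_mat a a \<Longrightarrow> Y \<in> carrier_mat b b \<Longrightarrow> r < b * a \<Longrightarrow> s < b * a \<Longrightarrow>
    kron X Y $$ (r, s) = X $$ (r div b, s div b) * Y $$ (r mod b, s mod b)"
  by (simp add: kron_def mult.commute)

lemma entry_mat_carrier:
  "Mmat Q mu n p \<in> carrier_mat (n + p - 2) (n + p - 2)" "Kmat Q mu n p \<in> carrier_mat (n + p - 2) (n + p - 2)"
  "Hmat Q mu n p \<in> carrier_mat (n + p - 2) (n + p - 2)"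
  by (simp_all add: Mmat_def Kmat_def Hmat_def)

lemma index_linear_combination:
  fixes A :: "real mat"
  assumes "A \<in> carrier_mat d d" "B \<in> carrier_mat d d" "C \<in> carrier_mat d d" "D \<in> carrier_mat d d" "E \<in> carrier_mat d d" "r < d" "s < d"
  shows "(x1 \<cdot>\<^sub>m A + x2 \<cdot>\<^sub>m B + x3 \<cdot>\<^sub>m C + x4 \<cdot>\<^sub>m D + x5 \<cdot>\<^sub>m E) $$ (r, s)
    = x1 * A $$ (r, s) + x2 * B $$ (r, s) + x3 * C $$ (r, s) + x4 * D $$ (r, s) + x5 * E $$ (r, s)"
  using assms by simp

text \<open>Direction 1 is the second Kronecker factor, so \<open>r mod N1\<close> is its index and
  \<open>r div N1\<close> that of direction 2, in agreement with \<open>offset\<close>.\<close>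

lemma Amat_index:
  fixes n1 p1 p2 :: nat and \<nu> :: real
  defines "n2 \<equiv> n2of \<nu> n1" and "N1 \<equiv> n1 + p1 - 2" and "N2 \<equiv> n2of \<nu> n1 + p2 - 2"
  assumes r: "r < N1 * N2" and s: "s < N1 * N2"
  shows "Amat Q \<alpha>1 \<alpha>2 p1 p2 \<beta>1 \<beta>2 \<gamma> \<nu> n1 $$ (r, s)
    = (1 / \<nu>) * (Mmat Q \<alpha>2 n2 p2 $$ (r div N1, s div N1) * Kmat Q \<alpha>1 n1 p1 $$ (r mod N1, s mod N1))
     + \<nu> * (Kmat Q \<alpha>2 n2 p2 $$ (r div N1, s div N1) * Mmat Q \<alpha>1 n1 p1 $$ (r mod N1, s mod N1))
     + (\<beta>1 / (\<nu> * real n1) * (Mmat Q \<alpha>2 n2 p2 $$ (r div N1, s div N1) * Hmat Q \<alpha>1 n1 p1 $$ (r mod N1, s mod N1))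
     + \<beta>2 / real n1 * (Hmat Q \<alpha>2 n2 p2 $$ (r div N1, s div N1) * Mmat Q \<alpha>1 n1 p1 $$ (r mod N1, s mod N1))
     + \<gamma> / (\<nu> * (real n1)\<^sup>2) * (Mmat Q \<alpha>2 n2 p2 $$ (r div N1, s div N1) * Mmat Q \<alpha>1 n1 p1 $$ (r mod N1, s mod N1)))"
proof -
  have ok: "kron X Y \<in> carrier_mat (N1 * N2) (N1 * N2)"
    "kron X Y $$ (r, s) = X $$ (r div N1, s div N1) * Y $$ (r mod N1, s mod N1)"
    if "X \<in> carrier_mat N2 N2" "Y \<in> carrier_mat N1 N1" for X Y :: "real mat"
    using kron_carrier[OF that] kron_index[OF that r s] by simp_all
  have c1: "Mmat Q \<alpha>1 n1 p1 \<in> carrier_mat N1 N1" "Kmat Q \<alpha>1 n1 p1 \<in> carrier_mat N1 N1" "Hmat Q \<alpha>1 n1 p1 \<in> carrier_mat N1 N1"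
    and c2: "Mmat Q \<alpha>2 n2 p2 \<in> carrier_mat N2 N2" "Kmat Q \<alpha>2 n2 p2 \<in> carrier_mat N2 N2" "Hmat Q \<alpha>2 n2 p2 \<in> carrier_mat N2 N2"
    unfolding N1_def N2_def n2_def by (rule entry_mat_carrier)+
  show ?thesis
    unfolding Amat_def Let_def n2_def[symmetric]
      index_linear_combination[OF ok(1)[OF c2(1) c1(2)] ok(1)[OF c2(2) c1(1)] ok(1)[OF c2(1) c1(3)]
        ok(1)[OF c2(3) c1(1)] ok(1)[OF c2(1) c1(1)] r s]
      ok(2)[OF c2(1) c1(2)] ok(2)[OF c2(2) c1(1)] ok(2)[OF c2(1) c1(3)] ok(2)[OF c2(3) c1(1)] ok(2)[OF c2(1) c1(1)]
    by (simp only: add.assoc)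
qed

lemma Amat_carrier:
  "Amat Q \<alpha>1 \<alpha>2 p1 p2 \<beta>1 \<beta>2 \<gamma> \<nu> n
    \<in> carrier_mat ((n + p1 - 2) * (n2of \<nu> n + p2 - 2)) ((n + p1 - 2) * (n2of \<nu> n + p2 - 2))"
  by (auto simp: Amat_def Let_def kron_def Mmat_def Kmat_def Hmat_def mult.commute)

text \<open>The limit entries of the two diffusion terms, and at the same time the Fourier
  coefficients of the symbol.\<close>

definition Asym :: "nat \<Rightarrow> nat \<Rightarrow> real \<Rightarrow> int \<times> int \<Rightarrow> real" where
  "Asym p1 p2 \<nu> w = (1 / \<nu>) * (msym p2 (snd w) * ksym p1 (fst w)) + \<nu> * (ksym p2 (snd w) * msym p1 (fst w))"

lemma Asym_fourier:
  assumes "p1 \<ge> 1" "p2 \<ge> 1" "p1 \<le> L" "p2 \<le> L"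
  shows "complex_of_real ((1 / \<nu>) * hsym p2 (fst \<theta>) * fsym p1 (snd \<theta>) + \<nu> * fsym p2 (fst \<theta>) * hsym p1 (snd \<theta>))
    = (\<Sum>w\<in>window L. complex_of_real (Asym p1 p2 \<nu> w) * fexp w \<theta>)"
proof -
  let ?S = "{- int L..int L}"
  let ?e = "\<lambda>k t. cis (of_int k * t)"
  have prod: "(\<Sum>x\<in>?S. complex_of_real (g x) * ?e x (snd \<theta>)) * (\<Sum>y\<in>?S. complex_of_real (f y) * ?e y (fst \<theta>))
      = (\<Sum>w\<in>window L. complex_of_real (f (snd w) * g (fst w)) * fexp w \<theta>)" for f g :: "int \<Rightarrow> real"
    unfolding sum_product window_def sum.cartesian_product
    by (intro sum.cong refl) (auto simp: fexp_def cis_mult[symmetric] mult.commute mult.left_commute)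
  have "(\<Sum>w\<in>window L. complex_of_real (Asym p1 p2 \<nu> w) * fexp w \<theta>)
     = complex_of_real (1 / \<nu>) * (\<Sum>w\<in>window L. complex_of_real (msym p2 (snd w) * ksym p1 (fst w)) * fexp w \<theta>)
      + complex_of_real \<nu> * (\<Sum>w\<in>window L. complex_of_real (ksym p2 (snd w) * msym p1 (fst w)) * fexp w \<theta>)"
    unfolding Asym_def of_real_add of_real_mult distrib_right sum.distrib sum_distrib_left mult.assoc ..
  also have "\<dots> = complex_of_real (1 / \<nu>) * (complex_of_real (fsym p1 (snd \<theta>)) * complex_of_real (hsym p2 (fst \<theta>)))
      + complex_of_real \<nu> * (complex_of_real (hsym p1 (snd \<theta>)) * complex_of_real (fsym p2 (fst \<theta>)))"
    unfolding prod[symmetric] hsym_fourier[OF assms(3)] hsym_fourier[OF assms(4)] fsym_fourier[OF assms(1,3)] fsym_fourier[OF assms(2,4)] ..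
  finally show ?thesis by (simp only: of_real_add of_real_mult mult.assoc mult.commute mult.left_commute)
qed

lemma lower_order_terms:
  assumes C: "\<bar>u\<bar> \<le> C" "\<bar>v\<bar> \<le> C" "\<bar>w\<bar> \<le> C" "\<bar>u'\<bar> \<le> C" "\<bar>v'\<bar> \<le> C" "\<bar>w'\<bar> \<le> (C::real)"
  shows "\<bar>a * (u * u') + b * (v * v') + c * (w * w')\<bar> \<le> (\<bar>a\<bar> + \<bar>b\<bar> + \<bar>c\<bar>) * (C * C)"
proof -
  have C0: "0 \<le> C" using C(1) by linarith
  have m: "\<bar>x * (y * z)\<bar> \<le> \<bar>x\<bar> * (C * C)" if "\<bar>y\<bar> \<le> C" "\<bar>z\<bar> \<le> C" for x y z
    unfolding abs_mult using that C0 by (intro mult_left_mono mult_mono) auto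
  show ?thesis
    unfolding distrib_right using m[OF C(1,4), of a] m[OF C(2,5), of b] m[OF C(3,6), of c] by linarith
qed

theorem theorem18:
  fixes p1 p2 :: nat and \<alpha>1 \<alpha>2 \<beta>1 \<beta>2 \<gamma> \<nu> :: real and Q :: gbkind
    and F :: "complex \<Rightarrow> complex"
  assumes "p1 \<ge> 1" "p2 \<ge> 1" "\<alpha>1 > 0" "\<alpha>2 > 0" "\<gamma> \<ge> 0" "\<nu> > 0"
    and "continuous_on UNIV F" and "compact (closure {z. F z \<noteq> 0})"
  shows "(\<lambda>n1. (\<Sum>z\<in>#eigvals (Amat Q \<alpha>1 \<alpha>2 p1 p2 \<beta>1 \<beta>2 \<gamma> \<nu> n1). F z)
                / of_nat ((n1 + p1 - 2) * (n2of \<nu> n1 + p2 - 2)))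
     \<longlonglongrightarrow> (1 / (4 * pi\<^sup>2)) *\<^sub>R integral (cbox (-pi, -pi) (pi, pi))
           (\<lambda>(\<theta>1, \<theta>2). F (complex_of_real
              ((1 / \<nu>) * hsym p2 \<theta>1 * fsym p1 \<theta>2 + \<nu> * fsym p2 \<theta>1 * hsym p1 \<theta>2)))"
proof -
  obtain C1 where C1: "C1 \<ge> 0" and E1: "\<And>e. e > 0 \<Longrightarrow> eventually (\<lambda>n. \<forall>i<n + p1 - 2. \<forall>j<n + p1 - 2. entries_ok Q \<alpha>1 p1 C1 e n i j) sequentially"
    using matrix_entries[OF assms(1,3), of Q] by blast
  obtain C2 where C2: "C2 \<ge> 0" and E2: "\<And>e. e > 0 \<Longrightarrow> eventually (\<lambda>n. \<forall>i<n + p2 - 2. \<forall>j<n + p2 - 2. entries_ok Q \<alpha>2 p2 C2 e n i j) sequentially"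
    using matrix_entries[OF assms(2,4), of Q] by blast
  define C where "C = max C1 C2"
  \<comment> \<open>One number for two purposes: it exceeds both half bandwidths and is the depth
    that \<open>entries_ok\<close> demands in both directions.\<close>
  define L where "L = 2 * max p1 p2"
  define N1 where "N1 = (\<lambda>n::nat. n + p1 - 2)"
  define N2 where "N2 = (\<lambda>n. n2of \<nu> n + p2 - 2)"
  define A where "A = Amat Q \<alpha>1 \<alpha>2 p1 p2 \<beta>1 \<beta>2 \<gamma> \<nu>"
  define M1 where "M1 = (\<lambda>n r s. Mmat Q \<alpha>1 n p1 $$ (r mod N1 n, s mod N1 n))"
  define K1 where "K1 = (\<lambda>n r s. Kmat Q \<alpha>1 n p1 $$ (r mod N1 n, s mod N1 n))"
  define H1 where "H1 = (\<lambda>n r s. Hmat Q \<alpha>1 n p1 $$ (r mod N1 n, s mod N1 n))"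
  define M2 where "M2 = (\<lambda>n r s. Mmat Q \<alpha>2 (n2of \<nu> n) p2 $$ (r div N1 n, s div N1 n))"
  define K2 where "K2 = (\<lambda>n r s. Kmat Q \<alpha>2 (n2of \<nu> n) p2 $$ (r div N1 n, s div N1 n))"
  define H2 where "H2 = (\<lambda>n r s. Hmat Q \<alpha>2 (n2of \<nu> n) p2 $$ (r div N1 n, s div N1 n))"
  \<comment> \<open>Advection and reaction. The prefactors tend to 0, so a bound \<open>b n\<close>
    on this part suffices; the asymmetry of \<open>A\<close> comes from here alone.\<close>
  define T where "T = (\<lambda>n r s. \<beta>1 / (\<nu> * real n) * (M2 n r s * H1 n r s) + \<beta>2 / real n * (H2 n r s * M1 n r s)
      + \<gamma> / (\<nu> * (real n)\<^sup>2) * (M2 n r s * M1 n r s))"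
  define b where "b = (\<lambda>n::nat. (\<bar>\<beta>1 / (\<nu> * real n)\<bar> + \<bar>\<beta>2 / real n\<bar> + \<bar>\<gamma> / (\<nu> * (real n)\<^sup>2)\<bar>) * (C * C))"
  have C0: "C \<ge> 0" using C1 by (simp add: C_def)
  have A: "A n $$ (r, s) = (1 / \<nu>) * (M2 n r s * K1 n r s) + \<nu> * (K2 n r s * M1 n r s) + T n r s"
    if "r < N1 n * N2 n" "s < N1 n * N2 n" for n r s
    using Amat_index[of r n p1 \<nu> p2 s Q \<alpha>1 \<alpha>2 \<beta>1 \<beta>2 \<gamma>] that
    unfolding A_def M1_def K1_def H1_def M2_def K2_def H2_def T_def N1_def N2_def by simp
  have lim2: "filterlim (n2of \<nu>) at_top sequentially" by (rule filterlim_n2of[OF assms(6)])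
  \<comment> \<open>The one-dimensional facts of both directions, transferred to flat
    indices.\<close>
  define G where "G = (\<lambda>e n r s. \<bar>M1 n r s\<bar> \<le> C \<and> \<bar>K1 n r s\<bar> \<le> C \<and> \<bar>H1 n r s\<bar> \<le> C \<and> \<bar>M2 n r s\<bar> \<le> C \<and> \<bar>K2 n r s\<bar> \<le> C \<and> \<bar>H2 n r s\<bar> \<le> C \<and>
      M1 n r s = M1 n s r \<and> K1 n r s = K1 n s r \<and> M2 n r s = M2 n s r \<and> K2 n r s = K2 n s r \<and>
      (\<bar>fst (offset (N1 n) r s)\<bar> > int p1 \<longrightarrow> M1 n r s = 0 \<and> K1 n r s = 0 \<and> H1 n r s = 0) \<and>
      (\<bar>snd (offset (N1 n) r s)\<bar> > int p2 \<longrightarrow> M2 n r s = 0 \<and> K2 n r s = 0 \<and> H2 n r s = 0) \<and>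
      (deep L (N1 n) (N2 n) s \<longrightarrow>
        \<bar>M1 n r s - msym p1 (fst (offset (N1 n) r s))\<bar> \<le> e \<and> \<bar>K1 n r s - ksym p1 (fst (offset (N1 n) r s))\<bar> \<le> e \<and>
        \<bar>M2 n r s - msym p2 (snd (offset (N1 n) r s))\<bar> \<le> e \<and> \<bar>K2 n r s - ksym p2 (snd (offset (N1 n) r s))\<bar> \<le> e))"
  have ev: "eventually (\<lambda>n. \<forall>r<N1 n * N2 n. \<forall>s<N1 n * N2 n. G e n r s) sequentially"
    if e: "e > 0" for e
    using E1[OF e] eventually_compose_filterlim[OF E2[OF e] lim2]
  proof eventually_elim
    case (elim n)
    show ?case
    proof (intro allI impI)
      fix r s assume rs: "r < N1 n * N2 n" "s < N1 n * N2 n"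
      have pos: "N1 n > 0" using rs by (cases "N1 n") auto
      have m: "r mod N1 n < n + p1 - 2" "s mod N1 n < n + p1 - 2" using pos unfolding N1_def by auto
      have d: "r div N1 n < n2of \<nu> n + p2 - 2" "s div N1 n < n2of \<nu> n + p2 - 2"
        using rs unfolding N2_def by (auto simp: less_mult_imp_div_less mult.commute)
      note e1 = elim(1)[THEN spec, THEN mp, OF m(1), THEN spec, THEN mp, OF m(2), unfolded entries_ok_def]
        and e2 = elim(2)[THEN spec, THEN mp, OF d(1), THEN spec, THEN mp, OF d(2), unfolded entries_ok_def]
      have o: "fst (offset (N1 n) r s) = int (r mod N1 n) - int (s mod N1 n)"
        "snd (offset (N1 n) r s) = int (r div N1 n) - int (s div N1 n)" by (simp_all add: offset_def)
      have dp: "2 * p1 \<le> s mod N1 n \<and> s mod N1 n + 2 * p1 < n + p1 - 2"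
        "2 * p2 \<le> s div N1 n \<and> s div N1 n + 2 * p2 < n2of \<nu> n + p2 - 2" if "deep L (N1 n) (N2 n) s"
      proof -
        have "2 * p1 \<le> L" "2 * p2 \<le> L" by (auto simp: L_def)
        moreover have "L \<le> s mod N1 n" "s mod N1 n + L < n + p1 - 2" "L \<le> s div N1 n" "s div N1 n + L < n2of \<nu> n + p2 - 2"
          using that unfolding deep_def N2_def by (auto simp: N1_def)
        ultimately show "2 * p1 \<le> s mod N1 n \<and> s mod N1 n + 2 * p1 < n + p1 - 2"
          "2 * p2 \<le> s div N1 n \<and> s div N1 n + 2 * p2 < n2of \<nu> n + p2 - 2" by linarith+
      qed
      have c: "x \<le> C1 \<Longrightarrow> x \<le> C" "x \<le> C2 \<Longrightarrow> x \<le> C" for x by (auto simp: C_def)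
      show "G e n r s"
        unfolding G_def o M1_def K1_def H1_def M2_def K2_def H2_def
        using e1 e2 dp c by blast
    qed
  qed
  have blim: "b \<longlonglongrightarrow> 0"
  proof -
    have "(\<lambda>n. (\<bar>\<beta>1 / \<nu> * (1 / real n)\<bar> + \<bar>\<beta>2 * (1 / real n)\<bar> + \<bar>\<gamma> / \<nu> * ((1 / real n) * (1 / real n))\<bar>) * (C * C))
       \<longlonglongrightarrow> (\<bar>\<beta>1 / \<nu> * 0\<bar> + \<bar>\<beta>2 * 0\<bar> + \<bar>\<gamma> / \<nu> * (0 * 0)\<bar>) * (C * C)"
      by (intro tendsto_intros lim_1_over_n)
    then show ?thesis unfolding b_def by (simp add: power2_eq_square)
  qed
  have bev: "eventually (\<lambda>n. b n \<le> e) sequentially" if "e > 0" for e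
    using order_tendstoD(2)[OF blim that] by (rule eventually_mono) simp
  have one: "(0::real) < 1" by simp
  have Tb: "\<bar>T n r s\<bar> \<le> b n" if "G e n r s" for e n r s
  proof -
    have "\<bar>M2 n r s\<bar> \<le> C" "\<bar>H2 n r s\<bar> \<le> C" "\<bar>H1 n r s\<bar> \<le> C" "\<bar>M1 n r s\<bar> \<le> C"
      using that unfolding G_def by blast+
    then show ?thesis unfolding T_def b_def by (intro lower_order_terms)
  qed
  have scaled: "\<bar>x * y\<bar> \<le> x * z" if "x > 0" "\<bar>y\<bar> \<le> z" for x y z :: real
    unfolding abs_mult using that by (simp add: mult_left_mono)
  have prod: "\<bar>y * z\<bar> \<le> C * C" if "\<bar>y\<bar> \<le> C" "\<bar>z\<bar> \<le> C" for y z
    unfolding abs_mult using that C0 by (intro mult_mono) auto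
  have \<nu>': "1 / \<nu> > 0" using assms(6) by simp
  \<comment> \<open>The two diffusion terms, plus 1 for the lower-order part, which is eventually at
    most 1.\<close>
  define C' where "C' = (1 / \<nu>) * (C * C) + \<nu> * (C * C) + 1"
  interpret asymptotic_toeplitz A N1 N2 L C' "Asym p1 p2 \<nu>"
  proof
    show "A n \<in> carrier_mat (N1 n * N2 n) (N1 n * N2 n)" for n
      unfolding A_def N1_def N2_def by (rule Amat_carrier)
    have shift: "filterlim (\<lambda>n::nat. n + k - 2) at_top sequentially" for k
      by (rule filterlim_at_top_mono[OF filterlim_minus_const_nat_at_top[of 2]]) (auto intro!: always_eventually)
    show "filterlim N1 at_top sequentially" unfolding N1_def by (rule shift)
    show "filterlim N2 at_top sequentially" unfolding N2_def by (rule filterlim_compose[OF shift lim2])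
  next
    show "eventually (\<lambda>n. \<forall>r<N1 n * N2 n. \<forall>s<N1 n * N2 n. offset (N1 n) r s \<notin> window L \<longrightarrow> A n $$ (r, s) = 0) sequentially"
      using ev[OF one]
    proof eventually_elim
      case (elim n)
      show ?case
      proof (intro allI impI)
        fix r s assume rs: "r < N1 n * N2 n" "s < N1 n * N2 n" and off: "offset (N1 n) r s \<notin> window L"
        have "int p1 \<le> int L" "int p2 \<le> int L" by (auto simp: L_def)
        then have "\<bar>fst (offset (N1 n) r s)\<bar> > int p1 \<or> \<bar>snd (offset (N1 n) r s)\<bar> > int p2"
          using off unfolding window_def mem_Times_iff atLeastAtMost_iff by linarith
        then have "M1 n r s = 0 \<and> K1 n r s = 0 \<and> H1 n r s = 0 \<or> M2 n r s = 0 \<and> K2 n r s = 0 \<and> H2 n r s = 0"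
          using elim[THEN spec, THEN mp, OF rs(1), THEN spec, THEN mp, OF rs(2), unfolded G_def] by blast
        then show "A n $$ (r, s) = 0" unfolding A[OF rs] T_def by auto
      qed
    qed
  next
    show "eventually (\<lambda>n. \<forall>r<N1 n * N2 n. \<forall>s<N1 n * N2 n. \<bar>A n $$ (r, s)\<bar> \<le> C') sequentially"
      using ev[OF one] bev[OF one]
    proof eventually_elim
      case (elim n)
      show ?case
      proof (intro allI impI)
        fix r s assume rs: "r < N1 n * N2 n" "s < N1 n * N2 n"
        note el = elim(1)[THEN spec, THEN mp, OF rs(1), THEN spec, THEN mp, OF rs(2), unfolded G_def]
        have "\<bar>T n r s\<bar> \<le> b n" by (rule Tb[OF elim(1)[THEN spec, THEN mp, OF rs(1), THEN spec, THEN mp, OF rs(2)]])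
        moreover have "\<bar>(1 / \<nu>) * (M2 n r s * K1 n r s)\<bar> \<le> (1 / \<nu>) * (C * C)"
          using el by (intro scaled[OF \<nu>'] prod) blast+
        moreover have "\<bar>\<nu> * (K2 n r s * M1 n r s)\<bar> \<le> \<nu> * (C * C)"
          using el by (intro scaled[OF assms(6)] prod) blast+
        ultimately show "\<bar>A n $$ (r, s)\<bar> \<le> C'" unfolding A[OF rs] C'_def using elim(2) by linarith
      qed
    qed
  next
    fix e :: real assume e: "e > 0"
    \<comment> \<open>Each diffusion product is off by at most \<open>e' * (2 * C + 1)\<close>; half
      of \<open>e\<close> is reserved for the lower-order part.\<close>
    define D where "D = (1 / \<nu> + \<nu>) * (2 * C + 1)"
    have "2 * C + 1 > 0" using C0 by linarith
    then have D: "D > 0" unfolding D_def using assms(6) by (intro mult_pos_pos[OF add_pos_pos]) auto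
    define e' where "e' = min 1 (e / 2 / D)"
    have e': "e' > 0" "e' \<le> 1" "e' * D \<le> e / 2"
    proof -
      show "e' > 0" "e' \<le> 1" using e D by (auto simp: e'_def)
      have "e' * D \<le> (e / 2 / D) * D" using D by (intro mult_right_mono) (auto simp: e'_def)
      then show "e' * D \<le> e / 2" using D by simp
    qed
    have e2: "e / 2 > 0" using e by simp
    show "eventually (\<lambda>n. \<forall>r<N1 n * N2 n. \<forall>s<N1 n * N2 n. deep L (N1 n) (N2 n) s \<longrightarrow> offset (N1 n) r s \<in> window L
         \<longrightarrow> \<bar>A n $$ (r, s) - Asym p1 p2 \<nu> (offset (N1 n) r s)\<bar> \<le> e) sequentially"
      using ev[OF e'(1)] bev[OF e2]
    proof eventually_elim
      case (elim n)
      show ?case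
      proof (intro allI impI)
        fix r s assume rs: "r < N1 n * N2 n" "s < N1 n * N2 n" and dp: "deep L (N1 n) (N2 n) s"
        note el = elim(1)[THEN spec, THEN mp, OF rs(1), THEN spec, THEN mp, OF rs(2), unfolded G_def]
        let ?w = "offset (N1 n) r s"
        have t: "\<bar>T n r s\<bar> \<le> b n" by (rule Tb[OF elim(1)[THEN spec, THEN mp, OF rs(1), THEN spec, THEN mp, OF rs(2)]])
        have x: "\<bar>M2 n r s * K1 n r s - msym p2 (snd ?w) * ksym p1 (fst ?w)\<bar> \<le> e' * (2 * C + 1)"
          using el dp e'(2) by (intro abs_mult_diff_le) blast+
        have y: "\<bar>K2 n r s * M1 n r s - ksym p2 (snd ?w) * msym p1 (fst ?w)\<bar> \<le> e' * (2 * C + 1)"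
          using el dp e'(2) by (intro abs_mult_diff_le) blast+
        have "A n $$ (r, s) - Asym p1 p2 \<nu> ?w = (1 / \<nu>) * (M2 n r s * K1 n r s - msym p2 (snd ?w) * ksym p1 (fst ?w))
            + \<nu> * (K2 n r s * M1 n r s - ksym p2 (snd ?w) * msym p1 (fst ?w)) + T n r s"
          unfolding A[OF rs] Asym_def right_diff_distrib by linarith
        also have "\<bar>\<dots>\<bar> \<le> (1 / \<nu>) * (e' * (2 * C + 1)) + \<nu> * (e' * (2 * C + 1)) + b n"
        proof -
          have "\<bar>(1 / \<nu>) * (M2 n r s * K1 n r s - msym p2 (snd ?w) * ksym p1 (fst ?w))\<bar> \<le> (1 / \<nu>) * (e' * (2 * C + 1))"
            by (rule scaled[OF \<nu>' x])
          moreover have "\<bar>\<nu> * (K2 n r s * M1 n r s - ksym p2 (snd ?w) * msym p1 (fst ?w))\<bar> \<le> \<nu> * (e' * (2 * C + 1))"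
            by (rule scaled[OF assms(6) y])
          ultimately show ?thesis using t by linarith
        qed
        also have "(1 / \<nu>) * (e' * (2 * C + 1)) + \<nu> * (e' * (2 * C + 1)) = e' * D"
          unfolding D_def by (simp only: distrib_right mult.assoc mult.left_commute distrib_left)
        finally show "\<bar>A n $$ (r, s) - Asym p1 p2 \<nu> ?w\<bar> \<le> e" using e'(3) elim(2) by linarith
      qed
    qed
    show "eventually (\<lambda>n. \<forall>r<N1 n * N2 n. \<forall>s<N1 n * N2 n. \<bar>A n $$ (r, s) - A n $$ (s, r)\<bar> \<le> e) sequentially"
      using ev[OF one] bev[OF e2]
    proof eventually_elim
      case (elim n)
      show ?case
      proof (intro allI impI)
        fix r s assume rs: "r < N1 n * N2 n" "s < N1 n * N2 n"
        note el = elim(1)[THEN spec, THEN mp, OF rs(1), THEN spec, THEN mp, OF rs(2), unfolded G_def]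
        have "\<bar>T n r s\<bar> \<le> b n" by (rule Tb[OF elim(1)[THEN spec, THEN mp, OF rs(1), THEN spec, THEN mp, OF rs(2)]])
        moreover have "\<bar>T n s r\<bar> \<le> b n" by (rule Tb[OF elim(1)[THEN spec, THEN mp, OF rs(2), THEN spec, THEN mp, OF rs(1)]])
        moreover have "M1 n r s = M1 n s r" "K1 n r s = K1 n s r" "M2 n r s = M2 n s r" "K2 n r s = K2 n s r"
          using el by blast+
        then have "A n $$ (r, s) - A n $$ (s, r) = T n r s - T n s r"
          unfolding A[OF rs] A[OF rs(2,1)] by simp
        ultimately show "\<bar>A n $$ (r, s) - A n $$ (s, r)\<bar> \<le> e" using elim(2) by linarith
      qed
    qed
  qed
  have L: "p1 \<le> L" "p2 \<le> L" by (auto simp: L_def)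
  from eigenvalue_distribution[OF assms(7) Asym_fourier[OF assms(1,2) L]]
  show ?thesis unfolding A_def N1_def N2_def by (simp add: case_prod_unfold)
qed

end
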